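(* Let $1<p<\infty$. Let $\varphi:\mathbb{D}\to\mathbb{D}$ be a holomorphic function such that there exists a hyperbolic holomorphic semiflow $(\varphi_t)_{t\ge0}$ with $\varphi=\varphi_1$. Let $\Omega$ be its Koenigs domain and assume that $\operatorname{int}(\overline{\Omega})=\Omega$ and that $\mathbb{C}\setminus\overline{\Omega}$ has at most two connected components. Let $\gamma$ be the width of the smallest horizontal strip containing $\Omega$. Assume further that $\Omega$ does not contain any horizontal strip and that there exists $C>0$ such that, for the operator norm on $\mathcal{L}(H^p)$, $$\|q(C_\varphi)\|\le C\cdot\sup\left\{|q(z)| : |z|\le e^{\frac{\pi}{p\gamma}}\right\}$$ for every polynomial $q\in\mathbb{C}[z]$. Then $C_\varphi\in\mathcal{L}(H^p)$ has the double commutant property.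
   Context: $\mathbb{D}$ is the open unit disc of $\mathbb{C}$ and $\mathbb{T}$ the unit circle. For $1\le p<\infty$, $H^p$ is the Banach space of holomorphic $f:\mathbb{D}\to\mathbb{C}$ with $\|f\|_{H^p}=\left(\sup_{0<r<1}\int_0^{2\pi}|f(re^{i\theta})|^p\,d\theta\right)^{1/p}<\infty$. For holomorphic $\varphi:\mathbb{D}\to\mathbb{D}$, $C_\varphi f=f\circ\varphi$, a bounded operator on $H^p$. For a complex Banach space $X$, $\mathcal{L}(X)$ is the algebra of bounded linear operators on $X$. For $T\in\mathcal{L}(X)$, $\{T\}'=\{A\in\mathcal{L}(X):AT=TA\}$, $\{T\}''=\bigcap_{A\in\{T\}'}\{A\}'$, and $\operatorname{alg}(T)=\{q(T): q \text{ a complex polynomial}\}$. $T$ has the double commutant property if the closure of $\operatorname{alg}(T)$ in the weak operator topology equals $\{T\}''$. Semiflows. A holomorphic semiflow is a family $(\varphi_t)_{t\ge0}$ of holomorphic self-maps of $\mathbb{D}$ with $\varphi_0(z)=z$, $\varphi_{t+s}=\varphi_t\circ\varphi_s$ for all $t,s\geq 0$, and $\varphi_t\to\varphi_s$ uniformly on compact subsets of $\mathbb{D}$ as $t\to s$. It is elliptic if $\varphi_{t_0}(z_0)=z_0$ for some $t_0>0$ and $z_0\in\mathbb{D}$. If it is not elliptic, there is a unique $\tau\in\mathbb{T}$ (the Denjoy–Wolff point) such that $\varphi_t\to\tau$ uniformly on compact subsets as $t\to\infty$, and there is $\alpha\le 0$ such that $\varphi_t'$ has non-tangential limit $e^{t\alpha}$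 at $\tau$ for all $t\geq 0$; the semiflow is hyperbolic if $\alpha<0$ and parabolic if $\alpha=0$. For a non-elliptic semiflow there is a univalent function $h:\mathbb{D}\to\mathbb{C}$ (the Koenigs function), unique up to an additive constant, with $\varphi_t(z)=h^{-1}(h(z)+t)$ for all $z\in\mathbb{D}$, $t\ge0$. The Koenigs domain is $\Omega=h(\mathbb{D})$. A non-elliptic semiflow is hyperbolic if and only if $\Omega$ is contained in a horizontal strip $\{w: a<\operatorname{Im}(w)<b\}$ with $-\infty<a<b<\infty$, whose width is $b-a$. Interior and closure are taken in $\mathbb{C}$. *)

theory Defs
  imports "HOL-Complex_Analysis.Complex_Analysis" "HOL-Library.FuncSet"
begin

section \<open>Operators on complex normed spaces\<close>

text \<open>A complex normed space is given by a carrier \<open>X\<close> of complex-valued functions, with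
  the pointwise vector space operations, together with a norm \<open>N\<close> on \<open>X\<close>.
  Operators on \<open>X\<close> are \<open>undefined\<close> outside of \<open>X\<close> (as in \<^const>\<open>PiE\<close>), so that
  equality of operators is equality on \<open>X\<close>.\<close>

type_synonym 'a vec = "'a \<Rightarrow> complex"

definition bounded_ops :: "'a vec set \<Rightarrow> ('a vec \<Rightarrow> real) \<Rightarrow> ('a vec \<Rightarrow> 'a vec) set" where
  "bounded_ops X N = {A. A \<in> X \<rightarrow>\<^sub>E X
     \<and> (\<forall>f\<in>X. \<forall>g\<in>X. A (\<lambda>z. f z + g z) = (\<lambda>z. A f z + A g z))
     \<and> (\<forall>c. \<forall>f\<in>X. A (\<lambda>z. c * f z) = (\<lambda>z. c * A f z))
     \<and> (\<exists>K. \<forall>f\<in>X. N (A f) \<le> K * N f)}"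

definition bounded_functionals :: "'a vec set \<Rightarrow> ('a vec \<Rightarrow> real) \<Rightarrow> ('a vec \<Rightarrow> complex) set" where
  "bounded_functionals X N = {l.
       (\<forall>f\<in>X. \<forall>g\<in>X. l (\<lambda>z. f z + g z) = l f + l g)
     \<and> (\<forall>c. \<forall>f\<in>X. l (\<lambda>z. c * f z) = c * l f)
     \<and> (\<exists>K. \<forall>f\<in>X. norm (l f) \<le> K * N f)}"

text \<open>This is the operator norm only for \<open>A \<in> bounded_ops X N\<close>; otherwise the
  supremum may be that of an unbounded set.\<close>

definition op_norm :: "'a vec set \<Rightarrow> ('a vec \<Rightarrow> real) \<Rightarrow> ('a vec \<Rightarrow> 'a vec) \<Rightarrow> real" where
  "op_norm X N A = (SUP f\<in>{f\<in>X. N f \<le> 1}. N (A f))"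

definition poly_op :: "'a vec set \<Rightarrow> complex poly \<Rightarrow> ('a vec \<Rightarrow> 'a vec) \<Rightarrow> 'a vec \<Rightarrow> 'a vec" where
  "poly_op X q T = (\<lambda>f\<in>X. \<lambda>z. \<Sum>i\<le>degree q. coeff q i * (T ^^ i) f z)"

definition alg_op :: "'a vec set \<Rightarrow> ('a vec \<Rightarrow> 'a vec) \<Rightarrow> ('a vec \<Rightarrow> 'a vec) set" where
  "alg_op X T = {poly_op X q T | q. True}"

definition commutant ::
    "'a vec set \<Rightarrow> ('a vec \<Rightarrow> real) \<Rightarrow> ('a vec \<Rightarrow> 'a vec) \<Rightarrow> ('a vec \<Rightarrow> 'a vec) set" where
  "commutant X N T = {A \<in> bounded_ops X N. \<forall>f\<in>X. A (T f) = T (A f)}"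

definition bicommutant ::
    "'a vec set \<Rightarrow> ('a vec \<Rightarrow> real) \<Rightarrow> ('a vec \<Rightarrow> 'a vec) \<Rightarrow> ('a vec \<Rightarrow> 'a vec) set" where
  "bicommutant X N T = (\<Inter>A\<in>commutant X N T. commutant X N A)"

text \<open>The coarsest topology on \<open>bounded_ops X N\<close> for which all maps \<open>A \<mapsto> l (A f)\<close>
  are continuous.\<close>

definition weak_operator_topology ::
    "'a vec set \<Rightarrow> ('a vec \<Rightarrow> real) \<Rightarrow> ('a vec \<Rightarrow> 'a vec) topology" where
  "weak_operator_topology X N = topology_generated_by
     {{A \<in> bounded_ops X N. l (A f) \<in> U} | l f U.
        l \<in> bounded_functionals X N \<and> f \<in> X \<and> open U}"

definition double_commutant_property ::
    "'a vec set \<Rightarrow> ('a vec \<Rightarrow> real) \<Rightarrow> ('a vec \<Rightarrow> 'a vec) \<Rightarrow> bool" where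
  "double_commutant_property X N T \<longleftrightarrow>
     T \<in> bounded_ops X N \<and>
     weak_operator_topology X N closure_of alg_op X T = bicommutant X N T"


section \<open>Hardy spaces and composition operators\<close>

abbreviation unit_disc :: "complex set" ("\<D>") where
  "\<D> \<equiv> ball 0 1"

definition Hp_mean :: "real \<Rightarrow> (complex \<Rightarrow> complex) \<Rightarrow> real \<Rightarrow> real" where
  "Hp_mean p f r = integral {0..2*pi} (\<lambda>\<theta>. norm (f (of_real r * cis \<theta>)) powr p)"

text \<open>A function on the disc is represented by its extension by zero to the plane.\<close>

definition Hp :: "real \<Rightarrow> (complex \<Rightarrow> complex) set" where
  "Hp p = {f. f holomorphic_on \<D> \<and> (\<forall>z. z \<notin> \<D> \<longrightarrow> f z = 0)
              \<and> bdd_above (Hp_mean p f ` {0<..<1})}"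

definition Hp_norm :: "real \<Rightarrow> (complex \<Rightarrow> complex) \<Rightarrow> real" where
  "Hp_norm p f = (SUP r\<in>{0<..<1}. Hp_mean p f r) powr (1 / p)"

definition comp_op ::
    "real \<Rightarrow> (complex \<Rightarrow> complex) \<Rightarrow> (complex \<Rightarrow> complex) \<Rightarrow> complex \<Rightarrow> complex" where
  "comp_op p \<phi> = (\<lambda>f\<in>Hp p. \<lambda>z. if z \<in> \<D> then f (\<phi> z) else 0)"


section \<open>Holomorphic semiflows of the disc\<close>

text \<open>Semiflows are indexed by \<open>real\<close>; only the values \<open>\<Phi> t z\<close> with \<open>t \<ge> 0\<close> and
  \<open>z \<in> \<D>\<close> matter.\<close>

definition holomorphic_semiflow :: "(real \<Rightarrow> complex \<Rightarrow> complex) \<Rightarrow> bool" where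
  "holomorphic_semiflow \<Phi> \<longleftrightarrow>
     (\<forall>t\<ge>0. \<Phi> t holomorphic_on \<D> \<and> \<Phi> t ` \<D> \<subseteq> \<D>) \<and>
     (\<forall>z\<in>\<D>. \<Phi> 0 z = z) \<and>
     (\<forall>t\<ge>0. \<forall>s\<ge>0. \<forall>z\<in>\<D>. \<Phi> (t + s) z = \<Phi> t (\<Phi> s z)) \<and>
     (\<forall>s\<ge>0. \<forall>K. compact K \<and> K \<subseteq> \<D> \<longrightarrow> uniform_limit K \<Phi> (\<Phi> s) (at s within {0..}))"

definition elliptic_semiflow :: "(real \<Rightarrow> complex \<Rightarrow> complex) \<Rightarrow> bool" where
  "elliptic_semiflow \<Phi> \<longleftrightarrow> holomorphic_semiflow \<Phi> \<and> (\<exists>t>0. \<exists>z\<in>\<D>. \<Phi> t z = z)"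

definition Denjoy_Wolff_point :: "(real \<Rightarrow> complex \<Rightarrow> complex) \<Rightarrow> complex \<Rightarrow> bool" where
  "Denjoy_Wolff_point \<Phi> \<tau> \<longleftrightarrow> norm \<tau> = 1 \<and>
     (\<forall>K. compact K \<and> K \<subseteq> \<D> \<longrightarrow> uniform_limit K \<Phi> (\<lambda>_. \<tau>) at_top)"

definition Stolz_region :: "complex \<Rightarrow> real \<Rightarrow> complex set" where
  "Stolz_region \<tau> M = {z \<in> \<D>. norm (\<tau> - z) < M * (1 - norm z)}"

definition nontangential_limit :: "(complex \<Rightarrow> complex) \<Rightarrow> complex \<Rightarrow> complex \<Rightarrow> bool" where
  "nontangential_limit f \<tau> l \<longleftrightarrow> (\<forall>M>1. (f \<longlongrightarrow> l) (at \<tau> within Stolz_region \<tau> M))"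

definition hyperbolic_semiflow :: "(real \<Rightarrow> complex \<Rightarrow> complex) \<Rightarrow> bool" where
  "hyperbolic_semiflow \<Phi> \<longleftrightarrow> holomorphic_semiflow \<Phi> \<and> \<not> elliptic_semiflow \<Phi> \<and>
     (\<exists>\<tau> \<alpha>. Denjoy_Wolff_point \<Phi> \<tau> \<and> \<alpha> < 0 \<and>
        (\<forall>t\<ge>0. nontangential_limit (deriv (\<Phi> t)) \<tau> (of_real (exp (t * \<alpha>)))))"

definition Koenigs_function ::
    "(real \<Rightarrow> complex \<Rightarrow> complex) \<Rightarrow> (complex \<Rightarrow> complex) \<Rightarrow> bool" where
  "Koenigs_function \<Phi> h \<longleftrightarrow> h holomorphic_on \<D> \<and> inj_on h \<D> \<and>
     (\<forall>t\<ge>0. \<forall>z\<in>\<D>. h z + of_real t \<in> h ` \<D> \<and> \<Phi> t z = inv_into \<D> h (h z + of_real t))"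

definition horizontal_strip :: "real \<Rightarrow> real \<Rightarrow> complex set" where
  "horizontal_strip a b = {w. a < Im w \<and> Im w < b}"

definition smallest_horizontal_strip :: "complex set \<Rightarrow> real \<Rightarrow> real \<Rightarrow> bool" where
  "smallest_horizontal_strip \<Omega> a b \<longleftrightarrow> a < b \<and> \<Omega> \<subseteq> horizontal_strip a b \<and>
     (\<forall>a' b'. a' < b' \<and> \<Omega> \<subseteq> horizontal_strip a' b'
        \<longrightarrow> horizontal_strip a b \<subseteq> horizontal_strip a' b')"

end

theory Submission
  imports Defs
begin

text \<open>
  The functions \<open>exp (\<mu> * h)\<close> are eigenvectors of all \<open>comp_op p (\<Phi> t)\<close>, with eigenvalues \<open>exp (\<mu> * t)\<close>.
  They lie in \<open>Hp\<close> for \<open>Re \<mu> < pi / (p * \<gamma>)\<close>: harmonic majorants come from the width of the strip if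
  \<open>Re \<mu> \<ge> 0\<close>, and otherwise from the fact that \<open>\<Omega>\<close> becomes arbitrarily thin to the left.

  They span a dense subspace. Its closure is invariant under multiplication by \<open>1 / (h - w)\<close> for \<open>w\<close>
  above or below the strip, hence, by pushing poles, for all \<open>w\<close> outside the closure of \<open>\<Omega>\<close>, since every
  component of that complement contains one of the two half planes. By Runge approximation it is then
  invariant under \<open>f \<circ> h\<close> for bounded \<open>f\<close> holomorphic near the closure of \<open>\<Omega>\<close>. Taking for \<open>f\<close> the
  Riemann maps of shrinking neighbourhoods of \<open>\<Omega>\<close>, the functions \<open>f \<circ> h\<close> tend to the identity of the
  disc, because \<open>\<Omega>\<close> is the interior of its closure. So the closure contains the polynomials.

  An operator \<open>A\<close> in the bicommutant commutes with \<open>comp_op p (\<Phi> t)\<close> and with multiplication by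
  \<open>exp (2 * pi * \<i> * h)\<close>. Therefore \<open>A\<close> acts on \<open>exp (\<mu> * h)\<close> as a scalar \<open>G (exp \<mu>)\<close>, where \<open>G\<close> is bounded
  and holomorphic on the disc of radius \<open>exp (pi / (p * \<gamma>))\<close>. Polynomials that are uniformly bounded on
  this disc and tend to \<open>G\<close> pointwise yield, by the norm hypothesis, bounded polynomials in the
  operator which converge to \<open>A\<close> on the eigenvectors, hence everywhere.\<close>


section \<open>Hardy spaces on the disc\<close>

text \<open>The absence of strips in \<Omega> is what makes polynomials sufficient: it lets
  \<open>Re \<mu>\<close> tend to minus infinity, so that the eigenvalues \<open>exp \<mu>\<close>
  fill a punctured disc and the bounded function \<open>G\<close> extends over 0. On an annulus,
  polynomials would not approximate all bounded holomorphic functions. The main obstacle is that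
  \<open>h\<close> is unbounded. Limits of multipliers are therefore taken uniformly on the sets
  \<open>norm h \<le> R\<close> only, with a common bound, and Runge's theorem is carried out on an
  infinite grid for functions that decay quadratically. Membership of the closed span is an
  inductive predicate with a rule for limits, so that invariance and convergence are proved by
  induction. Since only boundedness and convergence matter, a triangle inequality with the factor 2
  replaces Minkowski's; homogeneity of the norm, in contrast, is exact. Density of the polynomials
  rests on dilations and uniform convexity instead of boundary values, and there
  \<open>1 < p\<close> enters.\<close>

lemma circle_in_disc: "0 \<le> r \<Longrightarrow> r < 1 \<Longrightarrow> of_real r * cis t \<in> \<D>"
  by (simp add: norm_mult)

lemma continuous_on_circle:
  assumes "f holomorphic_on S" "\<And>t. t \<in> A \<Longrightarrow> of_real r * cis t \<in> S"
  shows "continuous_on A (\<lambda>t. f (of_real r * cis t))"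
  using assms by (intro continuous_on_compose2[OF holomorphic_on_imp_continuous_on[OF assms(1)]] continuous_intros) auto

lemma continuous_on_norm_powr:
  fixes g :: "_ \<Rightarrow> complex"
  assumes "continuous_on A g" "0 < p"
  shows "continuous_on A (\<lambda>t. norm (g t) powr p)"
  using assms by (intro continuous_on_powr' continuous_intros) auto

lemma Hp_mean_integrable:
  assumes "f holomorphic_on \<D>" "0 < p" "0 \<le> r" "r < 1"
  shows "(\<lambda>t. norm (f (of_real r * cis t)) powr p) integrable_on {0..2*pi}"
  using assms
  by (intro integrable_continuous_real continuous_on_norm_powr continuous_on_circle[of f \<D>]) (auto simp: norm_mult)

lemma Hp_mean_nonneg: "0 \<le> Hp_mean p f r"
  \<comment> \<open>A function that is not integrable has integral 0 by convention.\<close>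
  unfolding Hp_mean_def by (cases "(\<lambda>\<theta>. norm (f (of_real r * cis \<theta>)) powr p) integrable_on {0..2*pi}")
    (auto intro: integral_nonneg simp: not_integrable_integral)

lemma HpD:
  assumes "f \<in> Hp p"
  shows "f holomorphic_on \<D>" "z \<notin> \<D> \<Longrightarrow> f z = 0"
  using assms by (auto simp: Hp_def)

lemma HpI:
  assumes "f holomorphic_on \<D>" "\<And>z. z \<notin> \<D> \<Longrightarrow> f z = 0"
    "\<And>r. 0 < r \<Longrightarrow> r < 1 \<Longrightarrow> Hp_mean p f r \<le> K"
  shows "f \<in> Hp p"
  using assms by (auto simp: Hp_def intro!: bdd_aboveI2[where M=K])

lemma Hp_norm_nonneg: "0 \<le> Hp_norm p f"
  by (simp add: Hp_norm_def)

lemma Hp_mean_le_norm: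
  assumes "f \<in> Hp p" "0 < p" "0 < r" "r < 1"
  shows "Hp_mean p f r \<le> Hp_norm p f powr p"
proof -
  have "bdd_above (Hp_mean p f ` {0<..<1})" using assms by (simp add: Hp_def)
  then have le: "Hp_mean p f r \<le> (SUP r\<in>{0<..<1}. Hp_mean p f r)"
    using assms by (intro cSUP_upper) auto
  then have "0 \<le> (SUP r\<in>{0<..<1}. Hp_mean p f r)"
    using Hp_mean_nonneg order_trans by blast
  then have "Hp_norm p f powr p = (SUP r\<in>{0<..<1}. Hp_mean p f r)"
    using assms by (simp add: Hp_norm_def powr_powr)
  with le show ?thesis by simp
qed

lemma Hp_norm_leI:
  assumes "0 < p" "0 \<le> B" "\<And>r. 0 < r \<Longrightarrow> r < 1 \<Longrightarrow> Hp_mean p f r \<le> B powr p"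
  shows "Hp_norm p f \<le> B"
proof -
  have ne: "{0<..<1::real} \<noteq> {}"
    by (metis greaterThanLessThan_iff empty_iff field_lbound_gt_zero zero_less_one)
  have le: "(SUP r\<in>{0<..<1}. Hp_mean p f r) \<le> B powr p"
    using assms ne by (intro cSUP_least) auto
  have "bdd_above (Hp_mean p f ` {0<..<1})"
    using assms by (intro bdd_aboveI2[where M="B powr p"]) auto
  then have "Hp_mean p f (1/2) \<le> (SUP r\<in>{0<..<1}. Hp_mean p f r)"
    by (intro cSUP_upper) auto
  then have "0 \<le> (SUP r\<in>{0<..<1}. Hp_mean p f r)"
    using Hp_mean_nonneg order_trans by blast
  then have "Hp_norm p f \<le> (B powr p) powr (1/p)"
    unfolding Hp_norm_def using le assms by (intro powr_mono2) auto
  then show ?thesis using assms by (simp add: powr_powr)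
qed

text \<open>With \<open>s = x + y\<close>, each summand \<open>u\<close> satisfies
  \<open>u powr p \<le> u * s powr (p - 1)\<close>, and these add up to \<open>s powr p\<close>. It
  collects two norms under one power in \<open>Hp_dominated\<close>.\<close>

lemma powr_add_superadditive:
  fixes x y p :: real
  assumes "1 \<le> p" "0 \<le> x" "0 \<le> y"
  shows "x powr p + y powr p \<le> (x + y) powr p"
proof (cases "x + y = 0")
  case True then show ?thesis using assms by (simp add: add_nonneg_eq_0_iff)
next
  case False
  define s where "s = x + y"
  have s: "s > 0" using False assms by (simp add: s_def)
  have *: "u powr p \<le> u * s powr (p - 1)" if "0 \<le> u" "u \<le> s" for u
  proof (cases "u = 0")
    case False
    have "u powr p = u * u powr (p - 1)" using that False
      by (simp add: powr_mult_base)
    also have "\<dots> \<le> u * s powr (p - 1)"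
      using that assms by (intro mult_left_mono powr_mono2) auto
    finally show ?thesis .
  qed (use assms in auto)
  have "x powr p + y powr p \<le> x * s powr (p-1) + y * s powr (p-1)"
    using assms by (intro add_mono *) (auto simp: s_def)
  also have "\<dots> = s * s powr (p-1)" by (simp add: s_def algebra_simps)
  also have "\<dots> = s powr p" using s by (simp add: powr_mult_base)
  finally show ?thesis by (simp add: s_def)
qed

lemma powr_add_le:
  fixes x y p :: real
  assumes "0 < p" "0 \<le> x" "0 \<le> y"
  shows "(x + y) powr p \<le> 2 powr p * (x powr p + y powr p)"
proof -
  have "(x + y) powr p \<le> (2 * max x y) powr p"
    using assms by (intro powr_mono2) auto
  also have "\<dots> = 2 powr p * max x y powr p" using assms by (simp add: powr_mult)
  also have "\<dots> \<le> 2 powr p * (x powr p + y powr p)"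
    by (intro mult_left_mono) (auto simp: max_def)
  finally show ?thesis .
qed

text \<open>Stand-in for Minkowski's inequality. Bounding a sum by twice the maximum costs
  \<open>2 powr p\<close>, hence the factor 2 in the norm, which is harmless for boundedness and
  convergence.\<close>

lemma Hp_dominated:
  assumes p: "1 \<le> p" and f: "f holomorphic_on \<D>" "\<And>z. z \<notin> \<D> \<Longrightarrow> f z = 0"
    and g: "g1 \<in> Hp p" "g2 \<in> Hp p"
    and le: "\<And>z. z \<in> \<D> \<Longrightarrow> norm (f z) \<le> norm (g1 z) + norm (g2 z)"
  shows "f \<in> Hp p" "Hp_norm p f \<le> 2 * (Hp_norm p g1 + Hp_norm p g2)"
proof -
  let ?N = "Hp_norm p"
  have m: "Hp_mean p f r \<le> (2 * (?N g1 + ?N g2)) powr p" if r: "0 < r" "r < 1" for r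
  proof -
    have i: "(\<lambda>t. norm (g (of_real r * cis t)) powr p) integrable_on {0..2*pi}" if "g holomorphic_on \<D>" for g
      using that r p by (intro Hp_mean_integrable) auto
    note ii = i[OF f(1)] i[OF HpD(1)[OF g(1)]] i[OF HpD(1)[OF g(2)]]
    have "Hp_mean p f r \<le> integral {0..2*pi} (\<lambda>t. 2 powr p * (norm (g1 (of_real r * cis t)) powr p + norm (g2 (of_real r * cis t)) powr p))"
      unfolding Hp_mean_def
    proof (rule integral_le)
      fix t
      have "norm (f (of_real r * cis t)) powr p \<le> (norm (g1 (of_real r * cis t)) + norm (g2 (of_real r * cis t))) powr p"
        using le[OF circle_in_disc] r p by (intro powr_mono2) auto
      also have "\<dots> \<le> 2 powr p * (norm (g1 (of_real r * cis t)) powr p + norm (g2 (of_real r * cis t)) powr p)"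
        using p by (intro powr_add_le) auto
      finally show "norm (f (of_real r * cis t)) powr p \<le> \<dots>" .
    qed (use ii in \<open>auto intro!: integrable_on_mult_right integrable_add\<close>)
    also have "\<dots> = 2 powr p * (Hp_mean p g1 r + Hp_mean p g2 r)"
      using ii by (simp add: Hp_mean_def integral_add)
    also have "\<dots> \<le> 2 powr p * (?N g1 powr p + ?N g2 powr p)"
      using g r p by (intro mult_left_mono add_mono Hp_mean_le_norm) auto
    also have "\<dots> \<le> 2 powr p * (?N g1 + ?N g2) powr p"
      using p by (intro mult_left_mono powr_add_superadditive) (auto simp: Hp_norm_nonneg)
    also have "\<dots> = (2 * (?N g1 + ?N g2)) powr p"
      by (simp only: powr_mult)
    finally show ?thesis .
  qed
  show "f \<in> Hp p" by (rule HpI[OF f m])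
  show "?N f \<le> 2 * (?N g1 + ?N g2)"
    using p m by (intro Hp_norm_leI) (auto simp: Hp_norm_nonneg)
qed

text \<open>A single majorant costs no extra factor, which keeps multiplication by constants exactly
  homogeneous.\<close>

lemma Hp_dominated1:
  assumes p: "1 \<le> p" and f: "f holomorphic_on \<D>" "\<And>z. z \<notin> \<D> \<Longrightarrow> f z = 0"
    and g: "g \<in> Hp p" and K: "0 \<le> K"
    and le: "\<And>z. z \<in> \<D> \<Longrightarrow> norm (f z) \<le> K * norm (g z)"
  shows "f \<in> Hp p" "Hp_norm p f \<le> K * Hp_norm p g"
proof -
  let ?N = "Hp_norm p"
  have m: "Hp_mean p f r \<le> (K * ?N g) powr p" if r: "0 < r" "r < 1" for r
  proof -
    have i: "(\<lambda>t. norm (g (of_real r * cis t)) powr p) integrable_on {0..2*pi}" if "g holomorphic_on \<D>" for g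
      using that r p by (intro Hp_mean_integrable) auto
    have "Hp_mean p f r \<le> integral {0..2*pi} (\<lambda>t. K powr p * norm (g (of_real r * cis t)) powr p)"
      unfolding Hp_mean_def
    proof (rule integral_le)
      fix t
      have "norm (f (of_real r * cis t)) powr p \<le> (K * norm (g (of_real r * cis t))) powr p"
        using le[OF circle_in_disc] r p by (intro powr_mono2) auto
      also have "\<dots> = K powr p * norm (g (of_real r * cis t)) powr p"
        using K by (simp add: powr_mult)
      finally show "norm (f (of_real r * cis t)) powr p \<le> \<dots>" .
    qed (use i[OF f(1)] i[OF HpD(1)[OF g]] in \<open>auto intro!: integrable_on_mult_right\<close>)
    also have "\<dots> = K powr p * Hp_mean p g r"
      by (simp add: Hp_mean_def)
    also have "\<dots> \<le> K powr p * ?N g powr p"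
      using g r p by (intro mult_left_mono Hp_mean_le_norm) auto
    also have "\<dots> = (K * ?N g) powr p" using K by (simp add: powr_mult Hp_norm_nonneg)
    finally show ?thesis .
  qed
  show "f \<in> Hp p" by (rule HpI[OF f m])
  show "?N f \<le> K * ?N g"
    using p m K by (intro Hp_norm_leI) (auto simp: Hp_norm_nonneg)
qed

lemma Hp_add:
  assumes "1 \<le> p" "f \<in> Hp p" "g \<in> Hp p"
  shows "(\<lambda>z. f z + g z) \<in> Hp p" "Hp_norm p (\<lambda>z. f z + g z) \<le> 2 * (Hp_norm p f + Hp_norm p g)"
proof -
  have "(\<lambda>z. f z + g z) holomorphic_on \<D>" using HpD(1) assms by (blast intro: holomorphic_on_add)
  moreover have "f z + g z = 0" if "z \<notin> \<D>" for z
    using HpD(2)[OF assms(2) that] HpD(2)[OF assms(3) that] by simp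
  ultimately show "(\<lambda>z. f z + g z) \<in> Hp p" "Hp_norm p (\<lambda>z. f z + g z) \<le> 2 * (Hp_norm p f + Hp_norm p g)"
    using Hp_dominated[OF assms(1) _ _ assms(2,3), of "\<lambda>z. f z + g z"] norm_triangle_ineq by blast+
qed

lemma Hp_mult_bounded:
  assumes "1 \<le> p" "f \<in> Hp p" "m holomorphic_on \<D>" "\<And>z. z \<in> \<D> \<Longrightarrow> norm (m z) \<le> K" "0 \<le> K"
  shows "(\<lambda>z. m z * f z) \<in> Hp p" "Hp_norm p (\<lambda>z. m z * f z) \<le> K * Hp_norm p f"
proof -
  have "(\<lambda>z. m z * f z) holomorphic_on \<D>" using HpD(1) assms by (blast intro: holomorphic_on_mult)
  moreover have "m z * f z = 0" if "z \<notin> \<D>" for z using that HpD(2) assms by simp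
  moreover have "norm (m z * f z) \<le> K * norm (f z)" if "z \<in> \<D>" for z
    using assms that by (simp add: norm_mult mult_right_mono)
  ultimately show "(\<lambda>z. m z * f z) \<in> Hp p" "Hp_norm p (\<lambda>z. m z * f z) \<le> K * Hp_norm p f"
    using Hp_dominated1[OF assms(1) _ _ assms(2,5), of "\<lambda>z. m z * f z"] by blast+
qed

lemma Hp_cmult:
  assumes "1 \<le> p" "f \<in> Hp p"
  shows "(\<lambda>z. c * f z) \<in> Hp p" "Hp_norm p (\<lambda>z. c * f z) \<le> norm c * Hp_norm p f"
  using Hp_mult_bounded[OF assms, of "\<lambda>_. c" "norm c"] by (auto)

lemma Hp_diff:
  assumes "1 \<le> p" "f \<in> Hp p" "g \<in> Hp p"
  shows "(\<lambda>z. f z - g z) \<in> Hp p" "Hp_norm p (\<lambda>z. f z - g z) \<le> 2 * (Hp_norm p f + Hp_norm p g)"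
  using Hp_add[OF assms(1,2) Hp_cmult(1)[OF assms(1,3)], of "-1"] Hp_cmult(2)[OF assms(1,3), of "-1"]
  by auto

lemma Hp_zero: "(\<lambda>z. 0) \<in> Hp p"
  by (rule HpI[where K=0]) (auto simp: Hp_mean_def)

lemma Hp_bounded:
  assumes "0 < p" "f holomorphic_on \<D>" "\<And>z. z \<notin> \<D> \<Longrightarrow> f z = 0" "\<And>z. z \<in> \<D> \<Longrightarrow> norm (f z) \<le> K"
  shows "f \<in> Hp p"
proof (rule HpI[OF assms(2,3)])
  fix r :: real assume r: "0 < r" "r < 1"
  have "Hp_mean p f r \<le> integral {0..2*pi} (\<lambda>t. K powr p)"
    unfolding Hp_mean_def using assms r circle_in_disc[of r]
    by (intro integral_le Hp_mean_integrable powr_mono2) auto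
  then show "Hp_mean p f r \<le> integral {0..2*pi} (\<lambda>t. K powr p)" .
qed

section \<open>The Poisson kernel\<close>

text \<open>Written as the real part of a function holomorphic in \<open>z\<close>: composed with a
  holomorphic map it still has the mean value property, which \<open>subordination\<close>
  uses.\<close>

definition poisson :: "real \<Rightarrow> complex \<Rightarrow> real \<Rightarrow> real" where
  "poisson r z t = Re ((of_real r * cis t + z) / (of_real r * cis t - z))"

lemma poisson_eq:
  assumes "norm z < r"
  shows "poisson r z t = (r\<^sup>2 - (norm z)\<^sup>2) / (norm (of_real r * cis t - z))\<^sup>2"
proof -
  define u where "u = of_real r * cis t"
  have r: "0 < r" using assms norm_ge_zero[of z] by linarith
  have nu: "norm u = r" using r by (simp add: u_def norm_mult)
  have "(u + z) / (u - z) = (u + z) * cnj (u - z) / of_real ((norm (u - z))\<^sup>2)"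
    using complex_div_cnj by (metis of_real_power)
  then have "Re ((u + z) / (u - z)) = Re ((u + z) * cnj (u - z)) / (norm (u - z))\<^sup>2"
    by (simp del: of_real_power)
  also have "Re ((u + z) * cnj (u - z)) = (norm u)\<^sup>2 - (norm z)\<^sup>2"
    unfolding cmod_power2 by (simp add: algebra_simps power2_eq_square)
  finally show ?thesis by (simp add: poisson_def u_def[symmetric] nu)
qed

lemma poisson_bounds:
  assumes "norm z < r"
  shows "0 < poisson r z t" "poisson r z t \<le> (r + norm z) / (r - norm z)"
proof -
  have r: "0 < r" using assms norm_ge_zero[of z] by linarith
  have d: "r - norm z \<le> norm (of_real r * cis t - z)"
    using norm_triangle_ineq2[of "of_real r * cis t" z] r by (simp add: norm_mult)
  have sq: "(norm z)\<^sup>2 < r\<^sup>2" using assms by (intro power_strict_mono) auto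
  show "0 < poisson r z t"
    unfolding poisson_eq[OF assms] using d assms sq by (intro divide_pos_pos zero_less_power) auto
  have "poisson r z t \<le> (r\<^sup>2 - (norm z)\<^sup>2) / (r - norm z)\<^sup>2"
    unfolding poisson_eq[OF assms] using d assms sq by (intro divide_left_mono power_mono) (auto intro!: mult_pos_pos)
  also have "\<dots> = (r + norm z) / (r - norm z)"
    using assms by (simp add: divide_simps power2_eq_square) (simp add: algebra_simps)
  finally show "poisson r z t \<le> (r + norm z) / (r - norm z)" .
qed

lemma circle_minus_nonzero:
  assumes "norm z < r"
  shows "of_real r * cis t - z \<noteq> 0"
proof
  assume "of_real r * cis t - z = 0"
  then have "norm z = norm (of_real r * cis t)" by simp
  also have "\<dots> = \<bar>r\<bar>" by (simp add: norm_mult)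
  finally show False using assms by simp
qed

lemma poisson_formula:
  fixes f :: "complex \<Rightarrow> complex"
  assumes f: "f holomorphic_on cball 0 r" and z: "norm z < r"
  shows "((\<lambda>t. of_real (poisson r z t) * f (of_real r * cis t)) has_integral (2 * pi * f z)) {0..2*pi}"
proof -
  have r: "0 < r" using z norm_ge_zero[of z] by linarith
  \<comment> \<open>On the circle, \<open>of_real (r\<^sup>2) - cnj z * u = u * cnj (u - z)\<close>,
    so Cauchy's kernel for \<open>F\<close> is the Poisson kernel for \<open>f\<close>; at
    \<open>u = z\<close> the extra factor is 1.\<close>
  define F where "F u = f u * of_real (r\<^sup>2 - (norm z)\<^sup>2) / (of_real (r\<^sup>2) - cnj z * u)" for u
  have sq: "(norm z)\<^sup>2 < r\<^sup>2" using z by (intro power_strict_mono) auto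
  have nz: "of_real (r\<^sup>2) - cnj z * u \<noteq> 0" if "norm u \<le> r" for u
  proof
    assume "of_real (r\<^sup>2) - cnj z * u = 0"
    then have "of_real (r\<^sup>2) = cnj z * u" by simp
    then have "r\<^sup>2 = norm z * norm u" by (metis complex_mod_cnj norm_mult norm_of_real abs_power2)
    also have "\<dots> \<le> norm z * r" using that by (intro mult_left_mono) auto
    also have "\<dots> < r * r" using z r by simp
    finally show False by (simp add: power2_eq_square)
  qed
  have "F holomorphic_on cball 0 r"
    unfolding F_def using nz by (intro holomorphic_intros f) auto
  then have "((\<lambda>u. F u / (u - z)) has_contour_integral (2 * of_real pi * \<i> * F z)) (circlepath 0 r)"
    using z by (intro Cauchy_integral_circlepath_simple) auto
  moreover have "F z = f z"
  proof -
    have "cnj z * z = of_real ((norm z)\<^sup>2)" by (metis complex_norm_square mult.commute)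
    then have "of_real (r\<^sup>2) - cnj z * z = of_real (r\<^sup>2 - (norm z)\<^sup>2)" by simp
    then show ?thesis using sq nz[of z] z by (simp add: F_def)
  qed
  ultimately have "((\<lambda>t. F (0 + of_real r * cis t) / (0 + of_real r * cis t - z) * of_real r * \<i> * cis t) has_integral (2 * of_real pi * \<i> * f z)) {0..2*pi}"
    unfolding circlepath_def by (subst (asm) has_contour_integral_part_circlepath_iff) auto
  then have "((\<lambda>t. (- \<i>) * (F (of_real r * cis t) / (of_real r * cis t - z) * of_real r * \<i> * cis t)) has_integral ((-\<i>) * (2 * of_real pi * \<i> * f z))) {0..2*pi}"
    by (intro has_integral_mult_right) simp
  moreover have "(- \<i>) * (F (of_real r * cis t) / (of_real r * cis t - z) * of_real r * \<i> * cis t)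
      = of_real (poisson r z t) * f (of_real r * cis t)" for t
  proof -
    define u where "u = of_real r * cis t"
    have nu: "norm u = r" using r by (simp add: u_def norm_mult)
    have uz: "u - z \<noteq> 0" unfolding u_def by (rule circle_minus_nonzero[OF z])
    have u0: "u \<noteq> 0" using nu r by auto
    have uu: "of_real (r\<^sup>2) = u * cnj u" using nu complex_norm_square by metis
    have e: "of_real (r\<^sup>2) - cnj z * u = u * cnj (u - z)" unfolding uu by (simp add: algebra_simps)
    have P: "complex_of_real (poisson r z t) = of_real (r\<^sup>2 - (norm z)\<^sup>2) / ((u - z) * cnj (u - z))"
      unfolding poisson_eq[OF z] u_def[symmetric] by (simp add: complex_norm_square[symmetric] del: complex_cnj_diff)
    have "(- \<i>) * (F u / (u - z) * \<i> * u) = F u / (u - z) * u"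
      by (simp add: algebra_simps)
    also have "\<dots> = f u * of_real (r\<^sup>2 - (norm z)\<^sup>2) / (u * cnj (u - z)) / (u - z) * u"
      by (simp only: F_def e)
    also have "\<dots> = of_real (poisson r z t) * f u"
      unfolding P using u0 uz by (simp add: field_simps del: complex_cnj_diff)
    finally show ?thesis unfolding u_def by (simp add: mult_ac)
  qed
  ultimately show ?thesis by (simp add: mult_ac)
qed

lemma circle_mean_value:
  fixes f :: "complex \<Rightarrow> complex"
  assumes f: "f holomorphic_on cball 0 r" and r: "0 < r"
  shows "((\<lambda>t. f (of_real r * cis t)) has_integral (2 * pi * f 0)) {0..2*pi}"
proof -
  have "poisson r 0 t = 1" for t using r by (simp add: poisson_def)
  then show ?thesis using poisson_formula[OF f, of 0] r by simp
qed

lemma poisson_integral: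
  assumes "norm z < r"
  shows "(poisson r z has_integral 2 * pi) {0..2*pi}"
proof -
  have "((\<lambda>t. Re (of_real (poisson r z t) * 1)) has_integral Re (2 * pi * 1)) {0..2*pi}"
    by (intro has_integral_Re) (use poisson_formula[of "\<lambda>_. 1" r z] assms in simp)
  then show ?thesis by simp
qed

lemma continuous_on_poisson:
  assumes "norm z < r"
  shows "continuous_on A (poisson r z)"
  unfolding poisson_def[abs_def] using circle_minus_nonzero[OF assms]
  by (intro continuous_intros) auto

section \<open>Jensen's inequality and subordination\<close>

text \<open>For \<open>p > 1\<close> the derivative of the power increases strictly, and the mean
  value theorem compares the chord with the tangent at \<open>y\<close>. The endpoint
  \<open>x = 0\<close> is computed directly.\<close>

lemma powr_tangent_strict:
  fixes x y p :: real
  assumes "1 < p" "0 \<le> x" "0 < y" "x \<noteq> y"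
  shows "y powr p + p * y powr (p - 1) * (x - y) < x powr p"
proof (cases "x = 0")
  case True
  have *: "y * y powr (p - 1) = y powr p" using assms by (simp add: powr_mult_base)
  have "y powr p + p * y powr (p - 1) * (x - y) = y powr p - p * (y * y powr (p - 1))"
    using True by (simp add: mult.assoc mult.commute)
  also have "\<dots> = y powr p - p * y powr p" by (simp only: *)
  also have "\<dots> < 0" using assms mult_strict_right_mono[of 1 p "y powr p"] by simp
  finally show ?thesis using True assms by simp
next
  case False
  have d: "((\<lambda>x. x powr p) has_real_derivative p * u powr (p - 1)) (at u)" if "0 < u" for u
    using that by (auto intro!: derivative_eq_intros)
  show ?thesis
  proof (cases "x < y")
    case True
    obtain u where u: "x < u" "u < y" "y powr p - x powr p = (y - x) * (p * u powr (p - 1))"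
      using MVT2[OF True, of "\<lambda>x. x powr p" "\<lambda>u. p * u powr (p - 1)"] d assms False by auto
    have "p * u powr (p-1) < p * y powr (p-1)" using u assms by (intro mult_strict_left_mono powr_less_mono2) auto
    then have "(y - x) * (p * u powr (p-1)) < (y - x) * (p * y powr (p-1))" using True by (simp only: mult_less_cancel_left_pos diff_gt_0_iff_gt)
    then show ?thesis using u(3) by (simp add: algebra_simps)
  next
    case F2: False
    then have yx: "y < x" using assms by auto
    obtain u where u: "y < u" "u < x" "x powr p - y powr p = (x - y) * (p * u powr (p - 1))"
      using MVT2[OF yx, of "\<lambda>x. x powr p" "\<lambda>u. p * u powr (p - 1)"] d assms by auto
    have "p * y powr (p-1) < p * u powr (p-1)" using u assms by (intro mult_strict_left_mono powr_less_mono2) auto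
    then have "(x - y) * (p * y powr (p-1)) < (x - y) * (p * u powr (p-1))" using yx by (simp only: mult_less_cancel_left_pos diff_gt_0_iff_gt)
    then show ?thesis using u(3) by (simp add: algebra_simps)
  qed
qed

lemma powr_tangent:
  fixes x y p :: real
  assumes "1 \<le> p" "0 \<le> x" "0 < y"
  shows "y powr p + p * y powr (p - 1) * (x - y) \<le> x powr p"
proof (cases "p = 1 \<or> x = y")
  case True then show ?thesis using assms by auto
next
  case False then show ?thesis using powr_tangent_strict[of p x y] assms by simp
qed

text \<open>Jensen's inequality for the probability density \<open>poisson r z t / (2 * pi)\<close>:
  the tangent of the power at \<open>norm (f z)\<close> is integrated, and its linear term is
  nonnegative because the Poisson formula bounds \<open>norm (f z)\<close> by the mean of
  \<open>norm f\<close>.\<close>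

lemma poisson_jensen:
  fixes f :: "complex \<Rightarrow> complex"
  assumes p: "1 \<le> p" and f: "f holomorphic_on cball 0 r" and z: "norm z < r"
  shows "2 * pi * norm (f z) powr p \<le> integral {0..2*pi} (\<lambda>t. poisson r z t * norm (f (of_real r * cis t)) powr p)"
proof (cases "f z = 0")
  case True
  have "0 \<le> integral {0..2*pi} (\<lambda>t. poisson r z t * norm (f (of_real r * cis t)) powr p)"
    using poisson_bounds(1)[OF z] by (cases "(\<lambda>t. poisson r z t * norm (f (of_real r * cis t)) powr p) integrable_on {0..2*pi}")
      (auto intro!: integral_nonneg simp: not_integrable_integral less_imp_le)
  with True show ?thesis by simp
next
  case False
  define P where "P = poisson r z"
  have r: "0 < r" using z norm_ge_zero[of z] by linarith
  define v where "v t = norm (f (of_real r * cis t))" for t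
  define y where "y = norm (f z)"
  have y: "0 < y" using False by (simp add: y_def)
  have cf: "continuous_on {0..2*pi} (\<lambda>t. f (of_real r * cis t))"
    using r by (intro continuous_on_circle[OF f]) (auto simp: norm_mult)
  have cv: "continuous_on {0..2*pi} v" unfolding v_def by (intro continuous_intros cf)
  have cvp: "continuous_on {0..2*pi} (\<lambda>t. v t powr p)"
    unfolding v_def using p by (intro continuous_on_norm_powr cf) auto
  note cPv = continuous_on_mult[OF _ cvp]
  have cP: "continuous_on {0..2*pi} P" unfolding P_def by (rule continuous_on_poisson[OF z])
  have P0: "0 \<le> P t" for t unfolding P_def using poisson_bounds(1)[OF z] less_imp_le by blast
  have iP: "integral {0..2*pi} P = 2 * pi" unfolding P_def using poisson_integral[OF z] by blast
  have "2 * pi * y = norm (integral {0..2*pi} (\<lambda>t. of_real (P t) * f (of_real r * cis t)))"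
    using poisson_formula[OF f z] unfolding P_def y_def by (simp add: integral_unique norm_mult)
  also have "\<dots> \<le> integral {0..2*pi} (\<lambda>t. P t * v t)"
    using P0 by (intro integral_norm_bound_integral integrable_continuous_real continuous_intros cP cf cv) (auto simp: v_def norm_mult)
  finally have A: "2 * pi * y \<le> integral {0..2*pi} (\<lambda>t. P t * v t)" .
  have "integral {0..2*pi} (\<lambda>t. (y powr p - p * y powr (p-1) * y) * P t + p * y powr (p-1) * (P t * v t))
      \<le> integral {0..2*pi} (\<lambda>t. P t * v t powr p)"
  proof (rule integral_le)
    show "(\<lambda>t. P t * v t powr p) integrable_on {0..2*pi}"
      by (intro integrable_continuous_real cPv cP)
    show "(\<lambda>t. (y powr p - p * y powr (p-1) * y) * P t + p * y powr (p-1) * (P t * v t)) integrable_on {0..2*pi}"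
      by (intro integrable_continuous_real continuous_intros cP cv)
  next
    fix t
    have "P t * (y powr p + p * y powr (p-1) * (v t - y)) \<le> P t * v t powr p"
      using P0 p y by (intro mult_left_mono powr_tangent) (auto simp: v_def)
    then show "(y powr p - p * y powr (p-1) * y) * P t + p * y powr (p-1) * (P t * v t) \<le> P t * v t powr p"
      by (simp add: algebra_simps)
  qed
  also have "integral {0..2*pi} (\<lambda>t. (y powr p - p * y powr (p-1) * y) * P t + p * y powr (p-1) * (P t * v t))
     = (y powr p - p * y powr (p-1) * y) * (2 * pi) + p * y powr (p-1) * integral {0..2*pi} (\<lambda>t. P t * v t)"
    by (subst integral_add) (auto intro!: integrable_continuous_real continuous_intros cP cv simp: iP)
  finally have B: "(y powr p - p * y powr (p-1) * y) * (2 * pi) + p * y powr (p-1) * integral {0..2*pi} (\<lambda>t. P t * v t)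
     \<le> integral {0..2*pi} (\<lambda>t. P t * v t powr p)" .
  have "p * y powr (p-1) * (2 * pi * y) \<le> p * y powr (p-1) * integral {0..2*pi} (\<lambda>t. P t * v t)"
    using A p by (intro mult_left_mono) auto
  with B show ?thesis unfolding v_def y_def P_def by (simp add: algebra_simps)
qed

text \<open>\<open>poisson_jensen\<close> is applied at each point
  \<open>\<phi> (of_real \<rho> * cis \<theta>)\<close> and integrated over \<theta>. After
  exchanging the integrals, the inner one is the mean of a harmonic function over a circle, hence
  given by its value at the centre.\<close>

lemma subordination:
  fixes f \<phi> :: "complex \<Rightarrow> complex"
  assumes p: "1 \<le> p" and f: "f holomorphic_on cball 0 r" and \<phi>: "\<phi> holomorphic_on cball 0 \<rho>"
    and \<rho>: "0 < \<rho>" and lt: "\<And>z. z \<in> cball 0 \<rho> \<Longrightarrow> norm (\<phi> z) < r"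
  shows "Hp_mean p (\<lambda>z. f (\<phi> z)) \<rho> \<le> integral {0..2*pi} (\<lambda>t. poisson r (\<phi> 0) t * norm (f (of_real r * cis t)) powr p)"
proof -
  define w where "w t = norm (f (of_real r * cis t)) powr p" for t
  define \<psi> where "\<psi> \<theta> = \<phi> (of_real \<rho> * cis \<theta>)" for \<theta>
  have r: "0 < r" using lt[of 0] \<rho> order_le_less_trans[OF norm_ge_zero] by simp
  have \<psi>: "norm (\<psi> \<theta>) < r" for \<theta> unfolding \<psi>_def using \<rho> by (intro lt) (simp add: norm_mult)
  have c\<psi>: "continuous_on A \<psi>" for A
    unfolding \<psi>_def using \<rho> by (intro continuous_on_circle[OF \<phi>]) (simp add: norm_mult)
  have cf: "continuous_on A (\<lambda>t. f (of_real r * cis t))" for A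
    using r by (intro continuous_on_circle[OF f]) (simp add: norm_mult)
  have cw: "continuous_on A w" for A
    unfolding w_def[abs_def] using p by (intro continuous_on_norm_powr cf) auto
  have nz: "of_real r * cis t - \<psi> \<theta> \<noteq> 0" for t \<theta> by (rule circle_minus_nonzero[OF \<psi>])
  have cont: "continuous_on (cbox (0,0) (2*pi,2*pi)) (\<lambda>(\<theta>,t). poisson r (\<psi> \<theta>) t * w t)"
    unfolding case_prod_unfold poisson_def using nz
    by (intro continuous_intros continuous_on_compose2[OF cw[of UNIV]] continuous_on_compose2[OF c\<psi>[of UNIV]]) auto
  have cfp: "continuous_on A (\<lambda>\<theta>. norm (f (\<psi> \<theta>)) powr p)" for A
    using p \<psi> by (intro continuous_on_norm_powr continuous_on_compose2[OF holomorphic_on_imp_continuous_on[OF f] c\<psi>])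
       (auto simp: less_imp_le)
  have "continuous_on {0..2*pi} (\<lambda>\<theta>. integral (cbox 0 (2*pi)) (\<lambda>t. poisson r (\<psi> \<theta>) t * w t))"
    by (rule integral_continuous_on_param[where U="{0..2*pi}" and a=0 and b="2*pi" and f="\<lambda>\<theta> t. poisson r (\<psi> \<theta>) t * w t"])
      (use cont in \<open>simp add: cbox_Pair_eq\<close>)
  then have cI: "continuous_on {0..2*pi} (\<lambda>\<theta>. integral {0..2*pi} (\<lambda>t. poisson r (\<psi> \<theta>) t * w t))" by simp
  have "2 * pi * Hp_mean p (\<lambda>z. f (\<phi> z)) \<rho> = integral {0..2*pi} (\<lambda>\<theta>. 2 * pi * norm (f (\<psi> \<theta>)) powr p)"
    by (simp add: Hp_mean_def \<psi>_def)
  also have "\<dots> \<le> integral {0..2*pi} (\<lambda>\<theta>. integral {0..2*pi} (\<lambda>t. poisson r (\<psi> \<theta>) t * w t))"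
  proof (rule integral_le)
    show "(\<lambda>\<theta>. 2 * pi * norm (f (\<psi> \<theta>)) powr p) integrable_on {0..2*pi}"
      by (intro integrable_continuous_real continuous_on_mult continuous_on_const cfp)
    show "(\<lambda>\<theta>. integral {0..2*pi} (\<lambda>t. poisson r (\<psi> \<theta>) t * w t)) integrable_on {0..2*pi}"
      by (intro integrable_continuous_real cI)
    show "2 * pi * norm (f (\<psi> \<theta>)) powr p \<le> integral {0..2*pi} (\<lambda>t. poisson r (\<psi> \<theta>) t * w t)" for \<theta>
      unfolding w_def by (rule poisson_jensen[OF p f \<psi>])
  qed
  also have "\<dots> = integral {0..2*pi} (\<lambda>t. integral {0..2*pi} (\<lambda>\<theta>. poisson r (\<psi> \<theta>) t * w t))"
    using integral_swap_continuous[OF cont] by simp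
  also have "\<dots> = integral {0..2*pi} (\<lambda>t. 2 * pi * (poisson r (\<phi> 0) t * w t))"
  proof (rule integral_cong)
    fix t
    have "(\<lambda>z. (of_real r * cis t + \<phi> z) / (of_real r * cis t - \<phi> z)) holomorphic_on cball 0 \<rho>"
      using lt circle_minus_nonzero by (intro holomorphic_intros \<phi>) auto
    from circle_mean_value[OF this \<rho>]
    have "((\<lambda>\<theta>. Re ((of_real r * cis t + \<psi> \<theta>) / (of_real r * cis t - \<psi> \<theta>))) has_integral
        Re (2 * of_real pi * ((of_real r * cis t + \<phi> 0) / (of_real r * cis t - \<phi> 0)))) {0..2*pi}"
      unfolding \<psi>_def by (intro has_integral_Re) simp
    also have "Re (2 * of_real pi * ((of_real r * cis t + \<phi> 0) / (of_real r * cis t - \<phi> 0))) = 2 * pi * poisson r (\<phi> 0) t"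
    proof -
      have "Re (2 * of_real pi * u) = 2 * pi * Re u" for u by simp
      then show ?thesis unfolding poisson_def .
    qed
    finally have "((\<lambda>\<theta>. poisson r (\<psi> \<theta>) t) has_integral 2 * pi * poisson r (\<phi> 0) t) {0..2*pi}"
      unfolding poisson_def .
    then have "((\<lambda>\<theta>. poisson r (\<psi> \<theta>) t * w t) has_integral 2 * pi * poisson r (\<phi> 0) t * w t) {0..2*pi}"
      by (rule has_integral_mult_left)
    then show "integral {0..2*pi} (\<lambda>\<theta>. poisson r (\<psi> \<theta>) t * w t) = 2 * pi * (poisson r (\<phi> 0) t * w t)"
      by (subst mult.assoc[symmetric]) (rule integral_unique)
  qed
  also have "\<dots> = 2 * pi * integral {0..2*pi} (\<lambda>t. poisson r (\<phi> 0) t * w t)" by simp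
  finally show ?thesis by (simp add: w_def)
qed

text \<open>Subordination to the identity map, for which the Poisson kernel at the centre is
  1.\<close>

lemma Hp_mean_mono:
  assumes p: "1 \<le> p" and f: "f holomorphic_on \<D>" and r: "0 < \<rho>" "\<rho> \<le> r" "r < 1"
  shows "Hp_mean p f \<rho> \<le> Hp_mean p f r"
proof (cases "\<rho> = r")
  case False
  have "poisson r 0 t = 1" for t using r by (simp add: poisson_def)
  moreover have "f holomorphic_on cball 0 r" by (rule holomorphic_on_subset[OF f]) (use r in auto)
  ultimately show ?thesis
    using subordination[of p f r "\<lambda>z. z" \<rho>] p r False by (simp add: Hp_mean_def)
qed simp

text \<open>\<open>subordination\<close> needs a circle strictly inside the disc that encloses the
  image of \<open>cball 0 \<rho>\<close>; compactness provides one.\<close>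

lemma exists_radius:
  fixes \<phi> :: "complex \<Rightarrow> complex"
  assumes "\<phi> holomorphic_on \<D>" "\<phi> ` \<D> \<subseteq> \<D>" "0 < \<rho>" "\<rho> < 1" "r0 < 1"
  obtains r where "r0 \<le> r" "r < 1" "\<And>z. z \<in> cball 0 \<rho> \<Longrightarrow> norm (\<phi> z) < r"
proof -
  have sub: "cball 0 \<rho> \<subseteq> \<D>" using assms by auto
  have "continuous_on (cball 0 \<rho>) (\<lambda>z. norm (\<phi> z))"
    using assms by (intro continuous_intros holomorphic_on_imp_continuous_on holomorphic_on_subset[OF _ sub])
  then obtain w where w: "w \<in> cball 0 \<rho>" "\<And>z. z \<in> cball 0 \<rho> \<Longrightarrow> norm (\<phi> z) \<le> norm (\<phi> w)"
    using continuous_attains_sup[of "cball 0 \<rho>" "\<lambda>z. norm (\<phi> z)"] assms by auto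
  have "norm (\<phi> w) < 1" using w sub assms by (auto simp: image_subset_iff)
  then obtain r where "max r0 (norm (\<phi> w)) < r" "r < 1" using assms dense[of "max r0 (norm (\<phi> w))" 1] by auto
  then show ?thesis using w(2) by (intro that[of r]) (auto intro: order_le_less_trans)
qed

lemma Littlewood_subordination:
  assumes p: "1 \<le> p" and f: "f \<in> Hp p" and \<phi>: "\<phi> holomorphic_on \<D>" "\<phi> ` \<D> \<subseteq> \<D>"
  defines "g \<equiv> \<lambda>z. if z \<in> \<D> then f (\<phi> z) else 0"
  shows "g \<in> Hp p" "Hp_norm p g \<le> (4 / (1 - norm (\<phi> 0))) powr (1/p) * Hp_norm p f"
proof -
  have n0: "norm (\<phi> 0) < 1" using \<phi>(2) by (auto simp: image_subset_iff)
  have g: "g holomorphic_on \<D>"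
  proof -
    have "(f \<circ> \<phi>) holomorphic_on \<D>" by (rule holomorphic_on_compose_gen[OF \<phi>(1) HpD(1)[OF f] \<phi>(2)])
    then show ?thesis by (rule holomorphic_transform) (simp add: g_def)
  qed
  have m: "Hp_mean p g \<rho> \<le> ((4 / (1 - norm (\<phi> 0))) powr (1/p) * Hp_norm p f) powr p" if \<rho>: "0 < \<rho>" "\<rho> < 1" for \<rho>
  proof -
    \<comment> \<open>The lower bound on \<open>r\<close> gives
      \<open>r - norm (\<phi> 0) \<ge> (1 - norm (\<phi> 0)) / 2\<close>, so the Poisson kernel is
      at most \<open>4 / (1 - norm (\<phi> 0))\<close>.\<close>
    obtain r where r: "(1 + norm (\<phi> 0)) / 2 \<le> r" "r < 1" "\<And>z. z \<in> cball 0 \<rho> \<Longrightarrow> norm (\<phi> z) < r"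
      using exists_radius[OF \<phi> \<rho>, of "(1 + norm (\<phi> 0)) / 2"] n0 by auto
    have r0: "0 < r" using r(3)[of 0] \<rho> order_le_less_trans[OF norm_ge_zero] by simp
    have rl: "norm (\<phi> 0) < r" using r(3)[of 0] \<rho> by simp
    have hf: "f holomorphic_on cball 0 r" by (rule holomorphic_on_subset[OF HpD(1)[OF f]]) (use r in auto)
    have cf: "continuous_on A (\<lambda>t. f (of_real r * cis t))" for A
      using r0 by (intro continuous_on_circle[OF hf]) (simp add: norm_mult)
    have cfp: "continuous_on A (\<lambda>t. norm (f (of_real r * cis t)) powr p)" for A
      using p by (intro continuous_on_norm_powr cf) auto
    have "Hp_mean p g \<rho> = Hp_mean p (\<lambda>z. f (\<phi> z)) \<rho>"
      using \<rho> by (simp add: Hp_mean_def g_def norm_mult)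
    also have "\<dots> \<le> integral {0..2*pi} (\<lambda>t. poisson r (\<phi> 0) t * norm (f (of_real r * cis t)) powr p)"
      using p \<rho> r hf by (intro subordination holomorphic_on_subset[OF \<phi>(1)]) auto
    also have "\<dots> \<le> integral {0..2*pi} (\<lambda>t. 4 / (1 - norm (\<phi> 0)) * norm (f (of_real r * cis t)) powr p)"
    proof (rule integral_le)
      fix t
      have "poisson r (\<phi> 0) t \<le> (r + norm (\<phi> 0)) / (r - norm (\<phi> 0))" by (rule poisson_bounds(2)[OF rl])
      also have "\<dots> \<le> 2 / ((1 - norm (\<phi> 0)) / 2)"
        using r n0 rl by (intro frac_le) (auto simp: field_simps)
      finally have "poisson r (\<phi> 0) t \<le> 4 / (1 - norm (\<phi> 0))" by simp
      then show "poisson r (\<phi> 0) t * norm (f (of_real r * cis t)) powr p \<le> 4 / (1 - norm (\<phi> 0)) * norm (f (of_real r * cis t)) powr p"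
        by (intro mult_right_mono) auto
    qed (intro integrable_continuous_real continuous_on_mult continuous_on_poisson[OF rl] cfp continuous_on_const)+
    also have "\<dots> = 4 / (1 - norm (\<phi> 0)) * Hp_mean p f r" by (simp add: Hp_mean_def)
    also have "\<dots> \<le> 4 / (1 - norm (\<phi> 0)) * Hp_norm p f powr p"
      using f p r0 r n0 by (intro mult_left_mono Hp_mean_le_norm) auto
    also have "\<dots> = ((4 / (1 - norm (\<phi> 0))) powr (1/p) * Hp_norm p f) powr p"
      using n0 p by (simp add: powr_mult powr_powr)
    finally show ?thesis .
  qed
  show "g \<in> Hp p" by (rule HpI[OF g _ m]) (simp add: g_def)
  show "Hp_norm p g \<le> (4 / (1 - norm (\<phi> 0))) powr (1/p) * Hp_norm p f"
    using p m by (intro Hp_norm_leI) (auto simp: Hp_norm_nonneg)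
qed

text \<open>\<open>poisson_jensen\<close> on a circle whose radius is halfway between
  \<open>norm z\<close> and 1, where the kernel is bounded.\<close>

lemma Hp_eval_bound:
  assumes p: "1 \<le> p" and z: "z \<in> \<D>"
  shows "\<exists>K\<ge>0. \<forall>f\<in>Hp p. norm (f z) \<le> K * Hp_norm p f"
proof -
  define r where "r = (1 + norm z) / 2"
  have r: "norm z < r" "0 < r" "r < 1" using z norm_ge_zero[of z] by (auto simp: r_def simp del: norm_ge_zero)
  define c where "c = (r + norm z) / (r - norm z)"
  have c: "0 \<le> c" using r by (simp add: c_def)
  have "norm (f z) \<le> (c / (2 * pi)) powr (1/p) * Hp_norm p f" if f: "f \<in> Hp p" for f
  proof -
    have hf: "f holomorphic_on cball 0 r" by (rule holomorphic_on_subset[OF HpD(1)[OF f]]) (use r in auto)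
    have cf: "continuous_on A (\<lambda>t. f (of_real r * cis t))" for A
      using r by (intro continuous_on_circle[OF hf]) (simp add: norm_mult)
    have cfp: "continuous_on A (\<lambda>t. norm (f (of_real r * cis t)) powr p)" for A
      using p by (intro continuous_on_norm_powr cf) auto
    have "2 * pi * norm (f z) powr p \<le> integral {0..2*pi} (\<lambda>t. poisson r z t * norm (f (of_real r * cis t)) powr p)"
      by (rule poisson_jensen[OF p hf r(1)])
    also have "\<dots> \<le> integral {0..2*pi} (\<lambda>t. c * norm (f (of_real r * cis t)) powr p)"
    proof (rule integral_le)
      show "poisson r z t * norm (f (of_real r * cis t)) powr p \<le> c * norm (f (of_real r * cis t)) powr p" for t
        using poisson_bounds(2)[OF r(1)] by (intro mult_right_mono) (auto simp: c_def)
    qed (intro integrable_continuous_real continuous_on_mult continuous_on_poisson[OF r(1)] cfp continuous_on_const)+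
    also have "\<dots> = c * Hp_mean p f r" by (simp add: Hp_mean_def)
    also have "\<dots> \<le> c * Hp_norm p f powr p" using f p r c by (intro mult_left_mono Hp_mean_le_norm) auto
    finally have "norm (f z) powr p \<le> c / (2 * pi) * Hp_norm p f powr p" by (simp add: field_simps)
    then have "(norm (f z) powr p) powr (1/p) \<le> (c / (2 * pi) * Hp_norm p f powr p) powr (1/p)"
      using p by (intro powr_mono2) auto
    also have "\<dots> = (c / (2 * pi)) powr (1/p) * Hp_norm p f"
      using p by (simp only: powr_mult powr_powr) (simp add: Hp_norm_nonneg)
    finally show ?thesis using p by (simp add: powr_powr)
  qed
  then show ?thesis by (intro exI[of _ "(c / (2 * pi)) powr (1/p)"]) auto
qed

section \<open>Density of the polynomials\<close>

text \<open>For equal norms, strictness comes from the parallelogram law; for different norms, from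
  strict convexity of the power at their mean.\<close>

lemma norm_powr_midpoint_strict:
  fixes x y :: complex
  assumes p: "1 < p" and ne: "x \<noteq> y"
  shows "norm ((x + y) / 2) powr p < (norm x powr p + norm y powr p) / 2"
proof -
  define m where "m = (norm x + norm y) / 2"
  have m: "0 < m" using ne by (auto simp: m_def add_nonneg_eq_0_iff less_le)
  have nm: "norm ((x + y) / 2) \<le> m" using norm_triangle_ineq[of x y] by (simp add: m_def norm_divide)
  show ?thesis
  proof (cases "norm x = norm y")
    case True
    then have xm: "norm x = m" "norm y = m" by (auto simp: m_def)
    have "(norm (x + y))\<^sup>2 + (norm (x - y))\<^sup>2 = 2 * (norm x)\<^sup>2 + 2 * (norm y)\<^sup>2"
      unfolding cmod_power2 by (simp add: algebra_simps power2_eq_square)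
    moreover have "0 < (norm (x - y))\<^sup>2" using ne by simp
    ultimately have "(norm (x + y))\<^sup>2 < (2 * m)\<^sup>2" using xm by (simp add: power2_eq_square)
    then have "norm (x + y) < 2 * m" using m power2_less_imp_less[of "norm (x + y)" "2 * m"] by linarith
    then have "norm ((x + y) / 2) powr p < m powr p" using p by (intro powr_less_mono2) (auto simp: norm_divide)
    then show ?thesis using xm by simp
  next
    case False
    then have "norm x \<noteq> m" "norm y \<noteq> m" by (auto simp: m_def)
    then have "m powr p + p * m powr (p - 1) * (norm x - m) < norm x powr p"
       "m powr p + p * m powr (p - 1) * (norm y - m) < norm y powr p"
      using p m by (auto intro!: powr_tangent_strict)
    moreover have "p * m powr (p - 1) * (norm x - m) + p * m powr (p - 1) * (norm y - m) = 0"
      by (simp add: m_def field_simps)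
    ultimately have "m powr p < (norm x powr p + norm y powr p) / 2" by simp
    moreover have "norm ((x + y) / 2) powr p \<le> m powr p" using p nm by (intro powr_mono2) auto
    ultimately show ?thesis by simp
  qed
qed

text \<open>Integrating this inequality gives the uniform convexity of the \<open>Lp\<close> norm.\<close>

lemma uniform_convexity:
  assumes p: "1 < p" and e: "0 < \<epsilon>"
  shows "\<exists>K\<ge>0. \<forall>x y::complex. norm (x - y) powr p \<le> \<epsilon> * (norm x powr p + norm y powr p)
     + K * ((norm x powr p + norm y powr p) / 2 - norm ((x + y) / 2) powr p)"
proof -
  define A where "A x y = norm x powr p + norm y powr p" for x y :: complex
  define D where "D x y = A x y / 2 - norm ((x + y) / 2) powr p" for x y
  have D0: "0 \<le> D x y" for x y
    using norm_powr_midpoint_strict[OF p, of x y] by (cases "x = y") (auto simp: D_def A_def)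
  have cA: "continuous_on S (\<lambda>z. A (fst z) (snd z))" for S
    unfolding A_def using p by (intro continuous_intros continuous_on_norm_powr) auto
  have cD: "continuous_on S (\<lambda>z. D (fst z) (snd z))" for S
    unfolding D_def using p by (intro continuous_intros continuous_on_norm_powr cA) auto
  \<comment> \<open>\<open>T\<close> is the part of the unit sphere where the term with \<epsilon>
    alone does not suffice. It is compact and avoids the diagonal, so the defect \<open>D\<close>
    has a positive minimum on it.\<close>
  define T where "T = sphere (0::complex\<times>complex) 1 \<inter> {z. \<epsilon> * A (fst z) (snd z) \<le> norm (fst z - snd z) powr p}"
  have "closed {z::complex\<times>complex. \<epsilon> * A (fst z) (snd z) \<le> norm (fst z - snd z) powr p}"
    using p by (intro closed_Collect_le continuous_intros cA continuous_on_norm_powr) auto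
  then have cT: "compact T" unfolding T_def by (intro compact_Int_closed) auto
  have "\<exists>\<delta>>0. \<forall>z\<in>T. \<delta> \<le> D (fst z) (snd z)"
  proof (cases "T = {}")
    case False
    obtain z where z: "z \<in> T" "\<And>w. w \<in> T \<Longrightarrow> D (fst z) (snd z) \<le> D (fst w) (snd w)"
      using continuous_attains_inf[OF cT False cD] by auto
    have "fst z \<noteq> snd z"
    proof
      assume eq: "fst z = snd z"
      then have "\<epsilon> * A (fst z) (snd z) \<le> 0" using z(1) by (simp add: T_def)
      then have "A (fst z) (snd z) \<le> 0" using e by (simp add: mult_le_0_iff)
      then have "norm (fst z) powr p = 0" using eq by (simp add: A_def)
      then have "fst z = 0" by simp
      then have "norm z = 0" using eq by (simp add: norm_prod_def)
      with z(1) show False by (simp add: T_def)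
    qed
    then have "0 < D (fst z) (snd z)" using norm_powr_midpoint_strict[OF p] by (simp add: D_def A_def)
    then show ?thesis using z(2) by blast
  qed (auto intro: exI[of _ 1])
  then obtain \<delta> where \<delta>: "0 < \<delta>" "\<And>z. z \<in> T \<Longrightarrow> \<delta> \<le> D (fst z) (snd z)" by auto
  \<comment> \<open>On the sphere \<open>norm (x - y) \<le> 2\<close>, so this \<open>K\<close>
    absorbs the left side on \<open>T\<close>. All terms are homogeneous of degree \<open>p\<close>,
    which settles the pairs off the sphere.\<close>
  define K where "K = 2 powr p / \<delta>"
  have K: "0 \<le> K" using \<delta> by (simp add: K_def)
  have sph: "norm (x - y) powr p \<le> \<epsilon> * A x y + K * D x y" if n1: "norm (x, y) = 1" for x y
  proof (cases "(x, y) \<in> T")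
    case True
    have "norm x \<le> 1" "norm y \<le> 1" using norm_fst_le[of x y] norm_snd_le[of y x] n1 by auto
    then have "norm (x - y) \<le> 2" using norm_triangle_ineq4[of x y] by linarith
    then have "norm (x - y) powr p \<le> 2 powr p" using p by (intro powr_mono2) auto
    also have "\<dots> = K * \<delta>" using \<delta> by (simp add: K_def)
    also have "\<dots> \<le> K * D x y" using \<delta>(2)[OF True] K by (intro mult_left_mono) auto
    finally show ?thesis using e by (simp add: A_def add_increasing)
  next
    case False
    then have "norm (x - y) powr p \<le> \<epsilon> * A x y" using n1 by (auto simp: T_def)
    then show ?thesis using K D0[of x y] by (simp add: add_increasing2)
  qed
  have "norm (x - y) powr p \<le> \<epsilon> * A x y + K * D x y" for x y
  proof (cases "(x, y) = 0")
    case True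
    then show ?thesis using p by (simp add: A_def D_def zero_prod_def)
  next
    case False
    define s where "s = norm (x, y)"
    have s: "0 < s" using False by (simp add: s_def)
    define x' y' where "x' = x / of_real s" and "y' = y / of_real s"
    have xy: "x = of_real s * x'" "y = of_real s * y'" using s by (auto simp: x'_def y'_def)
    have "(x', y') = (1/s) *\<^sub>R (x, y)" by (simp add: x'_def y'_def scaleR_conv_of_real)
    then have "norm (x', y') = \<bar>1/s\<bar> * norm (x, y)" by (simp only: norm_scaleR)
    then have "norm (x', y') = 1" using s by (simp only: s_def[symmetric]) simp
    then have *: "norm (x' - y') powr p \<le> \<epsilon> * A x' y' + K * D x' y'" by (rule sph)
    have sc: "norm (of_real s * u) powr p = s powr p * norm u powr p" for u :: complex
      using s by (simp add: norm_mult powr_mult)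
    have A: "A x y = s powr p * A x' y'" unfolding A_def xy sc by (simp add: algebra_simps)
    have "(x + y) / 2 = of_real s * ((x' + y') / 2)" by (simp add: xy algebra_simps)
    then have D: "D x y = s powr p * D x' y'" unfolding D_def A by (simp only: sc) (simp add: algebra_simps)
    have "x - y = of_real s * (x' - y')" by (simp add: xy algebra_simps)
    then have "norm (x - y) powr p = s powr p * norm (x' - y') powr p" by (simp only: sc)
    also have "\<dots> \<le> s powr p * (\<epsilon> * A x' y' + K * D x' y')" using * by (intro mult_left_mono) auto
    finally show ?thesis by (simp add: A D algebra_simps)
  qed
  then show ?thesis using K unfolding A_def D_def by blast
qed

definition zext :: "(complex \<Rightarrow> complex) \<Rightarrow> complex \<Rightarrow> complex" where
  "zext f z = (if z \<in> \<D> then f z else 0)"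

lemma zext_simps [simp]: "z \<in> \<D> \<Longrightarrow> zext f z = f z" "z \<notin> \<D> \<Longrightarrow> zext f z = 0"
  by (auto simp: zext_def)

lemma zext_holomorphic: "f holomorphic_on \<D> \<Longrightarrow> zext f holomorphic_on \<D>"
  by (rule holomorphic_transform) auto

text \<open>The means of \<open>f\<close> and of its dilate are at most \<open>B\<close>. If the
  mean of their midpoint \<open>g\<close> is close to \<open>B\<close>, uniform convexity makes the
  mean of the difference small.\<close>

lemma dilation_approx:
  assumes p: "1 < p" and f: "f \<in> Hp p" and e: "0 < e"
  shows "\<exists>r. 0 < r \<and> r < 1 \<and> Hp_norm p (\<lambda>z. f z - zext (\<lambda>z. f (of_real r * z)) z) < e"
proof -
  note fh = HpD(1)[OF f]
  define B where "B = Hp_norm p f powr p"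
  have B: "Hp_mean p f r \<le> B" if "0 < r" "r < 1" for r
    unfolding B_def using p that f by (intro Hp_mean_le_norm) auto
  have B0: "0 \<le> B" by (simp add: B_def)
  define e1 where "e1 = (e / 2) powr p"
  have e1: "0 < e1" using e by (simp add: e1_def)
  define \<epsilon> where "\<epsilon> = e1 / (4 * (B + 1))"
  have \<epsilon>: "0 < \<epsilon>" using e1 B0 by (simp add: \<epsilon>_def)
  have \<epsilon>B: "\<epsilon> * (B + B) \<le> e1 / 2" using B0 e1 by (simp add: \<epsilon>_def field_simps)
  obtain K where K: "0 \<le> K" "\<And>x y::complex. norm (x - y) powr p \<le> \<epsilon> * (norm x powr p + norm y powr p)
     + K * ((norm x powr p + norm y powr p) / 2 - norm ((x + y) / 2) powr p)"
    using uniform_convexity[OF p \<epsilon>] by blast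
  define \<eta> where "\<eta> = e1 / (4 * (K + 1))"
  have \<eta>: "0 < \<eta>" using e1 K by (simp add: \<eta>_def)
  have K\<eta>: "K * (2 * \<eta>) \<le> e1 / 2" using K e1 by (simp add: \<eta>_def field_simps)
  have "\<exists>\<rho>\<in>{0<..<1}. B - \<eta> < Hp_mean p f \<rho>"
  proof (rule ccontr)
    assume "\<not> ?thesis"
    then have le: "Hp_mean p f r \<le> B - \<eta>" if "0 < r" "r < 1" for r using that by (auto simp: not_less)
    then have "0 \<le> B - \<eta>" using Hp_mean_nonneg[of p f "1/2"] le[of "1/2"] by linarith
    then have "Hp_norm p f \<le> (B - \<eta>) powr (1/p)"
      using p le by (intro Hp_norm_leI) (auto simp: powr_powr)
    then have "B \<le> ((B - \<eta>) powr (1/p)) powr p" unfolding B_def using p by (intro powr_mono2) (auto simp: Hp_norm_nonneg)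
    then have "B \<le> B - \<eta>" using \<open>0 \<le> B - \<eta>\<close> p by (simp add: powr_powr)
    then show False using \<eta> by simp
  qed
  then obtain \<rho> where \<rho>: "0 < \<rho>" "\<rho> < 1" "B - \<eta> < Hp_mean p f \<rho>" by auto
  have sub: "cball 0 \<rho> \<subseteq> \<D>" using \<rho> by auto
  have cf: "continuous_on (cball 0 \<rho>) f" by (intro holomorphic_on_imp_continuous_on holomorphic_on_subset[OF fh sub])
  obtain L where "0 < L" "\<forall>x\<in>f ` cball 0 \<rho>. norm x \<le> L"
    using compact_imp_bounded[OF compact_continuous_image[OF cf compact_cball]] unfolding bounded_pos by blast
  then have L: "\<And>z. z \<in> cball 0 \<rho> \<Longrightarrow> norm (f z) \<le> L" "0 < L" by auto
  \<comment> \<open>With this \<delta> the tangent inequality for the power loses at most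
    \<open>\<eta> / (2 * pi)\<close> at each point of the circle, hence at most \<eta> in the
    mean.\<close>
  define \<delta> where "\<delta> = \<eta> / (2 * pi * p * L powr (p - 1))"
  have \<delta>: "0 < \<delta>" using \<eta> p L by (simp add: \<delta>_def)
  obtain d where d: "0 < d" "\<And>x y. x \<in> cball 0 \<rho> \<Longrightarrow> y \<in> cball 0 \<rho> \<Longrightarrow> dist y x < d \<Longrightarrow> dist (f y) (f x) < \<delta>"
    using compact_uniformly_continuous[OF cf compact_cball] \<delta> unfolding uniformly_continuous_on_def by metis
  define r where "r = max (1/2) (1 - d / 2)"
  have r: "0 < r" "r < 1" "1 - r < d" using d by (auto simp: r_def max_def)
  define fr where "fr = zext (\<lambda>z. f (of_real r * z))"
  have rD: "of_real r * z \<in> \<D>" if "z \<in> \<D>" for z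
    using that r mult_strict_mono[of r 1 "norm z" 1] by (simp add: norm_mult)
  have frh: "fr holomorphic_on \<D>"
    unfolding fr_def using rD by (intro zext_holomorphic holomorphic_on_compose_gen[OF _ fh, unfolded o_def] holomorphic_intros) auto
  have Mfr: "Hp_mean p fr s = Hp_mean p f (r * s)" if "0 < s" "s < 1" for s
    unfolding Hp_mean_def fr_def using circle_in_disc[of s] that by (simp add: mult.assoc)
  have Bfr: "Hp_mean p fr s \<le> B" if s: "0 < s" "s < 1" for s
    unfolding Mfr[OF s] using r s mult_strict_mono[of r 1 s 1] by (intro B) auto
  define g where "g z = (fr z + f z) / 2" for z
  have gh: "g holomorphic_on \<D>" unfolding g_def by (intro holomorphic_intros frh fh) auto
  define q where "q z = f z - fr z" for z
  have qh: "q holomorphic_on \<D>" unfolding q_def by (intro holomorphic_intros frh fh)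
  note int = Hp_mean_integrable[OF fh] Hp_mean_integrable[OF frh] Hp_mean_integrable[OF gh] Hp_mean_integrable[OF qh]
  have Mg: "B - 2 * \<eta> \<le> Hp_mean p g \<rho>"
  proof -
    have "Hp_mean p f \<rho> - \<eta> = integral {0..2*pi} (\<lambda>t. norm (f (of_real \<rho> * cis t)) powr p - \<eta> / (2 * pi))"
      using int \<rho> p by (subst integral_diff) (auto simp: Hp_mean_def)
    also have "\<dots> \<le> Hp_mean p g \<rho>" unfolding Hp_mean_def
    proof (rule integral_le)
      show "(\<lambda>t. norm (f (of_real \<rho> * cis t)) powr p - \<eta> / (2 * pi)) integrable_on {0..2*pi}"
        using int \<rho> p by (intro integrable_diff) auto
      show "(\<lambda>t. norm (g (of_real \<rho> * cis t)) powr p) integrable_on {0..2*pi}"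
        using int \<rho> p by auto
      fix t
      define z where "z = of_real \<rho> * cis t"
      have z: "z \<in> cball 0 \<rho>" "z \<in> \<D>" using \<rho> by (auto simp: z_def norm_mult)
      have rz: "of_real r * z \<in> cball 0 \<rho>" using z(1) r mult_mono[of r 1 "norm z" \<rho>] by (simp add: norm_mult)
      have "dist (of_real r * z) z = (1 - r) * norm z"
      proof -
        have "dist (of_real r * z) z = norm (of_real (r - 1) * z)" by (simp add: dist_norm algebra_simps)
        also have "\<dots> = \<bar>r - 1\<bar> * norm z" by (simp only: norm_mult norm_of_real)
        finally show ?thesis using r by simp
      qed
      also have "\<dots> \<le> (1 - r) * 1" using z r by (intro mult_left_mono) auto
      finally have "dist (of_real r * z) z < d" using r by simp
      then have df: "norm (fr z - f z) < \<delta>" using d(2)[OF z(1) rz] z(2) by (simp add: fr_def dist_norm)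
      have "norm (f z) - norm (g z) \<le> norm (f z - g z)" by (rule norm_triangle_ineq2)
      also have "f z - g z = - (fr z - f z) / 2" by (simp add: g_def field_simps)
      also have "norm (- (fr z - f z) / 2) \<le> \<delta>" using df \<delta> by (simp only: norm_divide norm_minus_cancel norm_numeral)
      finally have fg: "norm (f z) - norm (g z) \<le> \<delta>" .
      show "norm (f (of_real \<rho> * cis t)) powr p - \<eta> / (2 * pi) \<le> norm (g (of_real \<rho> * cis t)) powr p"
        unfolding z_def[symmetric]
      proof (cases "f z = 0")
        case True
        then have "norm (f z) powr p - \<eta> / (2 * pi) \<le> 0" using p \<eta> by simp
        then show "norm (f z) powr p - \<eta> / (2 * pi) \<le> norm (g z) powr p" using powr_ge_zero order_trans by blast
      next
        case False
        have "norm (f z) powr p + p * norm (f z) powr (p - 1) * (norm (g z) - norm (f z)) \<le> norm (g z) powr p"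
          using p False by (intro powr_tangent) auto
        moreover have "p * norm (f z) powr (p - 1) * (norm (f z) - norm (g z)) \<le> p * L powr (p - 1) * \<delta>"
        proof -
          have "p * norm (f z) powr (p - 1) * (norm (f z) - norm (g z)) \<le> p * norm (f z) powr (p - 1) * \<delta>"
            using fg p by (intro mult_left_mono) auto
          also have "\<dots> \<le> p * L powr (p - 1) * \<delta>"
            using p \<delta> L(1)[OF z(1)] by (intro mult_right_mono mult_left_mono powr_mono2) auto
          finally show ?thesis .
        qed
        moreover have "p * L powr (p - 1) * \<delta> = \<eta> / (2 * pi)" using p L by (simp add: \<delta>_def)
        ultimately show "norm (f z) powr p - \<eta> / (2 * pi) \<le> norm (g z) powr p" by (simp add: algebra_simps)
      qed
    qed
    finally show ?thesis using \<rho> by simp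
  qed
  \<comment> \<open>The mean of \<open>g\<close> increases with the radius, so its lower bound at
    \<rho> persists for all \<open>s \<ge> \<rho>\<close>. Smaller radii follow later from the
    monotonicity of the mean of \<open>q\<close>.\<close>
  have big: "Hp_mean p q s \<le> e1" if s: "\<rho> \<le> s" "s < 1" for s
  proof -
    have s0: "0 < s" using s \<rho> by simp
    have ip: "0 < p" using p by simp
    let ?f = "\<lambda>t. norm (f (of_real s * cis t)) powr p"
    let ?fr = "\<lambda>t. norm (fr (of_real s * cis t)) powr p"
    let ?g = "\<lambda>t. norm (g (of_real s * cis t)) powr p"
    note I = int(1)[OF ip less_imp_le[OF s0] s(2)] int(2)[OF ip less_imp_le[OF s0] s(2)] int(3)[OF ip less_imp_le[OF s0] s(2)]
    have "Hp_mean p q s \<le> integral {0..2*pi} (\<lambda>t. (\<epsilon> + K / 2) * ?f t + (\<epsilon> + K / 2) * ?fr t - K * ?g t)"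
      unfolding Hp_mean_def
    proof (rule integral_le)
      show "(\<lambda>t. norm (q (of_real s * cis t)) powr p) integrable_on {0..2*pi}" using int(4)[OF ip less_imp_le[OF s0] s(2)] .
      show "(\<lambda>t. (\<epsilon> + K / 2) * ?f t + (\<epsilon> + K / 2) * ?fr t - K * ?g t) integrable_on {0..2*pi}"
        by (intro integrable_diff integrable_add integrable_on_mult_right I)
      show "norm (q (of_real s * cis t)) powr p \<le> (\<epsilon> + K / 2) * ?f t + (\<epsilon> + K / 2) * ?fr t - K * ?g t" for t
        using K(2)[of "f (of_real s * cis t)" "fr (of_real s * cis t)"] by (simp add: q_def g_def algebra_simps add_divide_distrib)
    qed
    also have "\<dots> = (\<epsilon> + K / 2) * Hp_mean p f s + (\<epsilon> + K / 2) * Hp_mean p fr s - K * Hp_mean p g s"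
      unfolding Hp_mean_def using I
      by (simp add: integral_diff integral_add integrable_diff integrable_add integrable_on_mult_right)
    also have "\<dots> \<le> (\<epsilon> + K / 2) * B + (\<epsilon> + K / 2) * B - K * (B - 2 * \<eta>)"
      using K \<epsilon> s0 s \<rho> p Mg Hp_mean_mono[OF _ gh, of p \<rho> s]
      by (intro diff_mono add_mono mult_left_mono B Bfr) auto
    also have "\<dots> = \<epsilon> * (B + B) + K * (2 * \<eta>)" by (simp add: algebra_simps)
    also have "\<dots> \<le> e1" using \<epsilon>B K\<eta> by simp
    finally show ?thesis .
  qed
  have "Hp_norm p q \<le> e / 2"
  proof (rule Hp_norm_leI)
    fix s :: real assume s: "0 < s" "s < 1"
    show "Hp_mean p q s \<le> (e / 2) powr p"
    proof (cases "\<rho> \<le> s")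
      case True then show ?thesis using big[OF True s(2)] by (simp add: e1_def)
    next
      case False
      then have "Hp_mean p q s \<le> Hp_mean p q \<rho>" using s \<rho> p by (intro Hp_mean_mono[OF _ qh]) auto
      then show ?thesis using big[of \<rho>] \<rho> by (simp add: e1_def)
    qed
  qed (use p e in auto)
  then have "Hp_norm p q < e" using e by simp
  then show ?thesis using r unfolding q_def fr_def by blast
qed

lemma holomorphic_poly_approx:
  fixes f :: "complex \<Rightarrow> complex"
  assumes f: "f holomorphic_on ball 0 R" and s: "0 < s" "s < R" and e: "0 < e"
  shows "\<exists>q. \<forall>z\<in>cball 0 s. norm (f z - poly q z) < e"
proof -
  define a where "a n = (deriv ^^ n) f 0 / fact n" for n
  have sums: "(\<lambda>n. a n * z ^ n) sums f z" if "z \<in> ball 0 R" for z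
    using holomorphic_power_series[OF f that] by (simp add: a_def)
  obtain u where u: "s < u" "u < R" using s dense by blast
  have "summable (\<lambda>n. a n * of_real u ^ n)" using sums[of "of_real u"] u s by (auto simp: sums_iff)
  then have sm: "summable (\<lambda>n. norm (a n * of_real s ^ n))" using u s by (intro powser_insidea) auto
  obtain N where N: "\<And>n. n \<ge> N \<Longrightarrow> norm (\<Sum>i. norm (a (i + n) * of_real s ^ (i + n))) < e"
    using suminf_exist_split[OF e sm] by auto
  define q where "q = (\<Sum>i<N. monom (a i) i)"
  have "norm (f z - poly q z) < e" if z: "z \<in> cball 0 s" for z
  proof -
    have zR: "z \<in> ball 0 R" using z s by auto
    have le: "norm (a i * z ^ i) \<le> norm (a i * of_real s ^ i)" for i
      using z s by (auto simp: norm_mult norm_power intro!: mult_left_mono power_mono)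
    have sz: "summable (\<lambda>n. norm (a n * z ^ n))"
      by (rule summable_comparison_test'[OF sm, of 0]) (use le in auto)
    have "f z = (\<Sum>i. a (i + N) * z ^ (i + N)) + (\<Sum>i<N. a i * z ^ i)"
      using sums[OF zR] suminf_split_initial_segment[of "\<lambda>i. a i * z ^ i" N] by (simp add: sums_iff)
    then have "f z - poly q z = (\<Sum>i. a (i + N) * z ^ (i + N))"
      by (simp add: q_def poly_sum poly_monom)
    also have "norm \<dots> \<le> (\<Sum>i. norm (a (i + N) * z ^ (i + N)))"
      by (rule summable_norm) (use sz summable_ignore_initial_segment in blast)
    also have "\<dots> \<le> (\<Sum>i. norm (a (i + N) * of_real s ^ (i + N)))"
      by (rule suminf_le[OF le]) (use sz sm summable_ignore_initial_segment in blast)+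
    also have "\<dots> \<le> norm \<dots>" by simp
    also have "\<dots> < e" by (rule N) simp
    finally show ?thesis .
  qed
  then show ?thesis by blast
qed

lemma Hp_poly_dense:
  assumes p: "1 < p" and f: "f \<in> Hp p" and e: "0 < e"
  shows "\<exists>q. Hp_norm p (\<lambda>z. f z - zext (poly q) z) < e"
proof -
  obtain r where r: "0 < r" "r < 1" "Hp_norm p (\<lambda>z. f z - zext (\<lambda>z. f (of_real r * z)) z) < e / 4"
    using dilation_approx[OF p f, of "e/4"] e by auto
  have h: "(\<lambda>z. f (of_real r * z)) holomorphic_on ball 0 (1 / r)"
  proof (intro holomorphic_on_compose_gen[OF _ HpD(1)[OF f], unfolded o_def] holomorphic_intros)
    show "(*) (complex_of_real r) ` ball 0 (1 / r) \<subseteq> \<D>"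
      using r by (auto simp: norm_mult field_simps)
  qed
  \<comment> \<open>\<open>2 * pi + 1\<close> dominates \<open>(2 * pi) powr (1 / p)\<close>, the
    norm of the constant 1. The quarter leaves room for the factor 2 of
    \<open>Hp_add\<close>.\<close>
  define e' where "e' = e / (4 * (2 * pi + 1))"
  have e': "0 < e'" using e by (simp add: e'_def add_pos_pos)
  obtain q where "\<forall>z\<in>cball 0 1. norm (f (of_real r * z) - poly q z) < e'"
    using holomorphic_poly_approx[OF h, of 1 e'] r e' by fastforce
  then have q: "\<And>z. z \<in> cball 0 1 \<Longrightarrow> norm (f (of_real r * z) - poly q z) < e'" by blast
  define g1 where "g1 z = f z - zext (\<lambda>z. f (of_real r * z)) z" for z
  define g2 where "g2 z = zext (\<lambda>z. f (of_real r * z) - poly q z) z" for z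
  have sub: "\<D> \<subseteq> ball 0 (1 / r)" using r by (intro subset_ball) (simp add: field_simps)
  have sub1: "cball (0::complex) 1 \<subseteq> ball 0 (1 / r)"
  proof
    fix z :: complex assume "z \<in> cball 0 1"
    moreover have "1 < 1 / r" using r by simp
    ultimately show "z \<in> ball 0 (1 / r)" by simp
  qed
  have fr: "(\<lambda>z. f (of_real r * z)) holomorphic_on \<D>" by (rule holomorphic_on_subset[OF h sub])
  have g2h: "g2 holomorphic_on \<D>" unfolding g2_def
    by (intro zext_holomorphic holomorphic_intros fr)
  have g2: "g2 \<in> Hp p"
    using p q by (intro Hp_bounded[of p g2 e'] g2h) (auto simp: g2_def less_imp_le)
  have frb: "zext (\<lambda>z. f (of_real r * z)) \<in> Hp p"
  proof -
    have "bounded ((\<lambda>z. f (of_real r * z)) ` cball 0 1)"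
      by (intro compact_imp_bounded compact_continuous_image holomorphic_on_imp_continuous_on holomorphic_on_subset[OF h sub1]) auto
    then obtain L where "\<forall>x\<in>(\<lambda>z. f (of_real r * z)) ` cball 0 1. norm x \<le> L" unfolding bounded_iff by blast
    then have "\<And>z. z \<in> cball 0 1 \<Longrightarrow> norm (f (of_real r * z)) \<le> L" by auto
    then show ?thesis using p by (intro Hp_bounded[of p _ L] zext_holomorphic fr) auto
  qed
  have g1: "g1 \<in> Hp p" unfolding g1_def using p by (intro Hp_diff f frb) auto
  have n2: "Hp_norm p g2 \<le> (2 * pi) powr (1 / p) * e'"
  proof (rule Hp_norm_leI)
    fix s :: real assume s: "0 < s" "s < 1"
    have "Hp_mean p g2 s \<le> integral {0..2*pi} (\<lambda>t. e' powr p)"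
      unfolding Hp_mean_def using p q s circle_in_disc[of s]
      by (intro integral_le Hp_mean_integrable powr_mono2 g2h) (auto simp: g2_def norm_mult less_imp_le)
    also have "\<dots> = 2 * pi * e' powr p" by simp
    also have "\<dots> = ((2 * pi) powr (1 / p) * e') powr p" using p by (simp add: powr_mult powr_powr)
    finally show "Hp_mean p g2 s \<le> ((2 * pi) powr (1 / p) * e') powr p" .
  qed (use p e' in auto)
  also have "\<dots> \<le> (2 * pi + 1) * e'"
  proof (intro mult_right_mono)
    have "(2 * pi) powr (1 / p) \<le> (2 * pi + 1) powr (1 / p)" using p by (intro powr_mono2) auto
    also have "\<dots> \<le> (2 * pi + 1) powr 1" using p by (intro powr_mono) auto
    finally show "(2 * pi) powr (1 / p) \<le> 2 * pi + 1" by (simp add: add_nonneg_nonneg)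
  qed (use e' in auto)
  also have "\<dots> = e / 4" by (simp add: e'_def field_simps add_pos_pos less_imp_neq[symmetric])
  finally have n2: "Hp_norm p g2 \<le> e / 4" .
  have eq: "(\<lambda>z. f z - zext (poly q) z) = (\<lambda>z. g1 z + g2 z)"
    by (auto simp: g1_def g2_def zext_def fun_eq_iff)
  have "Hp_norm p (\<lambda>z. g1 z + g2 z) \<le> 2 * (Hp_norm p g1 + Hp_norm p g2)"
    using p by (intro Hp_add g1 g2) auto
  also have "\<dots> < e" using n2 r(3) unfolding g1_def[symmetric] by simp
  finally show ?thesis unfolding eq[symmetric] by blast
qed

section \<open>Eigenfunctions\<close>

text \<open>The integral of \<open>Re G\<close> over a circle is \<open>2 * pi\<close> times its
  value at 0, whatever the radius.\<close>

lemma Hp_harmonic_majorant: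
  assumes p: "0 < p" and f: "f holomorphic_on \<D>" "\<And>z. z \<notin> \<D> \<Longrightarrow> f z = 0"
    and G: "G holomorphic_on \<D>" and le: "\<And>z. z \<in> \<D> \<Longrightarrow> norm (f z) powr p \<le> Re (G z)"
  shows "f \<in> Hp p"
proof (rule HpI[OF f])
  fix r :: real assume r: "0 < r" "r < 1"
  have "G holomorphic_on cball 0 r" by (rule holomorphic_on_subset[OF G]) (use r in auto)
  from has_integral_Re[OF circle_mean_value[OF this r(1)]]
  have I: "((\<lambda>t. Re (G (of_real r * cis t))) has_integral Re (of_real (2 * pi) * G 0)) {0..2*pi}" .
  have "Hp_mean p f r \<le> integral {0..2*pi} (\<lambda>t. Re (G (of_real r * cis t)))"
    unfolding Hp_mean_def using p r f I circle_in_disc[of r]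
    by (intro integral_le Hp_mean_integrable le) (auto simp: has_integral_integrable)
  then show "Hp_mean p f r \<le> Re (of_real (2 * pi) * G 0)" using I by (simp add: integral_unique)
qed

text \<open>The closed linear span in \<open>Hp p\<close>. Closure under limits is itself a rule, so
  a property that is stable under sums, multiples and limits holds on the whole closure by
  induction.\<close>

inductive_set exp_span :: "real \<Rightarrow> (complex \<Rightarrow> complex) \<Rightarrow> real \<Rightarrow> (complex \<Rightarrow> complex) set"
  for p h s where
  base: "Re \<mu> < s \<Longrightarrow> zext (\<lambda>z. exp (\<mu> * h z)) \<in> exp_span p h s"
| add: "f \<in> exp_span p h s \<Longrightarrow> g \<in> exp_span p h s \<Longrightarrow> (\<lambda>z. f z + g z) \<in> exp_span p h s"
| scale: "f \<in> exp_span p h s \<Longrightarrow> (\<lambda>z. c * f z) \<in> exp_span p h s"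
| limit: "f \<in> Hp p \<Longrightarrow> \<forall>e>0. \<exists>g. g \<in> exp_span p h s \<and> Hp_norm p (\<lambda>z. f z - g z) < e \<Longrightarrow> f \<in> exp_span p h s"

locale koenigs_strip =
  fixes p a b :: real and h :: "complex \<Rightarrow> complex"
  assumes p: "1 < p" and h_hol: "h holomorphic_on \<D>" and h_inj: "inj_on h \<D>"
    and ab: "a < b" and strip: "\<And>z. z \<in> \<D> \<Longrightarrow> a < Im (h z) \<and> Im (h z) < b"
    and shift: "\<And>z t. z \<in> \<D> \<Longrightarrow> 0 \<le> t \<Longrightarrow> h z + of_real t \<in> h ` \<D>"
    and int_cl: "interior (closure (h ` \<D>)) = h ` \<D>"
    and comps: "finite (components (- closure (h ` \<D>)))" "card (components (- closure (h ` \<D>))) \<le> 2"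
    and no_strip: "\<not> (\<exists>c d. c < d \<and> horizontal_strip c d \<subseteq> h ` \<D>)"
begin

definition \<Omega> where "\<Omega> = h ` \<D>"
definition U where "U = - closure \<Omega>"
text \<open>The critical exponent: for \<open>0 \<le> s < s0\<close> the angle
  \<open>s * p * (b - a) / 2\<close> stays below a right angle, so that its cosine is
  positive.\<close>

definition s0 where "s0 = pi / (p * (b - a))"
definition B where "B = max \<bar>a\<bar> \<bar>b\<bar>"
definition ef where "ef \<mu> = zext (\<lambda>z. exp (\<mu> * h z))"
abbreviation E where "E \<equiv> exp_span p h s0"

lemma p1: "1 \<le> p" "0 < p" using p by auto

lemma s0_pos: "0 < s0" using p ab by (simp add: s0_def)

lemma B_bound: "z \<in> \<D> \<Longrightarrow> \<bar>Im (h z)\<bar> \<le> B"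
  using strip[of z] by (auto simp: B_def)

section \<open>Geometry of the Koenigs domain and of its complement\<close>

lemma open_\<Omega>: "open \<Omega>" unfolding \<Omega>_def using int_cl by (metis open_interior)

lemma open_U: "open U" by (simp add: U_def open_Compl)

lemma h_in_\<Omega>: "z \<in> \<D> \<Longrightarrow> h z \<in> \<Omega>" by (simp add: \<Omega>_def)

lemma \<Omega>_strip: "w \<in> \<Omega> \<Longrightarrow> a < Im w \<and> Im w < b"
  using strip by (auto simp: \<Omega>_def)

lemma \<Omega>_shift: "w \<in> \<Omega> \<Longrightarrow> 0 \<le> t \<Longrightarrow> w + of_real t \<in> \<Omega>"
  using shift by (auto simp: \<Omega>_def)

lemma closure_\<Omega>_shift: 
  assumes "w \<in> closure \<Omega>" "0 \<le> t" shows "w + of_real t \<in> closure \<Omega>"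
proof -
  have "(\<lambda>x. of_real t + x) ` \<Omega> \<subseteq> \<Omega>" using \<Omega>_shift assms(2) by (auto simp: add.commute)
  then have "closure ((\<lambda>x. of_real t + x) ` \<Omega>) \<subseteq> closure \<Omega>" by (rule closure_mono)
  then have "(\<lambda>x. of_real t + x) ` closure \<Omega> \<subseteq> closure \<Omega>" by (simp add: closure_translation)
  then show ?thesis using assms(1) by (auto simp: add.commute)
qed

lemma closure_\<Omega>_strip:
  assumes "w \<in> closure \<Omega>" shows "a \<le> Im w \<and> Im w \<le> b"
proof -
  have "closed ({w. a \<le> Im w} \<inter> {w. Im w \<le> b})"
    by (intro closed_Int closed_halfspace_Im_ge closed_halfspace_Im_le)
  then have "closure \<Omega> \<subseteq> {w. a \<le> Im w} \<inter> {w. Im w \<le> b}"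
    using \<Omega>_strip by (intro closure_minimal) (auto simp: less_imp_le)
  then show ?thesis using assms by auto
qed

lemma U_shift: "u \<in> U \<Longrightarrow> 0 \<le> t \<Longrightarrow> u - of_real t \<in> U"
  using closure_\<Omega>_shift[of "u - of_real t" t] by (auto simp: U_def)

lemma U_upper: "b < Im w \<Longrightarrow> w \<in> U" and U_lower: "Im w < a \<Longrightarrow> w \<in> U"
  using closure_\<Omega>_strip[of w] by (auto simp: U_def)

abbreviation upp where "upp \<equiv> Complex 0 (b + 1)"
abbreviation low where "low \<equiv> Complex 0 (a - 1)"

text \<open>\<open>U\<close> is invariant under translation to the left, so it contains the whole
  segment ending at the rightmost of the two points.\<close>

lemma same_height_connected:
  assumes "u \<in> U" "v \<in> U" "Im u = Im v"
  shows "connected_component U u v"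
proof -
  have *: "connected_component U u v" if uv: "u \<in> U" "v \<in> U" "Im u = Im v" "Re v \<le> Re u" for u v
  proof -
    have "closed_segment u v \<subseteq> U"
    proof
      fix w assume w: "w \<in> closed_segment u v"
      then have "Im w = Im u" "Re w \<le> Re u"
      proof -
        obtain t where t: "0 \<le> t" "t \<le> 1" "w = (1 - t) *\<^sub>R u + t *\<^sub>R v" using w by (auto simp: in_segment)
        have "Im w = (1 - t) * Im u + t * Im v" "Re w = (1 - t) * Re u + t * Re v" by (simp_all add: t(3))
        moreover have "t * Re v \<le> t * Re u" using t uv by (intro mult_left_mono) auto
        ultimately show "Im w = Im u" "Re w \<le> Re u" using uv by (simp_all add: algebra_simps)
      qed
      then have "w = u - of_real (Re u - Re w)" by (simp add: complex_eq_iff)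
      then show "w \<in> U" using U_shift[OF uv(1), of "Re u - Re w"] \<open>Re w \<le> Re u\<close> by simp
    qed
    then show ?thesis by (auto simp: connected_component_def intro!: exI[of _ "closed_segment u v"])
  qed
  show ?thesis
  proof (cases "Re v \<le> Re u")
    case True then show ?thesis using * assms by blast
  next
    case False
    then have "connected_component U v u" using assms by (intro *) auto
    then show ?thesis by (rule connected_component_sym)
  qed
qed

lemma component_height:
  assumes "connected_component U u v" "min (Im u) (Im v) \<le> y" "y \<le> max (Im u) (Im v)"
  shows "\<exists>w. connected_component U u w \<and> Im w = y"
proof -
  let ?V = "connected_component_set U u"
  have "connected (Im ` ?V)"
    by (intro connected_continuous_image continuous_intros) auto
  moreover have "Im u \<in> Im ` ?V" "Im v \<in> Im ` ?V"
    using assms(1) connected_component_in(1)[OF assms(1)] by (auto intro!: imageI connected_component_refl)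
  ultimately have "y \<in> Im ` ?V" using assms(2,3)
    unfolding connected_iff_interval by (cases "Im u \<le> Im v") (auto simp: min_def max_def split: if_splits)
  then show ?thesis by auto
qed

text \<open>If the two half planes lie in the same component of \<open>U\<close>, then every line of constant height
  meets that component, so it is the only one.\<close>

lemma component_upp_low:
  assumes u: "u \<in> U"
  shows "connected_component U u upp \<or> connected_component U u low"
proof (rule ccontr)
  assume neg: "\<not> ?thesis"
  have ul: "upp \<in> U" "low \<in> U" by (auto intro: U_upper U_lower)
  show False
  proof (cases "connected_component U low upp")
    case True
    have "convex {w. b < Im w}" "convex {w. Im w < a}" by (auto intro: convex_halfspace_Im_gt convex_halfspace_Im_lt)
    have hi: "connected_component U u upp" if "b < Im u"
      unfolding connected_component_def
      by (rule exI[of _ "{w. b < Im w}"]) (use that U_upper \<open>convex {w. b < Im w}\<close> in \<open>auto intro: convex_connected\<close>)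
    have lo: "connected_component U u low" if "Im u < a"
      unfolding connected_component_def
      by (rule exI[of _ "{w. Im w < a}"]) (use that U_lower \<open>convex {w. Im w < a}\<close> in \<open>auto intro: convex_connected\<close>)
    have "a \<le> Im u" "Im u \<le> b" using hi lo neg by (auto simp: not_less[symmetric])
    then obtain w where w: "connected_component U low w" "Im w = Im u"
      using component_height[OF True, of "Im u"] by auto
    have "connected_component U u w" using w connected_component_in[OF w(1)] u by (intro same_height_connected) auto
    then have "connected_component U u low" using w(1) connected_component_sym connected_component_trans by blast
    with neg show False by blast
  next
    case False
    let ?S = "{connected_component_set U u, connected_component_set U upp, connected_component_set U low}"
    have ne: "connected_component_set U x \<noteq> connected_component_set U y" if "x \<in> U" "y \<in> U" "\<not> connected_component U x y" for x y
    proof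
      assume "connected_component_set U x = connected_component_set U y"
      moreover have "y \<in> connected_component_set U y" using connected_component_refl[OF that(2)] by simp
      ultimately have "y \<in> connected_component_set U x" by simp
      then show False using that(3) by simp
    qed
    have "\<not> connected_component U upp low" using False connected_component_sym by blast
    then have "card ?S = 3" using ne[OF u ul(1)] ne[OF u ul(2)] ne[OF ul] neg by simp
    moreover have "?S \<subseteq> components U" using u ul by (auto simp: components_def)
    ultimately have "3 \<le> card (components U)"
      using comps(1) unfolding U_def \<Omega>_def by (metis card_mono)
    then show False using comps(2) by (simp add: U_def \<Omega>_def)
  qed
qed

text \<open>Suppose that two heights are missed by \<open>U\<close>. The strip between them is not
  in \<Omega>, so it contains a point of \<open>U\<close>; the component of this point reaches one
  of the half planes and crosses one of the two heights. Thus every height but at most one,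
  \<open>y0\<close>, is met by \<open>U\<close>, and \<open>U\<close> then contains a left ray of
  that height. Compactness away from \<open>y0\<close> gives a common \<open>M\<close>.\<close>

lemma narrow:
  obtains y0 where "\<And>\<epsilon>. 0 < \<epsilon> \<Longrightarrow> \<exists>M. \<forall>w\<in>\<Omega>. \<epsilon> \<le> \<bar>Im w - y0\<bar> \<longrightarrow> - M < Re w"
proof -
  have uniq: False if y: "y1 < y2" "y1 \<notin> Im ` U" "y2 \<notin> Im ` U" for y1 y2
  proof -
    have bd: "a \<le> y1" "y2 \<le> b"
    proof -
      show "a \<le> y1" using U_lower[of "Complex 0 y1"] y(2) by (force simp: not_less[symmetric])
      show "y2 \<le> b" using U_upper[of "Complex 0 y2"] y(3) by (force simp: not_less[symmetric])
    qed
    have "\<exists>u\<in>U. y1 < Im u \<and> Im u < y2"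
    proof (rule ccontr)
      assume "\<not> ?thesis"
      then have "horizontal_strip y1 y2 \<subseteq> closure \<Omega>" by (auto simp: horizontal_strip_def U_def)
      moreover have "open (horizontal_strip y1 y2)"
        unfolding horizontal_strip_def using open_Int[OF open_halfspace_Im_gt[of y1] open_halfspace_Im_lt[of y2]]
        by (simp add: Collect_conj_eq)
      ultimately have "horizontal_strip y1 y2 \<subseteq> interior (closure \<Omega>)" by (rule interior_maximal)
      then show False using no_strip y(1) int_cl by (auto simp: \<Omega>_def)
    qed
    then obtain u where u: "u \<in> U" "y1 < Im u" "Im u < y2" by blast
    from component_upp_low[OF u(1)] show False
    proof
      assume c: "connected_component U u upp"
      obtain w where "connected_component U u w" "Im w = y2"
        using component_height[OF c, of y2] u bd by auto
      then show False using y(3) connected_component_in by blast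
    next
      assume c: "connected_component U u low"
      obtain w where "connected_component U u w" "Im w = y1"
        using component_height[OF c, of y1] u bd by auto
      then show False using y(2) connected_component_in by blast
    qed
  qed
  obtain y0 where y0: "\<And>y. y \<noteq> y0 \<Longrightarrow> y \<in> Im ` U"
  proof (cases "\<exists>y. y \<notin> Im ` U")
    case True
    then obtain y0 where "y0 \<notin> Im ` U" by blast
    then show ?thesis using uniq by (intro that[of y0]) (metis linorder_neqE)
  qed (use that in blast)
  have "\<exists>M. \<forall>w\<in>\<Omega>. \<epsilon> \<le> \<bar>Im w - y0\<bar> \<longrightarrow> - M < Re w" if \<epsilon>: "0 < \<epsilon>" for \<epsilon>
  proof -
    \<comment> \<open>The heights at which \<open>U\<close> contains the point with real part
      \<open>- n\<close>. These sets are open and increase with \<open>n\<close>, so one of them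
      contains the compact set \<open>?K\<close>.\<close>
    define I where "I n = {y. Complex (- real n) y \<in> U}" for n :: nat
    have I_open: "open (I n)" for n
    proof -
      have "open ((\<lambda>y. Complex (- real n) y) -` U)"
        unfolding Complex_eq by (intro open_vimage open_U continuous_intros)
      then show ?thesis by (simp add: I_def vimage_def)
    qed
    have I_mono: "I m \<subseteq> I n" if "m \<le> n" for m n
    proof
      fix y assume "y \<in> I m"
      then have "Complex (- real m) y - of_real (real n - real m) \<in> U"
        using that by (intro U_shift) (auto simp: I_def)
      moreover have "Complex (- real m) y - of_real (real n - real m) = Complex (- real n) y"
        by (simp add: complex_eq_iff)
      ultimately show "y \<in> I n" by (simp add: I_def)
    qed
    let ?K = "{a..b} - ball y0 \<epsilon>"
    have "compact ?K" by (intro compact_diff) auto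
    moreover have "?K \<subseteq> (\<Union>n. I n)"
    proof
      fix y assume "y \<in> ?K"
      then have "y \<noteq> y0" using \<epsilon> by auto
      then obtain u where u: "u \<in> U" "Im u = y" using y0[of y] by auto
      obtain n :: nat where n: "- Re u \<le> real n" using real_arch_simple by blast
      have "u - of_real (Re u + real n) = Complex (- real n) y" using u by (simp add: complex_eq_iff)
      then have "y \<in> I n" using U_shift[OF u(1), of "Re u + real n"] n by (simp add: I_def)
      then show "y \<in> (\<Union>n. I n)" by blast
    qed
    ultimately obtain C where C: "finite C" "?K \<subseteq> (\<Union>n\<in>C. I n)"
      using compactE_image[of ?K UNIV I] I_open by metis
    define N where "N = Max (insert 0 C)"
    have KN: "?K \<subseteq> I N"
    proof
      fix y assume "y \<in> ?K"
      then obtain n where n: "n \<in> C" "y \<in> I n" using C by blast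
      then have "n \<le> N" unfolding N_def using C(1) by (intro Max_ge) auto
      then show "y \<in> I N" using I_mono n(2) by blast
    qed
    have "- real N < Re w" if w: "w \<in> \<Omega>" "\<epsilon> \<le> \<bar>Im w - y0\<bar>" for w
    proof (rule ccontr)
      assume n: "\<not> - real N < Re w"
      have "Im w \<in> ?K" using \<Omega>_strip[OF w(1)] w(2) by (auto simp: dist_real_def abs_minus_commute)
      then have "Complex (- real N) (Im w) \<in> U" using KN by (auto simp: I_def)
      then have "Complex (- real N) (Im w) - of_real (- real N - Re w) \<in> U" using n by (intro U_shift) auto
      moreover have "Complex (- real N) (Im w) - of_real (- real N - Re w) = w" by (simp add: complex_eq_iff)
      ultimately show False using w(1) closure_subset[of \<Omega>] by (auto simp: U_def)
    qed
    then show ?thesis by blast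
  qed
  then show ?thesis by (rule that)
qed

section \<open>Harmonic majorants of the exponentials\<close>

lemma norm_exp_mult: "norm (exp (\<mu> * w)) = exp (Re \<mu> * Re w) * exp (- Im \<mu> * Im w)"
  by (simp add: norm_exp_eq_Re exp_add[symmetric])

lemma norm_exp_h:
  assumes "z \<in> \<D>"
  shows "norm (exp (\<mu> * h z)) \<le> exp (\<bar>Im \<mu>\<bar> * B) * exp (Re \<mu> * Re (h z))"
proof -
  have "\<bar>- Im \<mu> * Im (h z)\<bar> \<le> \<bar>Im \<mu>\<bar> * B" unfolding abs_mult using B_bound[OF assms] by (simp add: mult_left_mono)
  then have "- Im \<mu> * Im (h z) \<le> \<bar>Im \<mu>\<bar> * B" by linarith
  then have "exp (- Im \<mu> * Im (h z)) \<le> exp (\<bar>Im \<mu>\<bar> * B)" by (simp only: exp_le_cancel_iff)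
  then show ?thesis unfolding norm_exp_mult by (subst mult.commute) (intro mult_right_mono, auto)
qed

lemma ef_hol: "ef \<mu> holomorphic_on \<D>"
  unfolding ef_def by (intro zext_holomorphic holomorphic_intros h_hol)

lemma ef_out: "z \<notin> \<D> \<Longrightarrow> ef \<mu> z = 0" by (simp add: ef_def)

lemma cos_half_le:
  assumes "\<bar>x\<bar> \<le> pi / 3" shows "1 / 2 \<le> cos (x::real)"
proof -
  have "cos (pi / 3) \<le> cos \<bar>x\<bar>" using assms by (intro cos_monotone_0_pi_le) auto
  then show ?thesis by (simp add: cos_60)
qed

text \<open>For \<open>s \<ge> 0\<close>, \<open>G\<close> is a multiple of
  \<open>exp (s * p * h)\<close>, rotated so that the middle line of the strip becomes real: on the
  strip its argument stays below a right angle. For \<open>s < 0\<close> the angle may be large, and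
  \<open>narrow\<close> confines the points far to the left to heights near \<open>y0\<close>, which
  then plays the part of the middle line.\<close>

lemma real_exp_majorant:
  assumes s: "s < s0"
  shows "\<exists>G. G holomorphic_on \<D> \<and> (\<forall>z\<in>\<D>. exp (s * p * Re (h z)) \<le> Re (G z))"
proof (cases "0 \<le> s")
  case True
  define m where "m = (a + b) / 2"
  define c where "c = cos (s * p * ((b - a) / 2))"
  have sp: "s * p * ((b - a) / 2) < pi / 2" using s p ab by (simp add: s0_def field_simps)
  have sp0: "0 \<le> s * p" using True p by simp
  have "0 \<le> s * p * ((b - a) / 2)" using True p ab by simp
  then have c: "0 < c" unfolding c_def using sp by (intro cos_gt_zero_pi) auto
  define G where "G z = exp (of_real (s * p) * (h z - \<i> * of_real m)) / of_real c" for z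
  have "exp (s * p * Re (h z)) \<le> Re (G z)" if z: "z \<in> \<D>" for z
  proof -
    have ReG: "Re (G z) = exp (s * p * Re (h z)) * cos (s * p * (Im (h z) - m)) / c"
      by (simp add: G_def Re_divide_of_real Re_exp)
    have "\<bar>s * p * (Im (h z) - m)\<bar> = s * p * \<bar>Im (h z) - m\<bar>" unfolding abs_mult using sp0 True p by simp
    also have "\<dots> \<le> s * p * ((b - a) / 2)"
      using strip[OF z] sp0 by (intro mult_left_mono) (auto simp: m_def abs_le_iff field_simps)
    finally have "c \<le> cos \<bar>s * p * (Im (h z) - m)\<bar>"
      unfolding c_def using sp pi_gt_zero by (intro cos_monotone_0_pi_le) auto
    then have "c \<le> cos (s * p * (Im (h z) - m))" by simp
    then have "exp (s * p * Re (h z)) * c \<le> exp (s * p * Re (h z)) * cos (s * p * (Im (h z) - m))"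
      by (intro mult_left_mono) auto
    then show ?thesis unfolding ReG using c by (simp add: field_simps)
  qed
  moreover have "G holomorphic_on \<D>" unfolding G_def using c by (intro holomorphic_intros h_hol) auto
  ultimately show ?thesis by blast
next
  case False
  define k where "k = - s * p"
  have k: "0 < k" using False p by (simp add: k_def mult_neg_pos)
  obtain y0 where y0: "\<And>\<epsilon>. 0 < \<epsilon> \<Longrightarrow> \<exists>M. \<forall>w\<in>\<Omega>. \<epsilon> \<le> \<bar>Im w - y0\<bar> \<longrightarrow> - M < Re w" using narrow by blast
  obtain M where M: "\<And>w. w \<in> \<Omega> \<Longrightarrow> pi / (3 * k) \<le> \<bar>Im w - y0\<bar> \<Longrightarrow> - M < Re w"
    using y0[of "pi / (3 * k)"] k by auto
  \<comment> \<open>Near the height \<open>y0\<close> the factor 2 makes up for a cosine of at least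
    1/2. Elsewhere the first term is at least \<open>- 2 * exp (k * M)\<close>, and the constant
    leaves \<open>exp (k * M)\<close>, which suffices.\<close>
  define G where "G z = 2 * exp (of_real (- k) * (h z - \<i> * of_real y0)) + of_real (3 * exp (k * M))" for z
  have "exp (s * p * Re (h z)) \<le> Re (G z)" if z: "z \<in> \<D>" for z
  proof -
    have ReG: "Re (G z) = 2 * exp (- k * Re (h z)) * cos (k * (Im (h z) - y0)) + 3 * exp (k * M)"
    proof -
      have "cos (k * y0 - k * Im (h z)) = cos (k * Im (h z) - k * y0)" by (metis cos_minus minus_diff_eq)
      then show ?thesis by (simp add: G_def Re_exp algebra_simps)
    qed
    have "exp (- k * Re (h z)) \<le> Re (G z)"
    proof (cases "\<bar>Im (h z) - y0\<bar> < pi / (3 * k)")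
      case True
      then have "\<bar>k * (Im (h z) - y0)\<bar> \<le> pi / 3" 
      proof -
        have "\<bar>k * (Im (h z) - y0)\<bar> = k * \<bar>Im (h z) - y0\<bar>" using k by (simp only: abs_mult abs_of_pos)
        also have "\<dots> \<le> k * (pi / (3 * k))" using k True by (intro mult_left_mono) auto
        also have "\<dots> = pi / 3" using k by simp
        finally show ?thesis .
      qed
      then have "1 / 2 \<le> cos (k * (Im (h z) - y0))" by (rule cos_half_le)
      then have "2 * exp (- k * Re (h z)) * (1/2) \<le> 2 * exp (- k * Re (h z)) * cos (k * (Im (h z) - y0))"
        by (intro mult_left_mono) auto
      then show ?thesis unfolding ReG using exp_gt_zero[of "k * M"] by linarith
    next
      case False
      then have "- M < Re (h z)" using M[OF h_in_\<Omega>[OF z]] by auto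
      then have "- k * Re (h z) \<le> k * M" 
        using mult_left_mono[of "- Re (h z)" M k] k by simp
      then have e: "exp (- k * Re (h z)) \<le> exp (k * M)" by simp
      have "2 * exp (- k * Re (h z)) * (- 1) \<le> 2 * exp (- k * Re (h z)) * cos (k * (Im (h z) - y0))"
        by (intro mult_left_mono) auto
      then show ?thesis unfolding ReG using e by linarith
    qed
    then show ?thesis by (simp add: k_def)
  qed
  moreover have "G holomorphic_on \<D>" unfolding G_def by (intro holomorphic_intros h_hol)
  ultimately show ?thesis by blast
qed

lemma ef_Hp:
  assumes "Re \<mu> < s0" shows "ef \<mu> \<in> Hp p"
proof -
  obtain G where G: "G holomorphic_on \<D>" "\<And>z. z \<in> \<D> \<Longrightarrow> exp (Re \<mu> * p * Re (h z)) \<le> Re (G z)"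
    using real_exp_majorant[OF assms] by blast
  define C where "C = exp (\<bar>Im \<mu>\<bar> * B) powr p"
  show ?thesis
  proof (rule Hp_harmonic_majorant[of p _ "\<lambda>z. of_real C * G z"])
    fix z assume z: "z \<in> \<D>"
    have "norm (ef \<mu> z) powr p \<le> (exp (\<bar>Im \<mu>\<bar> * B) * exp (Re \<mu> * Re (h z))) powr p"
      using norm_exp_h[OF z] p z by (intro powr_mono2) (auto simp: ef_def)
    also have "\<dots> = C * exp (Re \<mu> * p * Re (h z))" by (simp add: powr_mult C_def exp_powr_real mult_ac)
    also have "\<dots> \<le> C * Re (G z)" using G(2)[OF z] by (intro mult_left_mono) (auto simp: C_def)
    finally show "norm (ef \<mu> z) powr p \<le> Re (of_real C * G z)" by simp
  qed (use p G ef_hol ef_out in \<open>auto intro!: holomorphic_intros\<close>)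
qed

lemma E_Hp: "f \<in> E \<Longrightarrow> f \<in> Hp p"
  by (induction rule: exp_span.induct) (auto intro: Hp_add Hp_cmult ef_Hp[unfolded ef_def] p1)

lemma ef_E: "Re \<mu> < s0 \<Longrightarrow> ef \<mu> \<in> E"
  unfolding ef_def by (rule exp_span.base)

text \<open>\<open>exp (\<delta> * \<bar>x\<bar>)\<close> is at most
  \<open>exp (\<delta> * x) + exp (- \<delta> * x)\<close>. A factor of small exponential growth in
  \<open>Re h\<close> therefore costs only a shift of \<mu> in both directions, and the open
  condition \<open>Re \<mu> < s0\<close> leaves room for it.\<close>

lemma exp_dominated:
  assumes f: "f holomorphic_on \<D>" "\<And>z. z \<notin> \<D> \<Longrightarrow> f z = 0" and C: "0 \<le> C"
    and le: "\<And>z. z \<in> \<D> \<Longrightarrow> norm (f z) \<le> C * exp (\<delta> * \<bar>Re (h z)\<bar>) * norm (ef \<mu> z)"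
    and \<delta>: "0 \<le> \<delta>" "Re \<mu> + \<delta> < s0"
  shows "f \<in> Hp p" "Hp_norm p f \<le> 2 * C * (Hp_norm p (ef (\<mu> + of_real \<delta>)) + Hp_norm p (ef (\<mu> - of_real \<delta>)))"
proof -
  let ?g1 = "\<lambda>z. of_real C * ef (\<mu> + of_real \<delta>) z" and ?g2 = "\<lambda>z. of_real C * ef (\<mu> - of_real \<delta>) z"
  have e: "ef (\<mu> + of_real \<delta>) \<in> Hp p" "ef (\<mu> - of_real \<delta>) \<in> Hp p" using \<delta> by (auto intro!: ef_Hp)
  note g = Hp_cmult[OF p1(1) e(1), of "of_real C"] Hp_cmult[OF p1(1) e(2), of "of_real C"]
  have "norm (f z) \<le> norm (?g1 z) + norm (?g2 z)" if z: "z \<in> \<D>" for z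
  proof -
    have "exp (\<delta> * \<bar>Re (h z)\<bar>) \<le> exp (\<delta> * Re (h z)) + exp (- \<delta> * Re (h z))"
      by (cases "0 \<le> Re (h z)") auto
    also have "\<dots> = norm (exp (of_real \<delta> * h z)) + norm (exp (- of_real \<delta> * h z))"
      by (simp add: norm_exp_eq_Re)
    finally have "exp (\<delta> * \<bar>Re (h z)\<bar>) * norm (ef \<mu> z) \<le> (norm (exp (of_real \<delta> * h z)) + norm (exp (- of_real \<delta> * h z))) * norm (ef \<mu> z)"
      by (rule mult_right_mono) auto
    also have "\<dots> = norm (ef (\<mu> + of_real \<delta>) z) + norm (ef (\<mu> - of_real \<delta>) z)"
    proof -
      have "norm (exp (of_real \<delta> * h z)) * norm (ef \<mu> z) = norm (ef (\<mu> + of_real \<delta>) z)"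
        "norm (exp (- of_real \<delta> * h z)) * norm (ef \<mu> z) = norm (ef (\<mu> - of_real \<delta>) z)"
        using z unfolding norm_mult[symmetric] by (simp_all add: ef_def exp_add[symmetric] algebra_simps)
      then show ?thesis by (simp only: distrib_right)
    qed
    finally have "C * (exp (\<delta> * \<bar>Re (h z)\<bar>) * norm (ef \<mu> z)) \<le> C * (norm (ef (\<mu> + of_real \<delta>) z) + norm (ef (\<mu> - of_real \<delta>) z))"
      using C by (rule mult_left_mono)
    then show ?thesis using le[OF z] C by (simp add: norm_mult algebra_simps)
  qed
  note d = Hp_dominated[OF p1(1) f g(1) g(3) this]
  from d(1) show "f \<in> Hp p" .
  show "Hp_norm p f \<le> 2 * C * (Hp_norm p (ef (\<mu> + of_real \<delta>)) + Hp_norm p (ef (\<mu> - of_real \<delta>)))"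
    using d(2) g(2,4) C by (simp add: algebra_simps)
qed

lemma h_growth:
  assumes \<delta>: "0 < \<delta>" and z: "z \<in> \<D>"
  shows "norm (h z) \<le> (1 / \<delta> + B) * exp (\<delta> * \<bar>Re (h z)\<bar>)"
proof -
  have B0: "0 \<le> B" by (simp add: B_def)
  have "norm (h z) \<le> \<bar>Re (h z)\<bar> + \<bar>Im (h z)\<bar>" by (rule cmod_le)
  also have "\<bar>Re (h z)\<bar> \<le> (1 / \<delta>) * exp (\<delta> * \<bar>Re (h z)\<bar>)"
  proof -
    have "\<delta> * \<bar>Re (h z)\<bar> \<le> exp (\<delta> * \<bar>Re (h z)\<bar>)" using exp_ge_add_one_self[of "\<delta> * \<bar>Re (h z)\<bar>"] by linarith
    then show ?thesis using \<delta> by (simp add: field_simps)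
  qed
  also have "\<bar>Im (h z)\<bar> \<le> B * exp (\<delta> * \<bar>Re (h z)\<bar>)"
  proof -
    have "B * 1 \<le> B * exp (\<delta> * \<bar>Re (h z)\<bar>)" using B0 \<delta> by (intro mult_left_mono) auto
    then show ?thesis using B_bound[OF z] by simp
  qed
  finally show ?thesis by (simp add: algebra_simps)
qed

lemma room: "Re \<mu> < s0 \<Longrightarrow> \<exists>\<delta>>0. Re \<mu> + 2 * \<delta> < s0"
  by (intro exI[of _ "(s0 - Re \<mu>) / 4"]) (auto simp: field_simps)

lemma h_ef_Hp:
  assumes "Re \<mu> < s0" shows "(\<lambda>z. h z * ef \<mu> z) \<in> Hp p"
proof -
  obtain \<delta> where \<delta>: "0 < \<delta>" "Re \<mu> + 2 * \<delta> < s0" using room[OF assms] by blast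
  show ?thesis
  proof (rule exp_dominated(1)[of _ "1 / \<delta> + B" \<delta> \<mu>])
    show "(\<lambda>z. h z * ef \<mu> z) holomorphic_on \<D>" by (intro holomorphic_intros h_hol ef_hol)
    show "norm (h z * ef \<mu> z) \<le> (1 / \<delta> + B) * exp (\<delta> * \<bar>Re (h z)\<bar>) * norm (ef \<mu> z)" if "z \<in> \<D>" for z
      unfolding norm_mult by (intro mult_right_mono h_growth \<delta> that) auto
  qed (use \<delta> in \<open>auto simp: ef_out B_def\<close>)
qed

end

section \<open>Multipliers of the closed span of the eigenfunctions\<close>

context koenigs_strip
begin

definition multiplier :: "(complex \<Rightarrow> complex) \<Rightarrow> bool" where
  "multiplier m \<longleftrightarrow> m holomorphic_on \<D> \<and> (\<exists>K. \<forall>z\<in>\<D>. norm (m z) \<le> K) \<and> (\<forall>f\<in>E. (\<lambda>z. m z * f z) \<in> E)"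

lemma multiplierD:
  assumes "multiplier m"
  shows "m holomorphic_on \<D>" "\<exists>K\<ge>0. \<forall>z\<in>\<D>. norm (m z) \<le> K" "f \<in> E \<Longrightarrow> (\<lambda>z. m z * f z) \<in> E"
proof -
  obtain K where "\<forall>z\<in>\<D>. norm (m z) \<le> K" using assms by (auto simp: multiplier_def)
  then show "\<exists>K\<ge>0. \<forall>z\<in>\<D>. norm (m z) \<le> K" by (intro exI[of _ "max K 0"]) auto
qed (use assms in \<open>auto simp: multiplier_def\<close>)

lemma multiplier_const: "multiplier (\<lambda>z. c)"
  unfolding multiplier_def by (auto intro: exp_span.scale)

lemma multiplier_add:
  assumes "multiplier m" "multiplier n" shows "multiplier (\<lambda>z. m z + n z)"
proof -
  obtain K L where "\<forall>z\<in>\<D>. norm (m z) \<le> K" "\<forall>z\<in>\<D>. norm (n z) \<le> L"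
    using multiplierD(2)[OF assms(1)] multiplierD(2)[OF assms(2)] by blast
  then have "\<forall>z\<in>\<D>. norm (m z + n z) \<le> K + L" by (blast intro: norm_triangle_mono)
  moreover have "(\<lambda>z. (m z + n z) * f z) \<in> E" if "f \<in> E" for f
    using exp_span.add[OF multiplierD(3)[OF assms(1) that] multiplierD(3)[OF assms(2) that]] by (simp add: distrib_right)
  ultimately show ?thesis unfolding multiplier_def using multiplierD(1)[OF assms(1)] multiplierD(1)[OF assms(2)]
    by (blast intro: holomorphic_on_add)
qed

lemma multiplier_mult:
  assumes "multiplier m" "multiplier n" shows "multiplier (\<lambda>z. m z * n z)"
proof -
  obtain K L where KL: "0 \<le> K" "0 \<le> L" "\<forall>z\<in>\<D>. norm (m z) \<le> K" "\<forall>z\<in>\<D>. norm (n z) \<le> L"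
    using multiplierD(2)[OF assms(1)] multiplierD(2)[OF assms(2)] by blast
  then have "\<forall>z\<in>\<D>. norm (m z * n z) \<le> K * L" by (auto simp: norm_mult intro!: mult_mono)
  moreover have "(\<lambda>z. (m z * n z) * f z) \<in> E" if "f \<in> E" for f
    using multiplierD(3)[OF assms(1) multiplierD(3)[OF assms(2) that]] by (simp add: mult.assoc)
  ultimately show ?thesis unfolding multiplier_def using multiplierD(1)[OF assms(1)] multiplierD(1)[OF assms(2)]
    by (blast intro: holomorphic_on_mult)
qed

lemma multiplier_cmult: "multiplier m \<Longrightarrow> multiplier (\<lambda>z. c * m z)"
  by (intro multiplier_mult multiplier_const)

lemma multiplier_diff: "multiplier m \<Longrightarrow> multiplier n \<Longrightarrow> multiplier (\<lambda>z. m z - n z)"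
  using multiplier_add[of m "\<lambda>z. (-1) * n z"] multiplier_cmult[of n "-1"] by simp

lemma multiplier_sum: "(\<And>i. i \<in> I \<Longrightarrow> multiplier (m i)) \<Longrightarrow> multiplier (\<lambda>z. \<Sum>i\<in>I. m i z)"
  by (induction I rule: infinite_finite_induct) (auto intro: multiplier_const multiplier_add)

lemma multiplier_power: "multiplier m \<Longrightarrow> multiplier (\<lambda>z. m z ^ n)"
  by (induction n) (auto intro: multiplier_const multiplier_mult)

text \<open>Elements of \<open>E\<close> vanish off the disc, so only the values of a multiplier on
  the disc matter.\<close>

lemma multiplier_cong:
  assumes "multiplier m" "\<And>z. z \<in> \<D> \<Longrightarrow> m z = n z"
  shows "multiplier n"
proof -
  have "(\<lambda>z. n z * f z) = (\<lambda>z. m z * f z)" if "f \<in> E" for f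
  proof
    fix z
    show "n z * f z = m z * f z"
      using assms(2)[of z] HpD(2)[OF E_Hp[OF that], of z] by (cases "z \<in> \<D>") auto
  qed
  then show ?thesis using assms unfolding multiplier_def
    by (auto intro: holomorphic_transform)
qed

text \<open>On the generators the factor shifts \<mu> along the imaginary axis, which preserves
  \<open>Re \<mu> < s0\<close>. It passes to limits because \<open>Im h\<close> is bounded, and so
  is the factor.\<close>

lemma exp_mult_E:
  assumes "f \<in> E" shows "(\<lambda>z. exp (\<i> * of_real \<beta> * h z) * f z) \<in> E"
  using assms
proof (induction rule: exp_span.induct)
  case (base \<mu>)
  have "(\<lambda>z. exp (\<i> * of_real \<beta> * h z) * zext (\<lambda>z. exp (\<mu> * h z)) z) = ef (\<mu> + \<i> * of_real \<beta>)"
    by (auto simp: ef_def zext_def exp_add[symmetric] algebra_simps)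
  then show ?case using ef_E[of "\<mu> + \<i> * of_real \<beta>"] base by simp
next
  case (add f g)
  then show ?case using exp_span.add by (simp add: distrib_left)
next
  case (scale f c)
  then show ?case using exp_span.scale[of _ p h s0 c] by (simp add: mult.left_commute)
next
  case (limit f)
  have b: "norm (exp (\<i> * of_real \<beta> * h z)) \<le> exp (\<bar>\<beta>\<bar> * B)" if "z \<in> \<D>" for z
    using norm_exp_h[OF that, of "\<i> * of_real \<beta>"] by simp
  have hol: "(\<lambda>z. exp (\<i> * of_real \<beta> * h z)) holomorphic_on \<D>" by (intro holomorphic_intros h_hol)
  show ?case
  proof (rule exp_span.limit)
    show "(\<lambda>z. exp (\<i> * of_real \<beta> * h z) * f z) \<in> Hp p"
      using Hp_mult_bounded(1)[OF p1(1) limit(1) hol b] by simp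
    show "\<forall>e>0. \<exists>g. g \<in> E \<and> Hp_norm p (\<lambda>z. exp (\<i> * of_real \<beta> * h z) * f z - g z) < e"
    proof (intro allI impI)
      fix e :: real assume e: "0 < e"
      then have "0 < e / exp (\<bar>\<beta>\<bar> * B)" by simp
      then obtain g where g: "g \<in> E" "(\<lambda>z. exp (\<i> * of_real \<beta> * h z) * g z) \<in> E" "Hp_norm p (\<lambda>z. f z - g z) < e / exp (\<bar>\<beta>\<bar> * B)"
        using limit(2) by blast
      have fg: "(\<lambda>z. f z - g z) \<in> Hp p" by (intro Hp_diff p1 limit E_Hp g)
      have "Hp_norm p (\<lambda>z. exp (\<i> * of_real \<beta> * h z) * (f z - g z)) \<le> exp (\<bar>\<beta>\<bar> * B) * Hp_norm p (\<lambda>z. f z - g z)"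
        using Hp_mult_bounded(2)[OF p1(1) fg hol b] by simp
      also have "\<dots> < e" using g(3) by (simp add: field_simps)
      finally show "\<exists>g. g \<in> E \<and> Hp_norm p (\<lambda>z. exp (\<i> * of_real \<beta> * h z) * f z - g z) < e"
        using g(2) by (auto simp: right_diff_distrib)
    qed
  qed
qed

lemma multiplier_exp: "multiplier (\<lambda>z. exp (\<i> * of_real \<beta> * h z))"
  unfolding multiplier_def
proof (intro conjI)
  show "\<exists>K. \<forall>z\<in>\<D>. norm (exp (\<i> * of_real \<beta> * h z)) \<le> K"
    using norm_exp_h[of _ "\<i> * of_real \<beta>"] by (intro exI[of _ "exp (\<bar>\<beta>\<bar> * B)"]) auto
qed (auto intro!: holomorphic_intros h_hol exp_mult_E)

text \<open>Uniform convergence is only required where \<open>h\<close> is bounded: the tails are controlled by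
  \<open>h * exp (\<mu> * h)\<close>, which lies in \<open>Hp\<close>.\<close>

lemma multiplier_limit:
  assumes lim: "\<And>R e. 0 < e \<Longrightarrow> \<exists>m'. multiplier m' \<and> (\<forall>z\<in>\<D>. norm (m' z) \<le> K) \<and>
     (\<forall>z\<in>\<D>. norm (h z) \<le> R \<longrightarrow> norm (m z - m' z) \<le> e)"
  shows "multiplier m"
proof -
  have bd: "norm (m z) \<le> K" if z: "z \<in> \<D>" for z
  proof (rule field_le_epsilon)
    fix e :: real assume "0 < e"
    then obtain m' where "norm (m' z) \<le> K" "norm (m z - m' z) \<le> e" using lim[of e "norm (h z)"] z by blast
    then show "norm (m z) \<le> K + e" using norm_triangle_sub[of "m z" "m' z"] by linarith
  qed
  have K0: "0 \<le> K" using bd[of 0] norm_ge_zero order_trans by (metis centre_in_ball zero_less_one)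
  have "\<exists>m'. \<forall>n. multiplier (m' n) \<and> (\<forall>z\<in>\<D>. norm (h z) \<le> real n \<longrightarrow> norm (m z - m' n z) \<le> 1 / real (Suc n))"
  proof (rule choice, rule)
    fix n show "\<exists>m'. multiplier m' \<and> (\<forall>z\<in>\<D>. norm (h z) \<le> real n \<longrightarrow> norm (m z - m' z) \<le> 1 / real (Suc n))"
      using lim[of "1 / real (Suc n)" "real n"] by auto
  qed
  then obtain m' where m': "\<And>n. multiplier (m' n)" "\<And>n z. z \<in> \<D> \<Longrightarrow> norm (h z) \<le> real n \<Longrightarrow> norm (m z - m' n z) \<le> 1 / real (Suc n)"
    by blast
  have hol: "m holomorphic_on \<D>"
  proof (rule holomorphic_uniform_sequence[of \<D> m'])
    fix x assume x: "x \<in> \<D>"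
    then obtain d where d: "0 < d" "cball x d \<subseteq> \<D>" using open_contains_cball[of "\<D>"] by blast
    have "bounded (h ` cball x d)"
      by (intro compact_imp_bounded compact_continuous_image holomorphic_on_imp_continuous_on holomorphic_on_subset[OF h_hol d(2)]) auto
    then obtain L where "\<forall>y\<in>h ` cball x d. norm y \<le> L" by (auto simp: bounded_iff)
    then have L: "norm (h y) \<le> L" if "y \<in> cball x d" for y using that by auto
    have "uniform_limit (cball x d) m' m sequentially"
    proof (rule uniform_limitI)
      fix e :: real assume e: "0 < e"
      obtain n0 where n0: "L \<le> real n0" using real_arch_simple by blast
      have "\<forall>\<^sub>F n in sequentially. 1 / real (Suc n) < e"
        using order_tendstoD(2)[OF lim_inverse_n' e] eventually_sequentially_Suc[of "\<lambda>n. 1 / real n < e"] by simp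
      then show "\<forall>\<^sub>F n in sequentially. \<forall>y\<in>cball x d. dist (m' n y) (m y) < e"
        using eventually_ge_at_top[of n0]
      proof eventually_elim
        case (elim n)
        show ?case
        proof
          fix y assume y: "y \<in> cball x d"
          have "norm (h y) \<le> real n" using L[OF y] n0 elim(2) by linarith
          then have "norm (m y - m' n y) \<le> 1 / real (Suc n)" using m'(2) y d by blast
          then show "dist (m' n y) (m y) < e" using elim by (simp add: dist_norm norm_minus_commute)
        qed
      qed
    qed
    then show "\<exists>d>0. cball x d \<subseteq> \<D> \<and> uniform_limit (cball x d) m' m sequentially" using d by blast
  qed (use m' multiplierD in auto)
  have "(\<lambda>z. m z * f z) \<in> E" if "f \<in> E" for f
    using that
  proof (induction rule: exp_span.induct)
    case (base \<mu>)
    let ?f = "ef \<mu>"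
    define C1 where "C1 = Hp_norm p ?f"
    define C2 where "C2 = Hp_norm p (\<lambda>z. h z * ?f z)"
    have C: "0 \<le> C1" "0 \<le> C2" by (auto simp: C1_def C2_def Hp_norm_nonneg)
    have f: "?f \<in> Hp p" "(\<lambda>z. h z * ?f z) \<in> Hp p" using base by (auto intro: ef_Hp h_ef_Hp)
    have mf: "(\<lambda>z. m z * ?f z) \<in> Hp p" by (rule Hp_mult_bounded(1)[OF p1(1) f(1) hol bd K0])
    have "(\<lambda>z. m z * ?f z) \<in> E"
    proof (rule exp_span.limit[OF mf], intro allI impI)
      fix e :: real assume e: "0 < e"
      \<comment> \<open>\<open>e1\<close> controls the part where \<open>norm h \<le> R\<close>.
        Beyond it, \<open>norm (m z - n z) \<le> 2 * K \<le> 2 * K / R * norm (h z)\<close>, and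
        \<open>R\<close> makes this small against \<open>h * ef \<mu>\<close>. Each part contributes
        \<open>e / 8\<close>, before the factor 2 of \<open>Hp_dominated\<close>.\<close>
      define e1 where "e1 = e / (8 * (C1 + 1))"
      define R where "R = 16 * (K + 1) * (C2 + 1) / e"
      have e1: "0 < e1" "e1 * C1 \<le> e / 8" using e C by (auto simp: e1_def field_simps)
      have R: "0 < R" using K0 C e by (simp add: R_def)
      have "K * C2 \<le> (K + 1) * (C2 + 1)" using K0 C by (intro mult_mono) auto
      moreover have "R * e = 16 * ((K + 1) * (C2 + 1))" using e by (simp add: R_def)
      ultimately have "16 * (K * C2) \<le> R * e" by simp
      then have RC: "2 * K / R * C2 \<le> e / 8" using R by (simp add: field_simps)
      obtain n where n: "multiplier n" "\<forall>z\<in>\<D>. norm (n z) \<le> K" "\<forall>z\<in>\<D>. norm (h z) \<le> R \<longrightarrow> norm (m z - n z) \<le> e1"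
        using lim[OF e1(1)] by blast
      let ?g1 = "\<lambda>z. of_real e1 * ?f z" and ?g2 = "\<lambda>z. of_real (2 * K / R) * (h z * ?f z)"
      note g1 = Hp_cmult[OF p1(1) f(1), of "of_real e1"] 
      note g2 = Hp_cmult[OF p1(1) f(2), of "of_real (2 * K / R)"]
      have le: "norm ((m z - n z) * ?f z) \<le> norm (?g1 z) + norm (?g2 z)" if z: "z \<in> \<D>" for z
      proof -
        have "norm (m z - n z) \<le> e1 + 2 * K / R * norm (h z)"
        proof (cases "norm (h z) \<le> R")
          case True
          then have "norm (m z - n z) \<le> e1" using n z by blast
          moreover have "0 \<le> 2 * K / R * norm (h z)" using K0 R by simp
          ultimately show ?thesis by linarith
        next
          case False
          have "norm (m z - n z) \<le> 2 * K" using norm_triangle_ineq4[of "m z" "n z"] bd[OF z] n(2) z by force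
          also have "\<dots> = 2 * K / R * R" using R by simp
          also have "\<dots> \<le> 2 * K / R * norm (h z)" using False K0 R by (intro mult_left_mono) auto
          finally show ?thesis using e1 by linarith
        qed
        then have "norm (m z - n z) * norm (?f z) \<le> (e1 + 2 * K / R * norm (h z)) * norm (?f z)" by (rule mult_right_mono) simp
        moreover have "norm (?g1 z) = e1 * norm (?f z)" using e1 by (simp add: norm_mult)
        moreover have "norm (?g2 z) = 2 * K / R * (norm (h z) * norm (?f z))"
          using K0 R by (simp only: norm_mult norm_of_real) simp
        ultimately show ?thesis by (simp only: norm_mult distrib_right mult.assoc)
      qed
      have h1: "(\<lambda>z. (m z - n z) * ?f z) holomorphic_on \<D>" by (intro holomorphic_intros hol multiplierD(1) n ef_hol)
      have "Hp_norm p (\<lambda>z. (m z - n z) * ?f z) \<le> 2 * (Hp_norm p ?g1 + Hp_norm p ?g2)"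
        by (rule Hp_dominated(2)[OF p1(1) h1 _ g1(1) g2(1) le]) (simp add: ef_out)
      also have "\<dots> \<le> 2 * (e1 * C1 + 2 * K / R * C2)"
        using g1(2) g2(2) e1 K0 R by (simp add: C1_def C2_def norm_mult norm_divide)
      also have "\<dots> < e" using e1 RC e by simp
      finally show "\<exists>g. g \<in> E \<and> Hp_norm p (\<lambda>z. m z * ?f z - g z) < e"
        using multiplierD(3)[OF n(1) ef_E[OF base]] by (auto simp: left_diff_distrib)
    qed
    then show ?case by (simp add: ef_def)
  next
    case (add f g)
    then show ?case using exp_span.add by (simp add: distrib_left)
  next
    case (scale f c)
    then show ?case using exp_span.scale[of _ p h s0 c] by (simp add: mult.left_commute)
  next
    case (limit f)
    show ?case
    proof (rule exp_span.limit)
      show "(\<lambda>z. m z * f z) \<in> Hp p" by (rule Hp_mult_bounded(1)[OF p1(1) limit(1) hol bd K0])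
      show "\<forall>e>0. \<exists>g. g \<in> E \<and> Hp_norm p (\<lambda>z. m z * f z - g z) < e"
      proof (intro allI impI)
        fix e :: real assume e: "0 < e"
        then have "0 < e / (K + 1)" using K0 by simp
        then obtain g where g: "g \<in> E" "(\<lambda>z. m z * g z) \<in> E" "Hp_norm p (\<lambda>z. f z - g z) < e / (K + 1)"
          using limit(2) by blast
        have fg: "(\<lambda>z. f z - g z) \<in> Hp p" by (intro Hp_diff p1 limit E_Hp g)
        have "Hp_norm p (\<lambda>z. m z * (f z - g z)) \<le> K * Hp_norm p (\<lambda>z. f z - g z)"
          by (rule Hp_mult_bounded(2)[OF p1(1) fg hol bd K0])
        also have "\<dots> \<le> (K + 1) * Hp_norm p (\<lambda>z. f z - g z)" by (intro mult_right_mono) (auto simp: Hp_norm_nonneg)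
        also have "\<dots> < e" using g(3) K0 by (simp add: field_simps)
        finally show "\<exists>g. g \<in> E \<and> Hp_norm p (\<lambda>z. m z * f z - g z) < e"
          using g(2) by (auto simp: right_diff_distrib)
      qed
    qed
  qed
  moreover have "\<forall>z\<in>\<D>. norm (m z) \<le> K" using bd by blast
  ultimately show ?thesis using hol unfolding multiplier_def by blast
qed

text \<open>Approximants within distance 1 are bounded by \<open>K + 1\<close>, which supplies the
  common bound for \<open>multiplier_limit\<close>.\<close>

lemma multiplier_uniform_limit:
  assumes bd: "\<And>z. z \<in> \<D> \<Longrightarrow> norm (m z) \<le> K"
    and lim: "\<And>e. 0 < e \<Longrightarrow> \<exists>m'. multiplier m' \<and> (\<forall>z\<in>\<D>. norm (m z - m' z) \<le> e)"
  shows "multiplier m"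
proof (rule multiplier_limit[where K="K + 1"])
  fix R e :: real assume "0 < e"
  then obtain m' where m': "multiplier m'" "\<forall>z\<in>\<D>. norm (m z - m' z) \<le> min e 1" using lim[of "min e 1"] by auto
  have "norm (m' z) \<le> K + 1" if "z \<in> \<D>" for z
    using m'(2) bd[OF that] norm_triangle_sub[of "m' z" "m z"] that by (force simp: norm_minus_commute)
  then show "\<exists>m'. multiplier m' \<and> (\<forall>z\<in>\<D>. norm (m' z) \<le> K + 1) \<and> (\<forall>z\<in>\<D>. norm (h z) \<le> R \<longrightarrow> norm (m z - m' z) \<le> e)"
    using m' by auto
qed

section \<open>Resolvents of h and the pushing of poles\<close>

lemma geometric_remainder:
  fixes x :: complex
  assumes "norm x \<le> q" "q < 1"
  shows "norm (1 / (1 - x) - (\<Sum>k<n. x ^ k)) \<le> q ^ n / (1 - q)" "1 - q \<le> norm (1 - x)"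
proof -
  show *: "1 - q \<le> norm (1 - x)" using norm_triangle_ineq2[of 1 x] assms by simp
  then have ne: "x \<noteq> 1" using assms by auto
  have "1 / (1 - x) - (\<Sum>k<n. x ^ k) = x ^ n / (1 - x)"
    using ne by (simp add: sum_gp_strict diff_divide_distrib)
  then have "norm (1 / (1 - x) - (\<Sum>k<n. x ^ k)) = norm x ^ n / norm (1 - x)" by (simp add: norm_divide norm_power)
  also have "\<dots> \<le> q ^ n / (1 - q)"
    using assms * order_trans[OF norm_ge_zero assms(1)] by (intro frac_le power_mono) auto
  finally show "norm (1 / (1 - x) - (\<Sum>k<n. x ^ k)) \<le> q ^ n / (1 - q)" .
qed

lemma multiplier_geometric:
  assumes x: "multiplier x" and q: "\<And>z. z \<in> \<D> \<Longrightarrow> norm (x z) \<le> q" "q < 1"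
  shows "multiplier (\<lambda>z. 1 / (1 - x z))"
proof (rule multiplier_uniform_limit[where K="1 / (1 - q)"])
  fix z assume "z \<in> \<D>"
  then show "norm (1 / (1 - x z)) \<le> 1 / (1 - q)"
    using geometric_remainder(1)[OF q(1) q(2), of z 0] by simp
next
  fix e :: real assume e: "0 < e"
  have q0: "0 \<le> q" using q(1)[of 0] norm_ge_zero order_trans by (metis centre_in_ball zero_less_one)
  obtain n where n: "q ^ n < e * (1 - q)" using real_arch_pow_inv[of "e * (1 - q)" q] e q by auto
  have "norm (1 / (1 - x z) - (\<Sum>k<n. x z ^ k)) \<le> e" if "z \<in> \<D>" for z
  proof -
    have "norm (1 / (1 - x z) - (\<Sum>k<n. x z ^ k)) \<le> q ^ n / (1 - q)" by (rule geometric_remainder(1)[OF q(1)[OF that] q(2)])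
    also have "\<dots> \<le> e" using n q by (simp add: field_simps)
    finally show ?thesis .
  qed
  then show "\<exists>m'. multiplier m' \<and> (\<forall>z\<in>\<D>. norm (1 / (1 - x z) - m' z) \<le> e)"
    by (intro exI[of _ "\<lambda>z. \<Sum>k<n. x z ^ k"] conjI multiplier_sum multiplier_power x) auto
qed

text \<open>The resolvent \<open>1 / u\<close> is the limit of \<open>\<eta> / (1 - exp (- \<eta> u))\<close>, a geometric series in
  \<open>exp (- \<eta> u)\<close>.\<close>

lemma multiplier_inverse_linear:
  assumes u: "\<And>z. u z = \<i> * of_real \<sigma> * h z + v"
    and d: "0 < d" "\<And>z. z \<in> \<D> \<Longrightarrow> d \<le> Re (u z)" "\<And>z. z \<in> \<D> \<Longrightarrow> Re (u z) \<le> L"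
  shows "multiplier (\<lambda>z. 1 / u z)"
proof (rule multiplier_limit[where K="(1 + d) / d"])
  fix R e :: real assume e: "0 < e"
  \<comment> \<open>\<open>W\<close> bounds \<open>norm (u z)\<close> where
    \<open>norm (h z) \<le> R\<close>. In \<eta>, the second term of the minimum brings the final
    error down to \<open>e\<close>, and the first yields the bound \<open>(1 + d) / d\<close> for
    the approximants, which does not depend on \<eta>.\<close>
  define W where "W = \<bar>\<sigma>\<bar> * \<bar>R\<bar> + norm v + 1"
  have W: "0 < W" by (simp add: W_def add_nonneg_pos)
  define \<eta> where "\<eta> = min 1 (e * d / (exp L * W * (1 + d)))"
  have \<eta>: "0 < \<eta>" "\<eta> \<le> 1" "\<eta> \<le> e * d / (exp L * W * (1 + d))" using e d W by (auto simp: \<eta>_def)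
  define x where "x z = exp (- of_real \<eta> * u z)" for z
  have x_eq: "x z = exp (- of_real \<eta> * v) * exp (\<i> * of_real (- \<eta> * \<sigma>) * h z)" for z
    by (simp add: x_def u exp_add[symmetric] algebra_simps)
  have xm: "multiplier x" unfolding x_eq[abs_def] by (intro multiplier_cmult multiplier_exp)
  define q where "q = exp (- \<eta> * d)"
  have q1: "q < 1" using \<eta> d by (simp add: q_def)
  have xq: "norm (x z) \<le> q" if "z \<in> \<D>" for z
    using d(2)[OF that] \<eta> by (simp add: x_def q_def norm_exp_eq_Re)
  have "q \<le> 1 / (1 + \<eta> * d)"
  proof -
    have "1 + \<eta> * d \<le> exp (\<eta> * d)" by (rule exp_ge_add_one_self)
    then have "1 / exp (\<eta> * d) \<le> 1 / (1 + \<eta> * d)" using \<eta> d by (intro divide_left_mono) (auto intro!: mult_pos_pos add_pos_pos)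
    then show ?thesis by (simp add: q_def exp_minus inverse_eq_divide)
  qed
  moreover have "1 - 1 / (1 + \<eta> * d) = \<eta> * d / (1 + \<eta> * d)" 
  proof -
    have "0 < 1 + \<eta> * d" using \<eta> d by (intro add_pos_pos) auto
    then show ?thesis by (simp add: diff_divide_eq_iff)
  qed
  moreover have "\<eta> * d / (1 + d) \<le> \<eta> * d / (1 + \<eta> * d)"
    using \<eta> d by (intro divide_left_mono) (auto intro!: mult_pos_pos add_pos_pos)
  ultimately have q2: "\<eta> * d / (1 + d) \<le> 1 - q" by linarith
  have den: "\<eta> * d / (1 + d) \<le> norm (1 - x z)" if "z \<in> \<D>" for z
    using q2 geometric_remainder(2)[OF xq[OF that] q1] by linarith
  have dp: "0 < \<eta> * d / (1 + d)" using \<eta> d by simp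
  define m' where "m' z = of_real \<eta> * (1 / (1 - x z))" for z
  have "multiplier m'" unfolding m'_def by (intro multiplier_cmult multiplier_geometric[OF xm xq q1])
  moreover have "norm (m' z) \<le> (1 + d) / d" if z: "z \<in> \<D>" for z
  proof -
    have "norm (m' z) = \<eta> / norm (1 - x z)" using \<eta> by (simp add: m'_def norm_mult norm_divide)
    also have "\<dots> \<le> \<eta> / (\<eta> * d / (1 + d))" using den[OF z] dp \<eta> by (intro divide_left_mono mult_pos_pos) auto
    also have "\<dots> = (1 + d) / d" using \<eta> d by simp
    finally show ?thesis .
  qed
  moreover have "norm (1 / u z - m' z) \<le> e" if z: "z \<in> \<D>" and hR: "norm (h z) \<le> R" for z
  proof -
    have u0: "u z \<noteq> 0" using d(1) d(2)[OF z] by auto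
    have x1: "1 - x z \<noteq> 0" using den[OF z] dp by auto
    have uW: "norm (u z) \<le> W"
    proof -
      have "norm (u z) \<le> \<bar>\<sigma>\<bar> * norm (h z) + norm v"
        unfolding u using norm_triangle_ineq[of "\<i> * of_real \<sigma> * h z" v] by (simp add: norm_mult)
      also have "\<bar>\<sigma>\<bar> * norm (h z) \<le> \<bar>\<sigma>\<bar> * \<bar>R\<bar>" using hR by (intro mult_left_mono) auto
      finally show ?thesis by (simp add: W_def)
    qed
    \<comment> \<open>Expansion to first order, with an error quadratic in \<eta>: the denominator
      \<open>1 - x z\<close> is itself of order \<eta>, so the quotient still has an error of order
      \<eta>.\<close>
    have "norm (x z - (\<Sum>k\<le>1. (- of_real \<eta> * u z) ^ k / fact k)) \<le> exp \<bar>Re (- of_real \<eta> * u z)\<bar> * norm (- of_real \<eta> * u z) ^ Suc 1 / fact 1"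
      unfolding x_def by (rule Taylor_exp)
    also have "x z - (\<Sum>k\<le>1. (- of_real \<eta> * u z) ^ k / fact k) = of_real \<eta> * u z - (1 - x z)" by simp
    also have "exp \<bar>Re (- of_real \<eta> * u z)\<bar> * norm (- of_real \<eta> * u z) ^ Suc 1 / fact 1 \<le> exp L * (\<eta> * norm (u z)) ^ 2"
    proof -
      have "\<bar>Re (- of_real \<eta> * u z)\<bar> = \<eta> * Re (u z)" using \<eta> d(1) d(2)[OF z] by (simp add: abs_mult)
      also have "\<dots> \<le> 1 * Re (u z)" using \<eta> d(1) d(2)[OF z] by (intro mult_right_mono) auto
      also have "\<dots> \<le> L" using d(3)[OF z] by simp
      finally show ?thesis using \<eta> by (simp add: norm_mult power2_eq_square mult_right_mono)
    qed
    finally have num: "norm (of_real \<eta> * u z - (1 - x z)) \<le> exp L * (\<eta> * norm (u z))\<^sup>2" .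
    have "1 / u z - m' z = - (of_real \<eta> * u z - (1 - x z)) / (u z * (1 - x z))"
      using u0 x1 by (simp add: m'_def field_simps)
    then have "norm (1 / u z - m' z) = norm (of_real \<eta> * u z - (1 - x z)) / (norm (u z) * norm (1 - x z))"
      by (simp only: norm_divide norm_mult norm_minus_cancel)
    also have "\<dots> \<le> exp L * (\<eta> * norm (u z))\<^sup>2 / (norm (u z) * (\<eta> * d / (1 + d)))"
      by (rule frac_le[OF _ num mult_pos_pos[OF _ dp] mult_left_mono[OF den[OF z]]]) (use u0 in auto)
    also have "\<dots> = (exp L * norm (u z) * (1 + d) / d) * \<eta>" using u0 \<eta> d by (simp add: field_simps power2_eq_square)
    also have "\<dots> \<le> (exp L * W * (1 + d) / d) * \<eta>"
      using uW \<eta> d by (intro mult_right_mono divide_right_mono mult_left_mono) auto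
    also have "\<dots> \<le> (exp L * W * (1 + d) / d) * (e * d / (exp L * W * (1 + d)))"
      using \<eta>(3) d W by (intro mult_left_mono) auto
    also have "\<dots> = e"
    proof -
      have "X / d * (e * d / X) = e" if "X \<noteq> 0" for X using that d by simp
      moreover have "exp L * W * (1 + d) \<noteq> 0" using d W by simp
      ultimately show ?thesis by blast
    qed
    finally show ?thesis .
  qed
  ultimately show "\<exists>m'. multiplier m' \<and> (\<forall>z\<in>\<D>. norm (m' z) \<le> (1 + d) / d) \<and> (\<forall>z\<in>\<D>. norm (h z) \<le> R \<longrightarrow> norm (1 / u z - m' z) \<le> e)"
    by blast
qed

text \<open>\<open>\<i> * (h z - w)\<close> has real part \<open>Im w - Im (h z)\<close>, which lies
  between \<open>Im w - b > 0\<close> and \<open>Im w - a\<close>, as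
  \<open>multiplier_inverse_linear\<close> requires.\<close>

lemma multiplier_pole_upper:
  assumes "b < Im w" shows "multiplier (\<lambda>z. 1 / (h z - w))"
proof -
  have "multiplier (\<lambda>z. 1 / (\<i> * of_real 1 * h z + - \<i> * w))"
    by (rule multiplier_inverse_linear[where \<sigma>=1 and v="- \<i> * w" and d="Im w - b" and L="Im w - a"])
      (use assms strip in \<open>auto simp: algebra_simps less_imp_le\<close>)
  from multiplier_cmult[OF this, of \<i>] show ?thesis
  proof (rule multiplier_cong)
    fix z assume "z \<in> \<D>"
    have "\<i> * of_real 1 * h z + - \<i> * w = \<i> * (h z - w)" by (simp add: algebra_simps)
    then show "\<i> * (1 / (\<i> * of_real 1 * h z + - \<i> * w)) = 1 / (h z - w)" by simp
  qed
qed

lemma multiplier_pole_lower: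
  assumes "Im w < a" shows "multiplier (\<lambda>z. 1 / (h z - w))"
proof -
  have "multiplier (\<lambda>z. 1 / (\<i> * of_real (- 1) * h z + \<i> * w))"
    by (rule multiplier_inverse_linear[where \<sigma>="- 1" and v="\<i> * w" and d="a - Im w" and L="b - Im w"])
      (use assms strip in \<open>auto simp: algebra_simps less_imp_le\<close>)
  from multiplier_cmult[OF this, of "- \<i>"] show ?thesis
  proof (rule multiplier_cong)
    fix z assume "z \<in> \<D>"
    have "\<i> * of_real (- 1) * h z + \<i> * w = - \<i> * (h z - w)" by (simp add: algebra_simps)
    then show "- \<i> * (1 / (\<i> * of_real (- 1) * h z + \<i> * w)) = 1 / (h z - w)" by simp
  qed
qed

text \<open>Neumann series of the resolvent at \<open>v\<close> around \<open>w\<close>, with ratio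
  at most 1/2.\<close>

lemma multiplier_pole_shift:
  assumes m: "multiplier (\<lambda>z. 1 / (h z - w))" and d: "0 < d" "\<And>z. z \<in> \<D> \<Longrightarrow> d \<le> norm (h z - w)"
    and v: "norm (v - w) \<le> d / 2"
  shows "multiplier (\<lambda>z. 1 / (h z - v))"
proof -
  have "norm ((v - w) * (1 / (h z - w))) \<le> 1 / 2" if "z \<in> \<D>" for z
  proof -
    have "norm ((v - w) * (1 / (h z - w))) = norm (v - w) / norm (h z - w)" by (simp add: norm_mult norm_divide)
    also have "\<dots> \<le> (d / 2) / d" using d(2)[OF that] d(1) v by (intro frac_le) auto
    finally show ?thesis using d by simp
  qed
  then have "multiplier (\<lambda>z. 1 / (h z - w) * (1 / (1 - (v - w) * (1 / (h z - w)))))"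
    by (intro multiplier_mult m multiplier_geometric[where q="1/2"] multiplier_cmult) auto
  then show ?thesis
  proof (rule multiplier_cong)
    fix z assume z: "z \<in> \<D>"
    then have "h z - w \<noteq> 0" using d(1) d(2)[OF z] by auto
    then have "(h z - w) * (1 - (v - w) * (1 / (h z - w))) = h z - v" by (simp add: field_simps)
    then show "1 / (h z - w) * (1 / (1 - (v - w) * (1 / (h z - w)))) = 1 / (h z - v)"
      by (metis mult.right_neutral times_divide_times_eq)
  qed
qed

lemma multiplier_pole:
  assumes u: "u \<in> U" shows "multiplier (\<lambda>z. 1 / (h z - u))"
proof -
  have push: "multiplier (\<lambda>z. 1 / (h z - u))" if c: "connected_component U u v" and v: "multiplier (\<lambda>z. 1 / (h z - v))" for v
  proof (rule connected_induction_simple[where S="connected_component_set U u" and a=v and P="\<lambda>w. multiplier (\<lambda>z. 1 / (h z - w))"])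
    fix w assume "w \<in> connected_component_set U u"
    then have "w \<in> U" using connected_component_in by auto
    then obtain d where d: "0 < d" "ball w d \<subseteq> U" using open_U open_contains_ball by blast
    \<comment> \<open>With radius \<open>d / 8\<close>, two points of \<open>?T\<close> are less
      than \<open>d / 4\<close> apart and at least \<open>d / 2\<close> away from the image of
      \<open>h\<close>, so one Neumann series leads from either to the other.\<close>
    let ?T = "connected_component_set U u \<inter> ball w (d / 8)"
    have "multiplier (\<lambda>z. 1 / (h z - y))" if "x \<in> ?T" "y \<in> ?T" "multiplier (\<lambda>z. 1 / (h z - x))" for x y
    proof (rule multiplier_pole_shift[OF that(3), of "d / 2"])
      fix z assume "z \<in> \<D>"
      then have "h z \<notin> U" using h_in_\<Omega> closure_subset[of \<Omega>] by (auto simp: U_def)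
      then have "d \<le> dist w (h z)" using d by (meson in_mono mem_ball not_le)
      then show "d / 2 \<le> norm (h z - x)" using that(1) d(1) dist_triangle[of w "h z" x] by (simp add: dist_norm norm_minus_commute)
      next
      have "dist x y < d / 8 + d / 8" using that(1,2) dist_triangle[of x y w] by (simp add: dist_commute)
      then show "norm (y - x) \<le> d / 2 / 2" using d(1) by (simp add: dist_norm norm_minus_commute)
    qed (use d in auto)
    moreover have "w \<in> ?T" using \<open>w \<in> connected_component_set U u\<close> d by simp
    moreover have "openin (top_of_set (connected_component_set U u)) ?T" by (rule openin_open_Int) simp
    ultimately show "\<exists>T. openin (top_of_set (connected_component_set U u)) T \<and> w \<in> T \<and>
        (\<forall>x\<in>T. \<forall>y\<in>T. multiplier (\<lambda>z. 1 / (h z - x)) \<longrightarrow> multiplier (\<lambda>z. 1 / (h z - y)))"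
      by (intro exI[of _ ?T] conjI ballI impI)
  next
    show "u \<in> connected_component_set U u" using connected_component_refl[OF u] by simp
    show "connected (connected_component_set U u)" by (rule connected_connected_component)
    show "multiplier (\<lambda>z. 1 / (h z - v))" by (rule v)
    show "v \<in> connected_component_set U u" using c by simp
  qed
  from component_upp_low[OF u] show ?thesis
  proof
    assume "connected_component U u upp"
    then show ?thesis by (rule push) (simp add: multiplier_pole_upper)
  next
    assume "connected_component U u low"
    then show ?thesis by (rule push) (simp add: multiplier_pole_lower)
  qed
qed

end

section \<open>Runge approximation along a square grid\<close>

text \<open>Moves differences from the edge integrals to the indicators of squares, so that an edge
  between two squares of the same kind drops out.\<close>

lemma int_sum_by_parts:
  fixes c v :: "int \<Rightarrow> complex"
  assumes "m \<le> n"
  shows "(\<Sum>i\<in>{m..<n}. c i * (v (i + 1) - v i)) =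
    (\<Sum>i\<in>{m..<n}. v i * (c (i - 1) - c i)) + v n * c (n - 1) - v m * c (m - 1)"
  using assms
proof (induction n rule: int_ge_induct)
  case (step n)
  have "{m..<n + 1} = insert n {m..<n}" using step.hyps by auto
  then show ?case using step.IH by (simp add: algebra_simps)
qed simp

text \<open>\<Omega> extends infinitely far to the right, so the grid has infinitely many columns;
  the quadratic decay of \<open>F\<close> makes the sum over them converge. The distance
  \<open>4 * \<delta>\<close> leaves room for whole squares that come within \<delta> of
  \<Omega>.\<close>

locale runge_grid = koenigs_strip p a b h for p a b h +
  fixes F :: "complex \<Rightarrow> complex" and V :: "complex set" and \<delta> C :: real
  assumes F: "F holomorphic_on V" and \<delta>: "0 < \<delta>" "\<delta> \<le> 1 / 2"
    and near: "\<And>x w. x \<in> \<Omega> \<Longrightarrow> dist x w \<le> 4 * \<delta> \<Longrightarrow> w \<in> V"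
    and F_bound: "\<And>w. w \<in> V \<Longrightarrow> norm (F w) \<le> C / (1 + \<bar>Re w\<bar>)\<^sup>2" and C0: "0 \<le> C"
begin

section \<open>The grid and its marked squares\<close>

definition P :: "int \<Rightarrow> int \<Rightarrow> complex" where "P i j = Complex (\<delta> * of_int i) (\<delta> * of_int j)"
definition Q where "Q i j = cbox (P i j) (P (i + 1) (j + 1))"
text \<open>The marked squares. They need only come within \<delta> of \<Omega>, not meet it; hence
  every edge of an unmarked square keeps a distance greater than \<delta> from \<Omega>.\<close>

definition A where "A = {(i, j). \<exists>x\<in>\<Omega>. \<exists>q\<in>Q i j. dist x q \<le> \<delta>}"
definition \<kappa> :: "int \<Rightarrow> int \<Rightarrow> complex" where "\<kappa> i j = (if (i, j) \<in> A then 1 else 0)"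
text \<open>The addition of 2 leaves the rows \<open>J - 1\<close> and \<open>- J - 1\<close>
  unmarked, so that the vertical summation by parts has no boundary terms.\<close>

definition J :: int where "J = \<lceil>(B + \<delta>) / \<delta>\<rceil> + 2"
definition ve where "ve i j w = contour_integral (linepath (P i j) (P i (j + 1))) (\<lambda>\<zeta>. F \<zeta> / (\<zeta> - w))"
definition he where "he i j w = contour_integral (linepath (P i j) (P (i + 1) j)) (\<lambda>\<zeta>. F \<zeta> / (\<zeta> - w))"
definition offgrid where "offgrid w \<longleftrightarrow> (\<forall>i::int. Re w \<noteq> \<delta> * of_int i \<and> Im w \<noteq> \<delta> * of_int i)"

lemma in_Q: "q \<in> Q i j \<longleftrightarrow> \<delta> * of_int i \<le> Re q \<and> Re q \<le> \<delta> * (of_int i + 1) \<and> \<delta> * of_int j \<le> Im q \<and> Im q \<le> \<delta> * (of_int j + 1)"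
  by (auto simp: Q_def P_def in_cbox_complex_iff)

lemma Q_diam: 
  assumes "q \<in> Q i j" "q' \<in> Q i j" shows "dist q q' \<le> 2 * \<delta>"
proof -
  have "dist q q' \<le> \<bar>Re (q - q')\<bar> + \<bar>Im (q - q')\<bar>" unfolding dist_norm by (rule cmod_le)
  also have "\<dots> \<le> \<delta> + \<delta>" using assms by (intro add_mono) (auto simp: in_Q algebra_simps)
  finally show ?thesis by simp
qed

lemma A_subset_V: assumes "(i, j) \<in> A" shows "Q i j \<subseteq> V"
proof
  fix q' assume q': "q' \<in> Q i j"
  obtain x q where x: "x \<in> \<Omega>" "q \<in> Q i j" "dist x q \<le> \<delta>" using assms by (auto simp: A_def)
  have "dist x q' \<le> dist x q + dist q q'" by (rule dist_triangle)
  also have "\<dots> \<le> 4 * \<delta>" using x Q_diam[OF x(2) q'] \<delta> by linarith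
  finally show "q' \<in> V" using near x(1) by blast
qed

lemma not_A_far: "(i, j) \<notin> A \<Longrightarrow> q \<in> Q i j \<Longrightarrow> x \<in> \<Omega> \<Longrightarrow> \<delta> < dist x q"
  by (force simp: A_def)

lemma A_rows: assumes "(i, j) \<in> A" shows "- J \<le> j" "j < J - 1"
proof -
  obtain x q where x: "x \<in> \<Omega>" "q \<in> Q i j" "dist x q \<le> \<delta>" using assms by (auto simp: A_def)
  have "\<bar>Im x\<bar> \<le> B" using x(1) B_bound by (auto simp: \<Omega>_def)
  moreover have "\<bar>Im (x - q)\<bar> \<le> \<delta>" using x(3) abs_Im_le_cmod[of "x - q"] by (simp add: dist_norm)
  ultimately have q: "\<bar>Im q\<bar> \<le> B + \<delta>" by simp
  have "\<delta> * of_int j \<le> B + \<delta>" "- (B + \<delta>) \<le> \<delta> * (of_int j + 1)" using x(2) q by (auto simp: in_Q)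
  then have "of_int j \<le> (B + \<delta>) / \<delta>" "- ((B + \<delta>) / \<delta>) \<le> of_int j + 1" using \<delta> by (auto simp: field_simps)
  moreover have "(B + \<delta>) / \<delta> \<le> of_int (J - 2)" by (simp add: J_def)
  ultimately have "real_of_int j \<le> of_int (J - 2)" "- real_of_int (J - 2) \<le> of_int (j + 1)" by simp_all
  then show "- J \<le> j" "j < J - 1" by linarith+
qed

lemma J_pos: "0 \<le> J"
proof -
  have "0 \<le> (B + \<delta>) / \<delta>" using \<delta> by (simp add: B_def)
  then have "0 \<le> \<lceil>(B + \<delta>) / \<delta>\<rceil>" by (metis ceiling_mono ceiling_zero)
  then show ?thesis by (simp add: J_def)
qed

lemma P_in_Q: "P i j \<in> Q i j" "P (i + 1) j \<in> Q i j" "P i (j + 1) \<in> Q i j" "P (i + 1) (j + 1) \<in> Q i j"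
  using \<delta> by (auto simp: in_Q P_def)

lemma segment_in_Q: "c \<in> Q i j \<Longrightarrow> d \<in> Q i j \<Longrightarrow> closed_segment c d \<subseteq> Q i j"
  by (intro closed_segment_subset) (auto simp: Q_def convex_box)

lemma seg_v: "closed_segment (P i j) (P i (j + 1)) \<subseteq> Q i j" "closed_segment (P i j) (P i (j + 1)) \<subseteq> Q (i - 1) j"
  using segment_in_Q P_in_Q(1,3)[of i j] P_in_Q(2,4)[of "i - 1" j] by simp_all

lemma seg_h: "closed_segment (P i j) (P (i + 1) j) \<subseteq> Q i j" "closed_segment (P i j) (P (i + 1) j) \<subseteq> Q i (j - 1)"
  using segment_in_Q P_in_Q(1,2)[of i j] P_in_Q(3,4)[of i "j - 1"] by simp_all

lemma offgridD:
  assumes "offgrid w"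
  shows "Re w \<noteq> \<delta> * of_int i" "Im w \<noteq> \<delta> * of_int i" "Re w \<noteq> \<delta> * (of_int i + 1)" "Im w \<noteq> \<delta> * (of_int i + 1)"
  using spec[OF assms[unfolded offgrid_def], of i] spec[OF assms[unfolded offgrid_def], of "i + 1"] by auto

lemma seg_v_Re: "\<zeta> \<in> closed_segment (P i j) (P i (j + 1)) \<Longrightarrow> Re \<zeta> = \<delta> * of_int i"
  using seg_v(1)[of i j] seg_v(2)[of i j] by (force simp: in_Q subset_iff)

lemma seg_h_Im: "\<zeta> \<in> closed_segment (P i j) (P (i + 1) j) \<Longrightarrow> Im \<zeta> = \<delta> * of_int j"
  using seg_h(1)[of i j] seg_h(2)[of i j] by (force simp: in_Q subset_iff)

lemma norm_edge: "norm (P i (j + 1) - P i j) = \<delta>" "norm (P (i + 1) j - P i j) = \<delta>"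
  using \<delta> by (auto simp: P_def complex_diff cmod_def algebra_simps)

lemma F_cont: "S \<subseteq> V \<Longrightarrow> continuous_on S F"
  using F holomorphic_on_imp_continuous_on continuous_on_subset by blast

lemma square_integral:
  assumes A: "(i, j) \<in> A" and w: "offgrid w"
  shows "he i j w + ve (i + 1) j w - he i (j + 1) w - ve i j w = (if w \<in> Q i j then 2 * pi * \<i> * F w else 0)"
proof -
  let ?f = "\<lambda>\<zeta>. F \<zeta> / (\<zeta> - w)"
  let ?a1 = "P i j" and ?a2 = "P (i + 1) j" and ?a3 = "P (i + 1) (j + 1)" and ?a4 = "P i (j + 1)"
  have QV: "Q i j \<subseteq> V" by (rule A_subset_V[OF A])
  have nw: "w \<notin> closed_segment ?a1 ?a2" "w \<notin> closed_segment ?a2 ?a3" "w \<notin> closed_segment ?a4 ?a3" "w \<notin> closed_segment ?a1 ?a4"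
    using offgridD[OF w] seg_v_Re[of w "i + 1" j] seg_v_Re[of w i j] seg_h_Im[of w i j] seg_h_Im[of w i "j + 1"] by auto
  have sub: "closed_segment ?a1 ?a2 \<subseteq> Q i j" "closed_segment ?a2 ?a3 \<subseteq> Q i j" "closed_segment ?a4 ?a3 \<subseteq> Q i j" "closed_segment ?a1 ?a4 \<subseteq> Q i j"
    using seg_h(1)[of i j] seg_v(2)[of "i + 1" j] seg_h(2)[of i "j + 1"] seg_v(1)[of i j] by auto
  have cont: "continuous_on S ?f" if "S \<subseteq> Q i j" "w \<notin> S" for S
    using that QV by (intro continuous_intros F_cont) auto
  have c: "continuous_on (closed_segment ?a1 ?a2) ?f" "continuous_on (closed_segment ?a2 ?a3) ?f"
     "continuous_on (closed_segment ?a3 ?a4) ?f" "continuous_on (closed_segment ?a4 ?a1) ?f"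
    using cont[OF sub(1) nw(1)] cont[OF sub(2) nw(2)] cont[OF sub(3) nw(3)] cont[OF sub(4) nw(4)]
    by (simp_all add: closed_segment_commute)
  note ci = c[THEN contour_integrable_continuous_linepath]
  have rect: "rectpath ?a1 ?a3 = linepath ?a1 ?a2 +++ linepath ?a2 ?a3 +++ linepath ?a3 ?a4 +++ linepath ?a4 ?a1"
    by (simp add: rectpath_def Let_def P_def)
  have "contour_integral (rectpath ?a1 ?a3) ?f =
     contour_integral (linepath ?a1 ?a2) ?f + (contour_integral (linepath ?a2 ?a3) ?f + (contour_integral (linepath ?a3 ?a4) ?f + contour_integral (linepath ?a4 ?a1) ?f))"
    unfolding rect using ci by (simp add: contour_integral_join contour_integrable_join valid_path_join)
  also have "contour_integral (linepath ?a3 ?a4) ?f = - he i (j + 1) w"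
    unfolding he_def by (rule contour_integral_reverse_linepath[OF c(3)])
  also have "contour_integral (linepath ?a4 ?a1) ?f = - ve i j w"
    unfolding ve_def by (rule contour_integral_reverse_linepath[OF c(4)])
  finally have I: "contour_integral (rectpath ?a1 ?a3) ?f = he i j w + ve (i + 1) j w - he i (j + 1) w - ve i j w"
    by (simp add: he_def ve_def)
  have le: "Re ?a1 \<le> Re ?a3" "Im ?a1 \<le> Im ?a3" using \<delta> by (auto simp: P_def)
  have img: "path_image (rectpath ?a1 ?a3) \<subseteq> Q i j" unfolding Q_def by (rule path_image_rectpath_subset_cbox[OF le])
  have FQ: "F holomorphic_on Q i j" by (rule holomorphic_on_subset[OF F QV])
  have cQ: "convex (Q i j)" by (simp add: Q_def convex_box)
  show ?thesis
  proof (cases "w \<in> Q i j")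
    case True
    have wb: "w \<in> box ?a1 ?a3"
      using True offgridD[OF w, of i] offgridD[OF w, of j]
      by (auto simp: in_Q in_box_complex_iff P_def less_le)
    have "path_image (rectpath ?a1 ?a3) \<subseteq> Q i j - {w}"
      using img wb le by (auto simp: path_image_rectpath_cbox_minus_box)
    then have "(?f has_contour_integral (2 * pi * \<i> * winding_number (rectpath ?a1 ?a3) w * F w)) (rectpath ?a1 ?a3)"
      using wb by (intro Cauchy_integral_formula_convex_simple[OF cQ FQ]) (auto simp: Q_def interior_cbox)
    then show ?thesis using True I winding_number_rectpath[OF wb] by (simp add: contour_integral_unique)
  next
    case False
    have "?f holomorphic_on Q i j" using False by (intro holomorphic_intros FQ) auto
    then have "(?f has_contour_integral 0) (rectpath ?a1 ?a3)"
      using img by (intro Cauchy_theorem_convex_simple[OF _ cQ]) auto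
    then show ?thesis using False I by (simp add: contour_integral_unique)
  qed
qed

text \<open>What summation by parts leaves of the left and the lower edge of a square: nothing,
  unless the edge separates a marked square from an unmarked one.\<close>

definition T where
  "T i j w = ve i j w * (\<kappa> (i - 1) j - \<kappa> i j) - he i j w * (\<kappa> i (j - 1) - \<kappa> i j)"
definition row where "row i w = (\<Sum>j\<in>{-J..<J}. T i j w)"
definition G where "G N w = (\<Sum>i\<in>{-N..<N}. row i w)"
text \<open>Boundary terms of the horizontal summation by parts, on the two columns where the grid
  is cut off.\<close>

definition wall where "wall N w = (\<Sum>j\<in>{-J..<J}. ve N j w * \<kappa> (N - 1) j - ve (- N) j w * \<kappa> (- N - 1) j)"

text \<open>Cauchy's formula is summed over the marked squares. Exactly one of them contains
  \<open>w\<close>, and the condition on \<open>N\<close> places it between the cut-off columns.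
  Summation by parts in both directions then removes the inner edges.\<close>

lemma grid_sum:
  assumes w: "offgrid w" "w \<in> \<Omega>" and N: "\<bar>Re w\<bar> + 1 \<le> \<delta> * of_int N"
  shows "G N w + wall N w = 2 * pi * \<i> * F w"
proof -
  define i0 j0 where "i0 = \<lfloor>Re w / \<delta>\<rfloor>" and "j0 = \<lfloor>Im w / \<delta>\<rfloor>"
  have inQ: "w \<in> Q i j \<longleftrightarrow> i = i0 \<and> j = j0" for i j
  proof
    assume "w \<in> Q i j"
    moreover note offgridD(3,4)[OF w(1)]
    ultimately have "of_int i \<le> Re w / \<delta>" "Re w / \<delta> < of_int i + 1" "of_int j \<le> Im w / \<delta>" "Im w / \<delta> < of_int j + 1"
      using \<delta> by (auto simp: in_Q field_simps less_le)
    then show "i = i0 \<and> j = j0" unfolding i0_def j0_def by (simp add: floor_unique)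
  next
    assume "i = i0 \<and> j = j0"
    moreover have "\<delta> * of_int i0 \<le> Re w" "\<delta> * of_int j0 \<le> Im w"
      unfolding i0_def j0_def using floor_divide_lower[OF \<delta>(1), of "Re w"] floor_divide_lower[OF \<delta>(1), of "Im w"] by (simp_all add: mult.commute)
    moreover have "Re w \<le> \<delta> * (of_int i0 + 1)" "Im w \<le> \<delta> * (of_int j0 + 1)"
      unfolding i0_def j0_def using floor_divide_upper[OF \<delta>(1), of "Re w"] floor_divide_upper[OF \<delta>(1), of "Im w"] by (simp_all add: mult.commute)
    ultimately show "w \<in> Q i j" by (simp add: in_Q)
  qed
  have wQ: "w \<in> Q i0 j0" using inQ by simp
  have A0: "(i0, j0) \<in> A" using wQ w(2) \<delta> by (auto simp: A_def intro!: bexI[of _ w])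
  have N0: "0 \<le> N"
  proof -
    have "0 \<le> \<delta> * of_int N" using N by linarith
    then show ?thesis using \<delta> by (simp add: zero_le_mult_iff)
  qed
  have i0: "i0 \<in> {-N..<N}"
  proof -
    have "\<delta> * of_int i0 \<le> Re w" "Re w \<le> \<delta> * (of_int i0 + 1)" using wQ by (auto simp: in_Q)
    then have "\<delta> * of_int i0 < \<delta> * of_int N" "\<delta> * - of_int N < \<delta> * (of_int i0 + 1)" using N by auto
    then have "real_of_int i0 < of_int N" "- real_of_int N < of_int i0 + 1" using \<delta> by (simp_all only: mult_less_cancel_left_pos)
    then show ?thesis by simp
  qed
  have j0: "j0 \<in> {-J..<J}" using A_rows[OF A0] by auto
  let ?I = "\<lambda>i j. he i j w + ve (i + 1) j w - he i (j + 1) w - ve i j w"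
  have "\<kappa> i j * ?I i j = (if i = i0 then if j = j0 then 2 * pi * \<i> * F w else 0 else 0)" for i j
    using square_integral[OF _ w(1), of i j] inQ[of i j] A0 by (auto simp: \<kappa>_def)
  then have S: "(\<Sum>i\<in>{-N..<N}. \<Sum>j\<in>{-J..<J}. \<kappa> i j * ?I i j) = 2 * pi * \<i> * F w"
  proof -
    assume eq: "\<And>i j. \<kappa> i j * ?I i j = (if i = i0 then if j = j0 then 2 * pi * \<i> * F w else 0 else 0)"
    have "(\<Sum>j\<in>{-J..<J}. \<kappa> i j * ?I i j) = (if i = i0 then 2 * pi * \<i> * F w else 0)" for i
      unfolding eq using j0 by (cases "i = i0") (simp_all add: sum.delta)
    then show ?thesis using i0 by (simp add: sum.delta)
  qed
  have "(\<Sum>i\<in>{-N..<N}. \<Sum>j\<in>{-J..<J}. \<kappa> i j * ?I i j) =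
     (\<Sum>i\<in>{-N..<N}. \<Sum>j\<in>{-J..<J}. \<kappa> i j * (ve (i + 1) j w - ve i j w)) - (\<Sum>i\<in>{-N..<N}. \<Sum>j\<in>{-J..<J}. \<kappa> i j * (he i (j + 1) w - he i j w))"
    unfolding sum_subtractf[symmetric] by (intro sum.cong refl) (simp add: algebra_simps)
  also have "(\<Sum>i\<in>{-N..<N}. \<Sum>j\<in>{-J..<J}. \<kappa> i j * (he i (j + 1) w - he i j w)) = (\<Sum>i\<in>{-N..<N}. \<Sum>j\<in>{-J..<J}. he i j w * (\<kappa> i (j - 1) - \<kappa> i j))"
  proof (rule sum.cong[OF refl])
    fix i
    have "\<kappa> i (J - 1) = 0" "\<kappa> i (- J - 1) = 0" using A_rows by (force simp: \<kappa>_def)+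
    then show "(\<Sum>j\<in>{-J..<J}. \<kappa> i j * (he i (j + 1) w - he i j w)) = (\<Sum>j\<in>{-J..<J}. he i j w * (\<kappa> i (j - 1) - \<kappa> i j))"
      using int_sum_by_parts[of "-J" J "\<kappa> i" "\<lambda>j. he i j w"] J_pos by simp
  qed
  also have "(\<Sum>i\<in>{-N..<N}. \<Sum>j\<in>{-J..<J}. \<kappa> i j * (ve (i + 1) j w - ve i j w)) = (\<Sum>j\<in>{-J..<J}. \<Sum>i\<in>{-N..<N}. \<kappa> i j * (ve (i + 1) j w - ve i j w))"
    by (rule sum.swap)
  also have "\<dots> = (\<Sum>j\<in>{-J..<J}. (\<Sum>i\<in>{-N..<N}. ve i j w * (\<kappa> (i - 1) j - \<kappa> i j)) + (ve N j w * \<kappa> (N - 1) j - ve (- N) j w * \<kappa> (- N - 1) j))"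
    using N0 by (intro sum.cong refl) (subst int_sum_by_parts, auto)
  also have "\<dots> = (\<Sum>j\<in>{-J..<J}. \<Sum>i\<in>{-N..<N}. ve i j w * (\<kappa> (i - 1) j - \<kappa> i j)) + wall N w"
    by (simp add: sum.distrib wall_def)
  also have "(\<Sum>j\<in>{-J..<J}. \<Sum>i\<in>{-N..<N}. ve i j w * (\<kappa> (i - 1) j - \<kappa> i j)) = (\<Sum>i\<in>{-N..<N}. \<Sum>j\<in>{-J..<J}. ve i j w * (\<kappa> (i - 1) j - \<kappa> i j))"
    by (rule sum.swap)
  finally have "(\<Sum>i\<in>{-N..<N}. \<Sum>j\<in>{-J..<J}. \<kappa> i j * ?I i j) = G N w + wall N w"
    by (simp add: G_def row_def T_def sum_subtractf)
  with S show ?thesis by simp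
qed

section \<open>Decay estimates for the grid sum\<close>

lemma F_column:
  assumes "\<zeta> \<in> V" "\<delta> * of_int i \<le> Re \<zeta>" "Re \<zeta> \<le> \<delta> * (of_int i + 1)"
  shows "norm (F \<zeta>) \<le> C / (\<delta> * (1 + \<bar>of_int i\<bar>))\<^sup>2"
proof -
  have "\<delta> * \<bar>of_int i\<bar> - \<delta> \<le> \<bar>Re \<zeta>\<bar>" using assms \<delta> by (cases "0 \<le> i") (auto simp: algebra_simps)
  \<comment> \<open>Adding \<open>2 * \<delta> \<le> 1\<close> to the previous inequality; this is
    the purpose of the bound on \<delta>.\<close>
  then have "\<delta> * (1 + \<bar>of_int i\<bar>) \<le> 1 + \<bar>Re \<zeta>\<bar>" using \<delta> by (simp add: algebra_simps)
  then have "C / (1 + \<bar>Re \<zeta>\<bar>)\<^sup>2 \<le> C / (\<delta> * (1 + \<bar>of_int i\<bar>))\<^sup>2"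
    using C0 \<delta> by (intro divide_left_mono power_mono) (auto intro!: mult_pos_pos zero_less_power add_pos_nonneg)
  then show ?thesis using F_bound[OF assms(1)] by linarith
qed

lemma edge_bound:
  assumes seg: "closed_segment c d \<subseteq> V" and len: "norm (d - c) = \<delta>" and r: "0 < r"
    and far: "\<And>\<zeta>. \<zeta> \<in> closed_segment c d \<Longrightarrow> r \<le> norm (\<zeta> - w)"
    and col: "\<And>\<zeta>. \<zeta> \<in> closed_segment c d \<Longrightarrow> \<delta> * of_int i \<le> Re \<zeta> \<and> Re \<zeta> \<le> \<delta> * (of_int i + 1)"
  shows "norm (contour_integral (linepath c d) (\<lambda>\<zeta>. F \<zeta> / (\<zeta> - w))) \<le> (C / \<delta>\<^sup>2) / (1 + \<bar>of_int i\<bar>)\<^sup>2 * (\<delta> / r)"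
proof -
  have nw: "w \<notin> closed_segment c d" using far[of w] r by auto
  have "continuous_on (closed_segment c d) (\<lambda>\<zeta>. F \<zeta> / (\<zeta> - w))"
    using nw by (intro continuous_intros F_cont seg) auto
  then have ci: "(\<lambda>\<zeta>. F \<zeta> / (\<zeta> - w)) contour_integrable_on linepath c d" by (rule contour_integrable_continuous_linepath)
  have "norm (contour_integral (linepath c d) (\<lambda>\<zeta>. F \<zeta> / (\<zeta> - w))) \<le> (C / (\<delta> * (1 + \<bar>of_int i\<bar>))\<^sup>2 / r) * norm (d - c)"
  proof (rule contour_integral_bound_linepath[OF ci])
    fix \<zeta> assume \<zeta>: "\<zeta> \<in> closed_segment c d"
    show "norm (F \<zeta> / (\<zeta> - w)) \<le> C / (\<delta> * (1 + \<bar>of_int i\<bar>))\<^sup>2 / r"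
      unfolding norm_divide using F_column[of \<zeta> i] col[OF \<zeta>] far[OF \<zeta>] \<zeta> seg r C0 by (intro frac_le) auto
  qed (use C0 r in auto)
  then show ?thesis unfolding len by (simp add: power_mult_distrib)
qed

text \<open>The edge borders one marked and one unmarked square: the first puts it into
  \<open>V\<close>, the second keeps it away from \<Omega>.\<close>

lemma v_edge:
  assumes "\<kappa> (i - 1) j - \<kappa> i j \<noteq> 0"
  shows "closed_segment (P i j) (P i (j + 1)) \<subseteq> V" "\<And>\<zeta> x. \<zeta> \<in> closed_segment (P i j) (P i (j + 1)) \<Longrightarrow> x \<in> \<Omega> \<Longrightarrow> \<delta> < dist x \<zeta>"
proof -
  from assms have "(i - 1, j) \<in> A \<and> (i, j) \<notin> A \<or> (i - 1, j) \<notin> A \<and> (i, j) \<in> A" by (auto simp: \<kappa>_def split: if_splits)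
  then show "closed_segment (P i j) (P i (j + 1)) \<subseteq> V" "\<And>\<zeta> x. \<zeta> \<in> closed_segment (P i j) (P i (j + 1)) \<Longrightarrow> x \<in> \<Omega> \<Longrightarrow> \<delta> < dist x \<zeta>"
    using A_subset_V not_A_far seg_v[of i j] by blast+
qed

lemma h_edge:
  assumes "\<kappa> i (j - 1) - \<kappa> i j \<noteq> 0"
  shows "closed_segment (P i j) (P (i + 1) j) \<subseteq> V" "\<And>\<zeta> x. \<zeta> \<in> closed_segment (P i j) (P (i + 1) j) \<Longrightarrow> x \<in> \<Omega> \<Longrightarrow> \<delta> < dist x \<zeta>"
proof -
  from assms have "(i, j - 1) \<in> A \<and> (i, j) \<notin> A \<or> (i, j - 1) \<notin> A \<and> (i, j) \<in> A" by (auto simp: \<kappa>_def split: if_splits)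
  then show "closed_segment (P i j) (P (i + 1) j) \<subseteq> V" "\<And>\<zeta> x. \<zeta> \<in> closed_segment (P i j) (P (i + 1) j) \<Longrightarrow> x \<in> \<Omega> \<Longrightarrow> \<delta> < dist x \<zeta>"
    using A_subset_V not_A_far seg_h[of i j] by blast+
qed

lemma norm_\<kappa>: "norm (\<kappa> i j) \<le> 1" "norm (\<kappa> i j - \<kappa> k l) \<le> 1"
  by (auto simp: \<kappa>_def)

lemma T_bound:
  assumes w: "w \<in> \<Omega>" shows "norm (T i j w) \<le> 2 * (C / \<delta>\<^sup>2) / (1 + \<bar>of_int i\<bar>)\<^sup>2"
proof -
  let ?M = "(C / \<delta>\<^sup>2) / (1 + \<bar>of_int i\<bar>)\<^sup>2 :: real"
  have M: "0 \<le> ?M" using C0 by simp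
  have v: "norm (ve i j w * (\<kappa> (i - 1) j - \<kappa> i j)) \<le> ?M"
  proof (cases "\<kappa> (i - 1) j - \<kappa> i j = 0")
    case False
    note e = v_edge[OF False]
    have "norm (ve i j w) \<le> ?M * (\<delta> / \<delta>)"
      unfolding ve_def
    proof (rule edge_bound[OF e(1) norm_edge(1) \<delta>(1)])
      fix \<zeta> assume \<zeta>: "\<zeta> \<in> closed_segment (P i j) (P i (j + 1))"
      show "\<delta> \<le> norm (\<zeta> - w)" using e(2)[OF \<zeta> w] by (simp add: dist_norm norm_minus_commute)
      show "\<delta> * of_int i \<le> Re \<zeta> \<and> Re \<zeta> \<le> \<delta> * (of_int i + 1)" using seg_v(1)[of i j] \<zeta> by (auto simp: in_Q)
    qed
    then have "norm (ve i j w) * norm (\<kappa> (i - 1) j - \<kappa> i j) \<le> ?M * 1"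
      using norm_\<kappa> M \<delta> by (intro mult_mono) auto
    then show ?thesis by (simp add: norm_mult)
  qed (use M in simp)
  have h: "norm (he i j w * (\<kappa> i (j - 1) - \<kappa> i j)) \<le> ?M"
  proof (cases "\<kappa> i (j - 1) - \<kappa> i j = 0")
    case False
    note e = h_edge[OF False]
    have "norm (he i j w) \<le> ?M * (\<delta> / \<delta>)"
      unfolding he_def
    proof (rule edge_bound[OF e(1) norm_edge(2) \<delta>(1)])
      fix \<zeta> assume \<zeta>: "\<zeta> \<in> closed_segment (P i j) (P (i + 1) j)"
      show "\<delta> \<le> norm (\<zeta> - w)" using e(2)[OF \<zeta> w] by (simp add: dist_norm norm_minus_commute)
      show "\<delta> * of_int i \<le> Re \<zeta> \<and> Re \<zeta> \<le> \<delta> * (of_int i + 1)" using seg_h(1)[of i j] \<zeta> by (auto simp: in_Q)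
    qed
    then have "norm (he i j w) * norm (\<kappa> i (j - 1) - \<kappa> i j) \<le> ?M * 1"
      using norm_\<kappa> M \<delta> by (intro mult_mono) auto
    then show ?thesis by (simp add: norm_mult)
  qed (use M in simp)
  have "norm (T i j w) \<le> ?M + ?M" unfolding T_def using v h norm_triangle_ineq4 by (meson add_mono order_trans)
  then show ?thesis by simp
qed

text \<open>Up to the decay factor, \<open>L / 2\<close> bounds one column: two edges for each of
  \<open>2 * J\<close> squares. Enlarging the grid by one step adds two columns.\<close>

definition L where "L = 8 * of_int J * (C / \<delta>\<^sup>2)"

lemma L0: "0 \<le> L" using C0 J_pos by (simp add: L_def)

lemma row_bound:
  assumes "w \<in> \<Omega>" shows "norm (row i w) \<le> L / 2 / (1 + \<bar>of_int i\<bar>)\<^sup>2"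
proof -
  have "norm (row i w) \<le> (\<Sum>j\<in>{-J..<J}. 2 * (C / \<delta>\<^sup>2) / (1 + \<bar>of_int i\<bar>)\<^sup>2)"
    unfolding row_def using T_bound[OF assms] by (intro sum_norm_le) auto
  also have "\<dots> = L / 2 / (1 + \<bar>of_int i\<bar>)\<^sup>2" using J_pos by (simp add: L_def)
  finally show ?thesis .
qed

text \<open>Each step adds at most \<open>L / (1 + M)\<^sup>2\<close>, which is at most
  \<open>L * (1 / M - 1 / (M + 1))\<close>, and this telescopes.\<close>

lemma G_tail:
  assumes w: "w \<in> \<Omega>" and N: "1 \<le> N" "N \<le> M"
  shows "norm (G M w - G N w) \<le> L * (1 / of_int N - 1 / of_int M)"
  using N(2)
proof (induction M rule: int_ge_induct)
  case (step M)
  have M: "1 \<le> M" using N step.hyps by simp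
  have "{- (M + 1)..<M + 1} = insert M (insert (- M - 1) {- M..<M})" using M by auto
  then have "G (M + 1) w - G N w = (G M w - G N w) + row M w + row (- M - 1) w"
    using M by (simp add: G_def algebra_simps)
  then have eq: "G (M + 1) w - G N w = G M w - G N w + row M w + row (- M - 1) w" .
  have "norm (G (M + 1) w - G N w) \<le> norm (G M w - G N w) + norm (row M w) + norm (row (- M - 1) w)"
    using norm_triangle_ineq[of "G M w - G N w + row M w" "row (- M - 1) w"] norm_triangle_ineq[of "G M w - G N w" "row M w"]
    unfolding eq by linarith
  also have "norm (row M w) \<le> L / 2 / (1 + of_int M)\<^sup>2" using row_bound[OF w, of M] M by simp
  also have "norm (row (- M - 1) w) \<le> L / 2 / (1 + of_int M)\<^sup>2"
  proof -
    have "norm (row (- M - 1) w) \<le> L / 2 / (1 + \<bar>of_int (- M - 1)\<bar>)\<^sup>2" by (rule row_bound[OF w])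
    also have "\<dots> \<le> L / 2 / (1 + of_int M)\<^sup>2" using M L0
      by (intro divide_left_mono power_mono) (auto intro!: mult_pos_pos zero_less_power)
    finally show ?thesis .
  qed
  also have "norm (G M w - G N w) + L / 2 / (1 + of_int M)\<^sup>2 + L / 2 / (1 + of_int M)\<^sup>2 = norm (G M w - G N w) + L * (1 / (1 + of_int M)\<^sup>2)"
    by simp
  also have "\<dots> \<le> L * (1 / of_int N - 1 / of_int M) + L * (1 / of_int M - 1 / of_int (M + 1))"
  proof (intro add_mono step.IH mult_left_mono L0)
    have "1 / real_of_int M - 1 / of_int (M + 1) = 1 / (of_int M * (1 + of_int M))" using M by (simp add: field_simps)
    moreover have "1 / (1 + real_of_int M)\<^sup>2 \<le> 1 / (of_int M * (1 + of_int M))"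
      using M unfolding power2_eq_square by (intro divide_left_mono mult_right_mono) auto
    ultimately show "1 / (1 + real_of_int M)\<^sup>2 \<le> 1 / of_int M - 1 / of_int (M + 1)" by simp
  qed
  finally show ?case by (simp add: algebra_simps)
qed simp

text \<open>The cut-off edges may run through \<Omega>, but they stay at distance at least 1 from
  \<open>w\<close>, and \<open>F\<close> is small on them.\<close>

lemma wall_bound:
  assumes M: "1 \<le> M" "\<bar>Re w\<bar> + 1 \<le> \<delta> * of_int M"
  shows "norm (wall M w) \<le> L / of_int M"
proof -
  have *: "norm (ve i j w * \<kappa> (i - 1) j) \<le> C / \<delta>\<^sup>2 / of_int M" if i: "\<bar>i\<bar> = M" for i j
  proof (cases "(i - 1, j) \<in> A")
    case True
    have seg: "closed_segment (P i j) (P i (j + 1)) \<subseteq> V" using A_subset_V[OF True] seg_v(2) by blast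
    have "norm (ve i j w) \<le> (C / \<delta>\<^sup>2) / (1 + \<bar>of_int i\<bar>)\<^sup>2 * (\<delta> / 1)"
      unfolding ve_def
    proof (rule edge_bound[OF seg norm_edge(1)])
      fix \<zeta> assume \<zeta>: "\<zeta> \<in> closed_segment (P i j) (P i (j + 1))"
      have "\<bar>Re \<zeta>\<bar> = \<delta> * of_int M" unfolding seg_v_Re[OF \<zeta>] using i \<delta> by (auto simp: abs_mult simp flip: of_int_abs)
      then have "1 \<le> \<bar>Re (\<zeta> - w)\<bar>" using M(2) by simp
      then show "1 \<le> norm (\<zeta> - w)" using abs_Re_le_cmod order_trans by blast
      show "\<delta> * of_int i \<le> Re \<zeta> \<and> Re \<zeta> \<le> \<delta> * (of_int i + 1)" using seg_v(1)[of i j] \<zeta> by (auto simp: in_Q)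
    qed simp
    also have "\<dots> \<le> (C / \<delta>\<^sup>2) / of_int M * 1"
    proof (intro mult_mono divide_left_mono)
      have "of_int M \<le> (1 + real_of_int M) * 1" by simp
      also have "\<dots> \<le> (1 + real_of_int M) * (1 + of_int M)" using M by (intro mult_left_mono) auto
      finally show "of_int M \<le> (1 + \<bar>real_of_int i\<bar>)\<^sup>2" using i by (simp add: power2_eq_square flip: of_int_abs)
    qed (use M C0 \<delta> i in \<open>auto intro!: mult_pos_pos zero_less_power\<close>)
    finally show ?thesis using True by (simp add: \<kappa>_def)
  qed (use C0 M in \<open>simp add: \<kappa>_def\<close>)
  have "norm (wall M w) \<le> (\<Sum>j\<in>{-J..<J}. 2 * (C / \<delta>\<^sup>2 / of_int M))"
    unfolding wall_def
  proof (rule sum_norm_le)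
    fix j
    have "norm (ve M j w * \<kappa> (M - 1) j - ve (- M) j w * \<kappa> (- M - 1) j) \<le> norm (ve M j w * \<kappa> (M - 1) j) + norm (ve (- M) j w * \<kappa> (- M - 1) j)"
      by (rule norm_triangle_ineq4)
    also have "\<dots> \<le> 2 * (C / \<delta>\<^sup>2 / of_int M)" using *[of M j] *[of "- M" j] M by simp
    finally show "norm (ve M j w * \<kappa> (M - 1) j - ve (- M) j w * \<kappa> (- M - 1) j) \<le> 2 * (C / \<delta>\<^sup>2 / of_int M)" .
  qed
  also have "\<dots> = L / 2 / of_int M" using J_pos by (simp add: L_def)
  also have "\<dots> \<le> L / of_int M" using L0 M by (intro divide_right_mono) auto
  finally show ?thesis .
qed

text \<open>The wall is controlled only for \<open>M\<close> large in terms of \<open>w\<close>.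
  Comparing \<open>G N\<close> with \<open>G M\<close> and letting \<open>M\<close> grow leaves a
  bound that is uniform in \<open>w\<close>.\<close>

lemma G_approx_offgrid:
  assumes w: "w \<in> \<Omega>" "offgrid w" and N: "1 \<le> N"
  shows "norm (2 * pi * \<i> * F w - G N w) \<le> L / of_int N"
proof (rule field_le_epsilon)
  fix e :: real assume e: "0 < e"
  obtain M :: int where M: "max (of_int N) (max ((\<bar>Re w\<bar> + 1) / \<delta>) (L / e)) \<le> of_int M" using ex_le_of_int by blast
  have M1: "N \<le> M" "\<bar>Re w\<bar> + 1 \<le> \<delta> * of_int M" "L \<le> e * of_int M" using M \<delta> e by (auto simp: field_simps)
  have M0: "1 \<le> M" using N M1 by simp
  have "2 * pi * \<i> * F w - G N w = (G M w - G N w) + wall M w" using grid_sum[OF w(2,1) M1(2)] by simp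
  then have "norm (2 * pi * \<i> * F w - G N w) \<le> norm (G M w - G N w) + norm (wall M w)" by (simp only: norm_triangle_ineq)
  also have "\<dots> \<le> L * (1 / of_int N - 1 / of_int M) + L / of_int M"
    using G_tail[OF w(1) N M1(1)] wall_bound[OF M0 M1(2)] by linarith
  also have "\<dots> = L / of_int N" by (simp add: algebra_simps)
  finally show "norm (2 * pi * \<i> * F w - G N w) \<le> L / of_int N + e" using e by simp
qed

lemma offgrid_dense:
  assumes "open S" "w \<in> S" shows "\<exists>v\<in>S. offgrid v"
proof -
  obtain e where e: "0 < e" "ball w e \<subseteq> S" using assms open_contains_ball by blast
  have co: "countable (range (\<lambda>i::int. \<delta> * real_of_int i))" by simp
  have ex: "\<exists>x. t < x \<and> x < t + e / 2 \<and> x \<notin> range (\<lambda>i::int. \<delta> * real_of_int i)" for t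
  proof (rule ccontr)
    assume "\<not> ?thesis"
    then have "{t<..<t + e / 2} \<subseteq> range (\<lambda>i::int. \<delta> * real_of_int i)" by auto
    then have "countable {t<..<t + e / 2}" using co countable_subset by blast
    then show False using e uncountable_open_interval[of t "t + e / 2"] by simp
  qed
  obtain x where x: "Re w < x" "x < Re w + e / 2" "x \<notin> range (\<lambda>i::int. \<delta> * real_of_int i)" using ex by blast
  obtain y where y: "Im w < y" "y < Im w + e / 2" "y \<notin> range (\<lambda>i::int. \<delta> * real_of_int i)" using ex by blast
  have "dist w (Complex x y) \<le> \<bar>Re (w - Complex x y)\<bar> + \<bar>Im (w - Complex x y)\<bar>" unfolding dist_norm by (rule cmod_le)
  also have "\<dots> < e" using x y by simp
  finally have "Complex x y \<in> S" using e by auto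
  moreover have "offgrid (Complex x y)" using x(3) y(3) by (auto simp: offgrid_def)
  ultimately show ?thesis by blast
qed

section \<open>Edge integrals as multipliers\<close>

text \<open>The kernel \<open>1 / (\<zeta> - h z)\<close> is expanded around the midpoint
  \<open>m\<close> of the edge, where the ratio \<open>(\<zeta> - m) / (h z - m)\<close> is at most
  1/2. Integrating term by term gives polynomials in \<open>1 / (h z - m)\<close>, which are
  multipliers because \<open>m\<close> lies in \<open>U\<close>.\<close>

lemma edge_multiplier:
  assumes seg: "closed_segment c d \<subseteq> V" and len: "norm (d - c) = \<delta>"
    and far: "\<And>\<zeta> x. \<zeta> \<in> closed_segment c d \<Longrightarrow> x \<in> \<Omega> \<Longrightarrow> \<delta> < dist x \<zeta>"
  shows "multiplier (\<lambda>z. contour_integral (linepath c d) (\<lambda>\<zeta>. F \<zeta> / (\<zeta> - h z)))"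
proof -
  define m where "m = midpoint c d"
  have m_seg: "m \<in> closed_segment c d" by (simp add: m_def)
  have half: "norm (\<zeta> - m) \<le> \<delta> / 2" if "\<zeta> \<in> closed_segment c d" for \<zeta>
  proof -
    obtain t where t: "\<zeta> = (1 - t) *\<^sub>R c + t *\<^sub>R d" "0 \<le> t" "t \<le> 1"
      using \<open>\<zeta> \<in> closed_segment c d\<close> unfolding closed_segment_def by blast
    have "(1 - t) * u + t * v - (u + v) / 2 = (t - 1/2) * (v - u)" for u v :: real by (simp add: field_simps)
    then have "\<zeta> - m = (t - 1/2) *\<^sub>R (d - c)"
      unfolding t(1) m_def midpoint_def by (simp add: complex_eq_iff)
    then have "norm (\<zeta> - m) = \<bar>t - 1/2\<bar> * \<delta>" using len by (simp only: norm_scaleR)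
    also have "\<dots> \<le> 1/2 * \<delta>" using t \<delta> by (intro mult_right_mono) linarith+
    finally show ?thesis by simp
  qed
  have "m \<in> U"
  proof (rule ccontr)
    assume "m \<notin> U"
    then have "m \<in> closure \<Omega>" by (simp add: U_def)
    then obtain x where "x \<in> \<Omega>" "dist x m < \<delta>" using closure_approachable \<delta> by blast
    then show False using far[OF m_seg] by fastforce
  qed
  then have mm: "multiplier (\<lambda>z. 1 / (h z - m))" by (rule multiplier_pole)
  have C': "norm (F \<zeta>) \<le> C" if "\<zeta> \<in> V" for \<zeta>
  proof -
    have "C / (1 + \<bar>Re \<zeta>\<bar>)\<^sup>2 \<le> C / 1" using C0 by (intro divide_left_mono) (auto intro!: one_le_power)
    then show ?thesis using F_bound[OF that] by simp
  qed
  define s where "s n z \<zeta> = - (1 / (h z - m)) * (\<Sum>k<n. ((\<zeta> - m) * (1 / (h z - m))) ^ k)" for n z \<zeta>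
  have rem: "norm (1 / (\<zeta> - h z) - s n z \<zeta>) \<le> (1/2) ^ n / (\<delta> / 2)" and zn: "\<delta> \<le> norm (\<zeta> - h z)" if "\<zeta> \<in> closed_segment c d" and z: "z \<in> \<D>" for n z \<zeta>
  proof -
    have hm: "\<delta> < norm (h z - m)" using far[OF m_seg h_in_\<Omega>[OF z]] by (simp add: dist_norm)
    then have hm0: "h z - m \<noteq> 0" using \<delta> by auto
    show "\<delta> \<le> norm (\<zeta> - h z)" using far[OF that(1) h_in_\<Omega>[OF z]] by (simp add: dist_norm norm_minus_commute)
    then have hz0: "\<zeta> - h z \<noteq> 0" using \<delta> by auto
    define x where "x = (\<zeta> - m) * (1 / (h z - m))"
    have "norm x = norm (\<zeta> - m) / norm (h z - m)" by (simp add: x_def norm_mult norm_divide)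
    also have "\<dots> \<le> (\<delta> / 2) / \<delta>" using half[OF that(1)] hm \<delta> by (intro frac_le) auto
    finally have x: "norm x \<le> 1 / 2" using \<delta> by simp
    have "(h z - m) * x = \<zeta> - m" using hm0 by (simp add: x_def)
    then have "(h z - m) * (1 - x) = h z - \<zeta>" by (simp add: right_diff_distrib)
    then have e: "1 / (\<zeta> - h z) = - (1 / (h z - m)) * (1 / (1 - x))"
      by (metis minus_diff_eq divide_minus_right mult_minus_left mult_1 times_divide_times_eq)
    have "1 / (\<zeta> - h z) - s n z \<zeta> = - (1 / (h z - m)) * (1 / (1 - x) - (\<Sum>k<n. x ^ k))"
      unfolding e s_def x_def[symmetric] by (simp add: algebra_simps)
    then have "norm (1 / (\<zeta> - h z) - s n z \<zeta>) = (1 / norm (h z - m)) * norm (1 / (1 - x) - (\<Sum>k<n. x ^ k))"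
      by (simp only: norm_mult norm_minus_cancel norm_divide norm_one)
    also have "\<dots> \<le> (1 / \<delta>) * ((1/2) ^ n / (1 - 1/2))"
      using hm \<delta> geometric_remainder(1)[OF x, of n] by (intro mult_mono frac_le) auto
    finally show "norm (1 / (\<zeta> - h z) - s n z \<zeta>) \<le> (1/2) ^ n / (\<delta> / 2)" by simp
  qed
  define \<alpha> where "\<alpha> k = contour_integral (linepath c d) (\<lambda>\<zeta>. F \<zeta> * (\<zeta> - m) ^ k)" for k
  define S where "S n z = - (1 / (h z - m)) * (\<Sum>k<n. \<alpha> k * (1 / (h z - m)) ^ k)" for n z
  have ciF: "(\<lambda>\<zeta>. F \<zeta> * (\<zeta> - m) ^ k) contour_integrable_on linepath c d" for k
    by (intro contour_integrable_continuous_linepath continuous_intros F_cont seg)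
  have Sm: "multiplier (S n)" for n
    unfolding S_def using multiplier_cmult[OF mm, of "-1"]
    by (intro multiplier_mult multiplier_sum multiplier_cmult multiplier_power mm) auto
  have S_eq: "((\<lambda>\<zeta>. F \<zeta> * s n z \<zeta>) has_contour_integral S n z) (linepath c d)" for n z
  proof -
    have "((\<lambda>\<zeta>. - (1 / (h z - m)) * (\<Sum>k<n. (1 / (h z - m)) ^ k * (F \<zeta> * (\<zeta> - m) ^ k))) has_contour_integral
         - (1 / (h z - m)) * (\<Sum>k<n. (1 / (h z - m)) ^ k * \<alpha> k)) (linepath c d)"
      unfolding \<alpha>_def by (intro has_contour_integral_lmul has_contour_integral_sum has_contour_integral_integral ciF) auto
    moreover have "- (1 / (h z - m)) * (\<Sum>k<n. (1 / (h z - m)) ^ k * (F \<zeta> * (\<zeta> - m) ^ k)) = F \<zeta> * s n z \<zeta>" for \<zeta>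
      unfolding s_def by (simp only: sum_distrib_left power_mult_distrib mult_ac)
    ultimately show ?thesis unfolding S_def by (simp add: mult.commute)
  qed
  have ci: "(\<lambda>\<zeta>. F \<zeta> / (\<zeta> - h z)) contour_integrable_on linepath c d" if "z \<in> \<D>" for z
    using zn[OF _ that] \<delta> by (intro contour_integrable_continuous_linepath continuous_intros F_cont seg) fastforce
  show ?thesis
  proof (rule multiplier_uniform_limit)
    fix z assume z: "z \<in> \<D>"
    show "norm (contour_integral (linepath c d) (\<lambda>\<zeta>. F \<zeta> / (\<zeta> - h z))) \<le> C / \<delta> * norm (d - c)"
    proof (rule contour_integral_bound_linepath[OF ci[OF z]])
      show "norm (F \<zeta> / (\<zeta> - h z)) \<le> C / \<delta>" if "\<zeta> \<in> closed_segment c d" for \<zeta>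
        unfolding norm_divide using that zn[OF that z] seg C' C0 \<delta> by (intro frac_le) auto
    qed (use C0 \<delta> in auto)
  next
    fix e :: real assume e: "0 < e"
    obtain n where n: "(1/2) ^ n < e / (2 * (C + 1))" using real_arch_pow_inv[of "e / (2 * (C + 1))" "1/2"] e C0 by auto
    have "norm (contour_integral (linepath c d) (\<lambda>\<zeta>. F \<zeta> / (\<zeta> - h z)) - S n z) \<le> e" if z: "z \<in> \<D>" for z
    proof -
      have "((\<lambda>\<zeta>. F \<zeta> / (\<zeta> - h z) - F \<zeta> * s n z \<zeta>) has_contour_integral (contour_integral (linepath c d) (\<lambda>\<zeta>. F \<zeta> / (\<zeta> - h z)) - S n z)) (linepath c d)"
        by (intro has_contour_integral_diff has_contour_integral_integral ci z S_eq)
      then have "norm (contour_integral (linepath c d) (\<lambda>\<zeta>. F \<zeta> / (\<zeta> - h z)) - S n z) \<le> (C * ((1/2) ^ n / (\<delta> / 2))) * norm (d - c)"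
      proof (rule has_contour_integral_bound_linepath)
        fix \<zeta> assume \<zeta>: "\<zeta> \<in> closed_segment c d"
        have "F \<zeta> / (\<zeta> - h z) - F \<zeta> * s n z \<zeta> = F \<zeta> * (1 / (\<zeta> - h z) - s n z \<zeta>)" by (simp add: algebra_simps)
        then show "norm (F \<zeta> / (\<zeta> - h z) - F \<zeta> * s n z \<zeta>) \<le> C * ((1/2) ^ n / (\<delta> / 2))"
          using C' \<zeta> seg C0 by (simp only: norm_mult) (intro mult_mono rem[OF \<zeta> z], auto)
      qed (use C0 \<delta> in auto)
      also have "\<dots> = 2 * C * (1/2) ^ n" using len \<delta> by simp
      also have "\<dots> \<le> 2 * (C + 1) * (e / (2 * (C + 1)))" using n C0 by (intro mult_mono) auto
      also have "\<dots> = e" using C0 by (simp add: field_simps)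
      finally show ?thesis .
    qed
    then show "\<exists>m'. multiplier m' \<and> (\<forall>z\<in>\<D>. norm (contour_integral (linepath c d) (\<lambda>\<zeta>. F \<zeta> / (\<zeta> - h z)) - m' z) \<le> e)"
      using Sm by blast
  qed
qed

lemma T_multiplier: "multiplier (\<lambda>z. T i j (h z))"
proof -
  have "multiplier (\<lambda>z. ve i j (h z) * (\<kappa> (i - 1) j - \<kappa> i j))"
  proof (cases "\<kappa> (i - 1) j - \<kappa> i j = 0")
    case False
    have "multiplier (\<lambda>z. ve i j (h z))" unfolding ve_def
      by (rule edge_multiplier[OF v_edge(1)[OF False] norm_edge(1) v_edge(2)[OF False]])
    then show ?thesis by (intro multiplier_mult multiplier_const)
  qed (use multiplier_const[of 0] in simp)
  moreover have "multiplier (\<lambda>z. he i j (h z) * (\<kappa> i (j - 1) - \<kappa> i j))"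
  proof (cases "\<kappa> i (j - 1) - \<kappa> i j = 0")
    case False
    have "multiplier (\<lambda>z. he i j (h z))" unfolding he_def
      by (rule edge_multiplier[OF h_edge(1)[OF False] norm_edge(2) h_edge(2)[OF False]])
    then show ?thesis by (intro multiplier_mult multiplier_const)
  qed (use multiplier_const[of 0] in simp)
  ultimately show ?thesis unfolding T_def by (rule multiplier_diff)
qed

lemma G_multiplier: "multiplier (\<lambda>z. G N (h z))"
  unfolding G_def row_def by (intro multiplier_sum T_multiplier)

lemma \<Omega>_sub_V: "\<Omega> \<subseteq> V" using near \<delta> by (metis dist_self less_imp_le mult_pos_pos subsetI zero_less_numeral)

lemma runge_multiplier: "multiplier (\<lambda>z. F (h z))"
proof -
  have "h ` \<D> \<subseteq> V" using \<Omega>_sub_V by (simp add: \<Omega>_def)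
  then have Fh: "(\<lambda>z. F (h z)) holomorphic_on \<D>"
    using holomorphic_on_compose_gen[OF h_hol F] by (simp add: o_def)
  have approx: "norm (2 * pi * \<i> * F (h z) - G N (h z)) \<le> L / of_int N" if z: "z \<in> \<D>" and N: "1 \<le> N" for z N
  proof (rule ccontr)
    assume neg: "\<not> ?thesis"
    \<comment> \<open>A failure of the estimate would persist on an open subset of the disc. Its
      image under the injective map \<open>h\<close> is open, hence contains a point off the grid
      lines, where the estimate is known.\<close>
    define g where "g z = norm (2 * pi * \<i> * F (h z) - G N (h z))" for z
    have "continuous_on \<D> g" unfolding g_def
      by (intro continuous_intros holomorphic_on_imp_continuous_on Fh multiplierD(1) G_multiplier)
    then have "openin (top_of_set \<D>) (\<D> \<inter> g -` {L / of_int N<..})" by (intro continuous_openin_preimage_gen) auto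
    then have o: "open (\<D> \<inter> g -` {L / of_int N<..})" using openin_open_trans open_ball by blast
    have "open (h ` (\<D> \<inter> g -` {L / of_int N<..}))"
      by (rule open_mapping_thm3[OF holomorphic_on_subset[OF h_hol] o inj_on_subset[OF h_inj]]) auto
    moreover have "h z \<in> h ` (\<D> \<inter> g -` {L / of_int N<..})" using z neg by (auto simp: g_def)
    ultimately obtain v where v: "v \<in> h ` (\<D> \<inter> g -` {L / of_int N<..})" "offgrid v" using offgrid_dense by blast
    then obtain y where y: "y \<in> \<D>" "v = h y" "L / of_int N < g y" by auto
    have "g y \<le> L / of_int N" unfolding g_def using G_approx_offgrid[OF h_in_\<Omega>[OF y(1)] _ N] v y by simp
    with y(3) show False by simp
  qed
  show ?thesis
  proof (rule multiplier_uniform_limit[where K=C])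
    fix z assume "z \<in> \<D>"
    then have "h z \<in> V" using h_in_\<Omega> \<Omega>_sub_V by blast
    moreover have "C / (1 + \<bar>Re (h z)\<bar>)\<^sup>2 \<le> C / 1" using C0 by (intro divide_left_mono) (auto intro!: one_le_power)
    ultimately show "norm (F (h z)) \<le> C" using F_bound[of "h z"] by simp
  next
    fix e :: real assume e: "0 < e"
    obtain N :: int where N: "max 1 (L / e) \<le> of_int N" using ex_le_of_int by blast
    then have N1: "1 \<le> N" by auto
    have LN: "L / of_int N \<le> e" using N e N1 by (simp add: field_simps)
    have "norm (F (h z) - (1 / (2 * pi * \<i>)) * G N (h z)) \<le> e" if z: "z \<in> \<D>" for z
    proof -
      have "F (h z) - (1 / (2 * pi * \<i>)) * G N (h z) = (1 / (2 * pi * \<i>)) * (2 * pi * \<i> * F (h z) - G N (h z))"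
        by (simp add: field_simps)
      then have "norm (F (h z) - (1 / (2 * pi * \<i>)) * G N (h z)) = (1 / (2 * pi)) * norm (2 * pi * \<i> * F (h z) - G N (h z))"
        by (simp only: norm_mult norm_divide) simp
      also have "\<dots> \<le> 1 * norm (2 * pi * \<i> * F (h z) - G N (h z))"
      proof (rule mult_right_mono)
        show "1 / (2 * pi) \<le> 1" using pi_gt3 by simp
      qed simp
      also have "\<dots> \<le> e" using approx[OF z N1] LN by simp
      finally show ?thesis .
    qed
    then show "\<exists>m'. multiplier m' \<and> (\<forall>z\<in>\<D>. norm (F (h z) - m' z) \<le> e)"
      by (intro exI[of _ "\<lambda>z. (1 / (2 * pi * \<i>)) * G N (h z)"] conjI multiplier_cmult G_multiplier) auto
  qed
qed

end

section \<open>Kernel convergence\<close>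

lemma riemann_map_normalized:
  assumes "open S" "simply_connected S" "S \<noteq> UNIV" "w \<in> S"
  obtains f g where "f holomorphic_on S" "g holomorphic_on \<D>" "f ` S \<subseteq> \<D>" "g ` \<D> \<subseteq> S"
    "\<And>z. z \<in> S \<Longrightarrow> g (f z) = z" "\<And>z. z \<in> \<D> \<Longrightarrow> f (g z) = z" "f w = 0" "g 0 = w"
proof -
  have "S \<noteq> {}" using assms(4) by blast
  then have "\<exists>f g. f holomorphic_on S \<and> g holomorphic_on \<D> \<and> (\<forall>z\<in>S. f z \<in> \<D> \<and> g (f z) = z) \<and> (\<forall>z\<in>\<D>. g z \<in> S \<and> f (g z) = z)"
    using Riemann_mapping_theorem[of S] assms by blast
  then obtain f g where fg: "f holomorphic_on S" "g holomorphic_on \<D>" "\<And>z. z \<in> S \<Longrightarrow> f z \<in> \<D> \<and> g (f z) = z"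
      "\<And>z. z \<in> \<D> \<Longrightarrow> g z \<in> S \<and> f (g z) = z" by blast
  define u where "u = f w"
  have u: "norm u < 1" using fg(3)[OF assms(4)] by (simp add: u_def)
  let ?M = "Moebius_function 0 u" and ?N = "Moebius_function 0 (- u)"
  have M: "?M ` \<D> \<subseteq> \<D>" "?N ` \<D> \<subseteq> \<D>" using u Moebius_function_norm_lt_1[of u] Moebius_function_norm_lt_1[of "- u"] by auto
  have fS: "f ` S \<subseteq> \<D>" using fg(3) by blast
  have NM: "?N (?M z) = z" "?M (?N z) = z" if "z \<in> \<D>" for z
    using u that by (auto intro!: Moebius_function_compose)
  show ?thesis
  proof (rule that[of "?M \<circ> f" "g \<circ> ?N"])
    show "(?M \<circ> f) holomorphic_on S"
      by (rule holomorphic_on_compose_gen[OF fg(1) Moebius_function_holomorphic[OF u] fS])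
    show "(g \<circ> ?N) holomorphic_on \<D>"
      by (rule holomorphic_on_compose_gen[OF Moebius_function_holomorphic fg(2) M(2)]) (use u in simp)
    show "(?M \<circ> f) ` S \<subseteq> \<D>" using fS M(1) by (auto simp: image_subset_iff)
    show "(g \<circ> ?N) ` \<D> \<subseteq> S" using fg(4) M(2) by (auto simp: image_subset_iff)
    show "(g \<circ> ?N) ((?M \<circ> f) z) = z" if "z \<in> S" for z using NM(1)[of "f z"] fg(3)[OF that] by simp
    show "(?M \<circ> f) ((g \<circ> ?N) z) = z" if "z \<in> \<D>" for z
      using NM(2)[OF that] fg(4)[of "?N z"] M(2) that by (simp add: image_subset_iff)
    show "(?M \<circ> f) w = 0" by (simp add: u_def Moebius_function_eq_zero)
    then show "(g \<circ> ?N) 0 = w" using NM(1)[of "f w"] fg(3)[OF assms(4)] by (simp add: u_def)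
  qed
qed

context koenigs_strip
begin

section \<open>Neighbourhoods of the Koenigs domain\<close>

definition nbhd where "nbhd e = (\<Union>x\<in>\<Omega>. ball x e)"

lemma in_nbhd: "w \<in> nbhd e \<longleftrightarrow> (\<exists>x\<in>\<Omega>. dist x w < e)" by (auto simp: nbhd_def)

lemma h0_\<Omega>: "h 0 \<in> \<Omega>" by (rule h_in_\<Omega>) simp

lemma \<Omega>_nbhd: "0 < e \<Longrightarrow> \<Omega> \<subseteq> nbhd e" by (auto simp: nbhd_def)

lemma connected_\<Omega>: "connected \<Omega>"
  unfolding \<Omega>_def by (intro connected_continuous_image holomorphic_on_imp_continuous_on h_hol) auto

lemma nbhd_Im:
  assumes "w \<in> nbhd e" shows "a - e < Im w" "Im w < b + e"
proof -
  obtain x where x: "x \<in> \<Omega>" "dist x w < e" using assms by (auto simp: in_nbhd)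
  have "\<bar>Im (x - w)\<bar> < e" using x(2) abs_Im_le_cmod[of "x - w"] by (simp add: dist_norm)
  then show "a - e < Im w" "Im w < b + e" using \<Omega>_strip[OF x(1)] by auto
qed

lemma nbhd_shift:
  assumes "w \<in> nbhd e" "0 \<le> t" shows "w + of_real t \<in> nbhd e"
proof -
  obtain x where x: "x \<in> \<Omega>" "dist x w < e" using assms by (auto simp: in_nbhd)
  then show ?thesis using \<Omega>_shift[OF x(1) assms(2)] by (auto simp: in_nbhd dist_norm intro!: bexI[of _ "x + of_real t"])
qed

lemma open_nbhd: "open (nbhd e)" by (auto simp: nbhd_def)

text \<open>The neighbourhood is the sum of \<Omega> and a disc, hence connected. It is invariant
  under translation to the right, so each component of its complement contains a left ray and is
  unbounded.\<close>

lemma simply_connected_nbhd: "simply_connected (nbhd e)"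
proof -
  have "nbhd e = (\<lambda>(x, y). x + y) ` (\<Omega> \<times> ball 0 e)"
  proof (intro equalityI subsetI)
    fix w assume "w \<in> nbhd e"
    then obtain x where "x \<in> \<Omega>" "dist x w < e" by (auto simp: in_nbhd)
    then show "w \<in> (\<lambda>(x, y). x + y) ` (\<Omega> \<times> ball 0 e)"
      by (intro image_eqI[of _ _ "(x, w - x)"]) (auto simp: dist_norm norm_minus_commute)
  next
    fix w assume "w \<in> (\<lambda>(x, y). x + y) ` (\<Omega> \<times> ball 0 e)"
    then obtain x y where "x \<in> \<Omega>" "norm y < e" "w = x + y" by auto
    then show "w \<in> nbhd e" by (auto simp: in_nbhd dist_norm intro!: bexI[of _ x])
  qed
  moreover have "connected ((\<lambda>(x, y). x + y) ` (\<Omega> \<times> ball 0 e))"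
    by (intro connected_continuous_image connected_Times connected_\<Omega>)
      (auto simp: case_prod_unfold intro!: continuous_intros)
  ultimately have conn: "connected (nbhd e)" by simp
  have "\<not> bounded D" if D: "D \<in> components (- nbhd e)" for D
  proof
    assume "bounded D"
    then obtain K where K: "\<And>w. w \<in> D \<Longrightarrow> norm w \<le> K" by (auto simp: bounded_iff)
    obtain u where u: "u \<in> - nbhd e" "D = connected_component_set (- nbhd e) u" using D by (auto simp: components_def)
    define ray where "ray = (\<lambda>t. u - of_real t) ` {0..}"
    have "connected ray" unfolding ray_def by (intro connected_continuous_image continuous_intros) auto
    moreover have "ray \<subseteq> - nbhd e"
      unfolding ray_def using u(1) nbhd_shift[of "u - of_real t" e t for t] by force
    moreover have "u \<in> ray" unfolding ray_def by (auto intro!: image_eqI[of _ _ 0])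
    ultimately have "ray \<subseteq> D" unfolding u(2) by (intro connected_component_maximal)
    moreover have "u - of_real (norm u + \<bar>K\<bar> + 1) \<in> ray" unfolding ray_def by (rule imageI) simp
    ultimately have "u - of_real (norm u + \<bar>K\<bar> + 1) \<in> D" by blast
    then have "norm (u - of_real (norm u + \<bar>K\<bar> + 1)) \<le> K" by (rule K)
    moreover have "norm (complex_of_real (norm u + \<bar>K\<bar> + 1)) - norm u \<le> norm (u - of_real (norm u + \<bar>K\<bar> + 1))"
      by (metis norm_minus_commute norm_triangle_ineq2)
    moreover have "norm (complex_of_real (norm u + \<bar>K\<bar> + 1)) = norm u + \<bar>K\<bar> + 1" by (simp only: norm_of_real) simp
    ultimately show False by linarith
  qed
  then show ?thesis using conn simply_connected_eq_unbounded_complement_components[OF open_nbhd] by blast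
qed

lemma nbhd_ne_UNIV: "nbhd e \<noteq> UNIV"
  using nbhd_Im(2)[of "Complex 0 (b + e)" e] by force

lemma closure_from_nbhd:
  assumes lim: "X \<longlonglongrightarrow> x" and X: "\<And>n. X n \<in> nbhd (\<epsilon> n)" and \<epsilon>: "\<epsilon> \<longlonglongrightarrow> 0"
  shows "x \<in> closure \<Omega>"
  unfolding closure_approachable
proof (intro allI impI)
  fix e :: real assume e: "0 < e"
  have "\<forall>\<^sub>F n in sequentially. dist (X n) x < e / 2" using tendstoD[OF lim, of "e/2"] e by simp
  moreover have "\<forall>\<^sub>F n in sequentially. \<epsilon> n < e / 2" using order_tendstoD(2)[OF \<epsilon>, of "e/2"] e by simp
  ultimately obtain n where n: "dist (X n) x < e / 2" "\<epsilon> n < e / 2"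
    using eventually_happens[OF eventually_conj] by fastforce
  obtain y where "y \<in> \<Omega>" "dist y (X n) < \<epsilon> n" using X[of n] by (auto simp: in_nbhd)
  then show "\<exists>y\<in>\<Omega>. dist y x < e" using n dist_triangle[of y x "X n"] by (intro bexI[of _ y]) auto
qed

lemma deriv_h0: "deriv h 0 \<noteq> 0"
  by (rule holomorphic_injective_imp_regular[OF h_hol open_ball h_inj]) simp

text \<open>Kernel convergence of the neighbourhoods of \<open>\<Omega>\<close>: a limit of their Riemann maps has open image
  in the closure of \<open>\<Omega>\<close>, hence in \<open>\<Omega>\<close>, so Schwarz' lemma bounds its derivative at 0 from above.\<close>

lemma kernel_convergence:
  assumes \<eta>: "0 < \<eta>"
  shows "\<exists>e f. 0 < e \<and> e \<le> 1 \<and> f holomorphic_on nbhd e \<and> f ` nbhd e \<subseteq> \<D> \<and> f (h 0) = 0 \<and> 1 - \<eta> < norm (deriv (f \<circ> h) 0)"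
proof -
  define \<epsilon> where "\<epsilon> n = 1 / real (Suc n)" for n
  have \<epsilon>: "0 < \<epsilon> n" "\<epsilon> n \<le> 1" for n by (auto simp: \<epsilon>_def)
  have \<epsilon>0: "\<epsilon> \<longlonglongrightarrow> 0" unfolding \<epsilon>_def by (rule lim_inverse_n'[THEN LIMSEQ_Suc])
  define w where "w = h 0"
  have wN: "w \<in> nbhd (\<epsilon> n)" for n using \<Omega>_nbhd[OF \<epsilon>(1)] h0_\<Omega> by (auto simp: w_def)
  have "\<forall>n. \<exists>fg. fst fg holomorphic_on nbhd (\<epsilon> n) \<and> snd fg holomorphic_on \<D> \<and> fst fg ` nbhd (\<epsilon> n) \<subseteq> \<D> \<and> snd fg ` \<D> \<subseteq> nbhd (\<epsilon> n) \<and>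
      (\<forall>z\<in>nbhd (\<epsilon> n). snd fg (fst fg z) = z) \<and> (\<forall>z\<in>\<D>. fst fg (snd fg z) = z) \<and> fst fg w = 0 \<and> snd fg 0 = w"
  proof
    fix n
    obtain f g where "f holomorphic_on nbhd (\<epsilon> n)" "g holomorphic_on \<D>" "f ` nbhd (\<epsilon> n) \<subseteq> \<D>" "g ` \<D> \<subseteq> nbhd (\<epsilon> n)"
      "\<And>z. z \<in> nbhd (\<epsilon> n) \<Longrightarrow> g (f z) = z" "\<And>z. z \<in> \<D> \<Longrightarrow> f (g z) = z" "f w = 0" "g 0 = w"
      using riemann_map_normalized[OF open_nbhd simply_connected_nbhd nbhd_ne_UNIV wN] by metis
    then show "\<exists>fg. fst fg holomorphic_on nbhd (\<epsilon> n) \<and> snd fg holomorphic_on \<D> \<and> fst fg ` nbhd (\<epsilon> n) \<subseteq> \<D> \<and> snd fg ` \<D> \<subseteq> nbhd (\<epsilon> n) \<and>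
      (\<forall>z\<in>nbhd (\<epsilon> n). snd fg (fst fg z) = z) \<and> (\<forall>z\<in>\<D>. fst fg (snd fg z) = z) \<and> fst fg w = 0 \<and> snd fg 0 = w"
      by (intro exI[of _ "(f, g)"]) simp
  qed
  then obtain FG where FG: "\<And>n. fst (FG n) holomorphic_on nbhd (\<epsilon> n) \<and> snd (FG n) holomorphic_on \<D> \<and> fst (FG n) ` nbhd (\<epsilon> n) \<subseteq> \<D> \<and> snd (FG n) ` \<D> \<subseteq> nbhd (\<epsilon> n) \<and>
      (\<forall>z\<in>nbhd (\<epsilon> n). snd (FG n) (fst (FG n) z) = z) \<and> (\<forall>z\<in>\<D>. fst (FG n) (snd (FG n) z) = z) \<and> fst (FG n) w = 0 \<and> snd (FG n) 0 = w"
    using choice[of "\<lambda>n fg. fst fg holomorphic_on nbhd (\<epsilon> n) \<and> snd fg holomorphic_on \<D> \<and> fst fg ` nbhd (\<epsilon> n) \<subseteq> \<D> \<and> snd fg ` \<D> \<subseteq> nbhd (\<epsilon> n) \<and>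
      (\<forall>z\<in>nbhd (\<epsilon> n). snd fg (fst fg z) = z) \<and> (\<forall>z\<in>\<D>. fst fg (snd fg z) = z) \<and> fst fg w = 0 \<and> snd fg 0 = w"] by blast
  define f where "f n = fst (FG n)" for n
  define g where "g n = snd (FG n)" for n
  have f: "f n holomorphic_on nbhd (\<epsilon> n)" "f n ` nbhd (\<epsilon> n) \<subseteq> \<D>" "f n w = 0" for n using FG[of n] by (auto simp: f_def)
  have g: "g n holomorphic_on \<D>" "g n ` \<D> \<subseteq> nbhd (\<epsilon> n)" "g n 0 = w" for n using FG[of n] by (auto simp: g_def)
  have fg: "z \<in> \<D> \<Longrightarrow> f n (g n z) = z" for n z using FG[of n] by (auto simp: f_def g_def)
  have dh: "(h has_field_derivative deriv h 0) (at 0)"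
    by (rule holomorphic_derivI[OF h_hol]) auto
  have df: "(f n has_field_derivative deriv (f n) w) (at w)" for n
    by (rule holomorphic_derivI[OF f(1) open_nbhd wN])
  have dg: "(g n has_field_derivative deriv (g n) 0) (at 0)" for n
    by (rule holomorphic_derivI[OF g(1)]) auto
  have dfg: "deriv (f n) w * deriv (g n) 0 = 1" for n
  proof -
    have "((\<lambda>z. f n (g n z)) has_field_derivative deriv (f n) w * deriv (g n) 0) (at 0)"
      by (rule DERIV_chain2[OF _ dg]) (simp add: g(3) df)
    then have "((\<lambda>z. z) has_field_derivative deriv (f n) w * deriv (g n) 0) (at 0)"
      by (rule DERIV_cong_ev[THEN iffD1, rotated -1])
        (auto intro!: eventually_nhds_in_open[of "\<D>" 0, THEN eventually_mono] simp: fg)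
    then show ?thesis using DERIV_ident DERIV_unique by blast
  qed
  have dk: "deriv (f n \<circ> h) 0 = deriv (f n) w * deriv h 0" for n
    by (rule DERIV_imp_deriv, rule DERIV_chain) (auto simp: df[unfolded w_def] w_def dh)
  have k_le: "norm (deriv (f n \<circ> h) 0) \<le> 1" for n
  proof (rule Schwarz_Lemma(2)[where \<xi>=0])
    have sub: "h ` \<D> \<subseteq> nbhd (\<epsilon> n)" using \<Omega>_nbhd[OF \<epsilon>(1)] by (simp add: \<Omega>_def)
    show "(f n \<circ> h) holomorphic_on \<D>" by (rule holomorphic_on_compose_gen[OF h_hol f(1) sub])
    show "norm ((f n \<circ> h) z) < 1" if "norm z < 1" for z using f(2)[of n] sub that by (auto simp: image_subset_iff)
  qed (use f(3) in \<open>auto simp: w_def\<close>)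
  have dg_ge: "norm (deriv h 0) \<le> norm (deriv (g n) 0)" for n
  proof -
    have "norm (deriv h 0) = norm (deriv (f n \<circ> h) 0) * norm (deriv (g n) 0)"
      unfolding norm_mult[symmetric] dk using dfg[of n] by (simp add: mult_ac)
    also have "\<dots> \<le> 1 * norm (deriv (g n) 0)" by (intro mult_right_mono k_le) auto
    finally show ?thesis by simp
  qed
  \<comment> \<open>The maps \<open>g n\<close> need not be bounded. All their images lie below
    height \<open>b + 1\<close>, hence at distance at least 1 from \<open>c\<close>, so Montel's
    theorem applies to \<open>1 / (g n - c)\<close>.\<close>
  define c where "c = \<i> * of_real (b + 2)"
  have gc: "1 \<le> norm (g n z - c)" if "z \<in> \<D>" for n z
  proof -
    have "g n z \<in> nbhd (\<epsilon> n)" using g(2) that by blast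
    then have "Im (g n z) < b + 1" using nbhd_Im(2) \<epsilon>(2)[of n] by fastforce
    then have "1 \<le> \<bar>Im (g n z - c)\<bar>" by (simp add: c_def)
    then show ?thesis using abs_Im_le_cmod order_trans by blast
  qed
  have gc0: "g n z - c \<noteq> 0" if "z \<in> \<D>" for n z using gc[OF that, of n] by auto
  have "g 0 0 - c \<noteq> 0" by (rule gc0) simp
  then have wc: "w - c \<noteq> 0" by (simp only: g(3) not_False_eq_True)
  then have wc': "w \<noteq> c" by simp
  define H where "H n z = 1 / (g n z - c)" for n z
  have H_hol: "H n holomorphic_on \<D>" for n unfolding H_def by (intro holomorphic_intros g gc0)
  have H_bd: "norm (H n z) \<le> 1" if "z \<in> \<D>" for n z using gc[OF that] by (simp add: H_def norm_divide divide_le_eq)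
  have dH: "deriv (H n) 0 = - deriv (g n) 0 / (w - c)\<^sup>2" for n
    unfolding H_def by (rule DERIV_imp_deriv) (auto intro!: derivative_eq_intros dg simp: g(3) wc' power2_eq_square)
  obtain K r where K: "K holomorphic_on \<D>" "strict_mono (r :: nat \<Rightarrow> nat)" "\<And>z. z \<in> \<D> \<Longrightarrow> (\<lambda>n. H (r n) z) \<longlonglongrightarrow> K z"
    "\<And>S. compact S \<Longrightarrow> S \<subseteq> \<D> \<Longrightarrow> uniform_limit S (H \<circ> r) K sequentially"
  proof (rule Montel[of "\<D>" "{f. f holomorphic_on \<D> \<and> (\<forall>z\<in>\<D>. norm (f z) \<le> 1)}" H])
    show "\<exists>B. \<forall>h\<in>{f. f holomorphic_on \<D> \<and> (\<forall>z\<in>\<D>. norm (f z) \<le> 1)}. \<forall>z\<in>S. norm (h z) \<le> B" if "S \<subseteq> \<D>" for S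
      using that by (intro exI[of _ 1]) blast
  qed (use H_hol H_bd in auto)
  have lim_dH: "(\<lambda>n. deriv (H (r n)) 0) \<longlonglongrightarrow> deriv K 0"
  proof -
    have "uniform_limit (ball 0 (1/2)) (H \<circ> r) K sequentially"
      by (rule uniform_limit_on_subset[OF K(4)[of "cball 0 (1/2)"]]) auto
    moreover have "\<forall>\<^sub>F n in sequentially. (H \<circ> r) n holomorphic_on ball 0 (1/2)"
    proof (rule always_eventually, rule allI)
      fix n show "(H \<circ> r) n holomorphic_on ball 0 (1/2)"
        unfolding o_def by (rule holomorphic_on_subset[OF H_hol]) auto
    qed
    ultimately have "(\<lambda>n. (deriv ^^ 1) ((H \<circ> r) n) 0) \<longlonglongrightarrow> (deriv ^^ 1) K 0"
      by (rule higher_deriv_complex_uniform_limit) auto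
    then show ?thesis by (simp add: o_def)
  qed
  define c0 where "c0 = norm (deriv h 0) / (norm (w - c))\<^sup>2"
  have c0: "0 < c0" using deriv_h0 wc by (simp add: c0_def)
  have ndH: "norm (deriv (H n) 0) = norm (deriv (g n) 0) / (norm (w - c))\<^sup>2" for n
    by (simp add: dH norm_divide norm_power)
  have "c0 \<le> norm (deriv (H n) 0)" for n unfolding ndH c0_def using dg_ge by (intro divide_right_mono) auto
  \<comment> \<open>The lower bound for \<open>deriv (g n) 0\<close> survives in the limit and keeps
    \<open>K\<close> from being constant.\<close>
  then have lo: "c0 \<le> norm (deriv K 0)" by (intro LIMSEQ_le_const[OF tendsto_norm[OF lim_dH]]) auto
  have nonconst: "\<not> K constant_on \<D>"
  proof
    assume "K constant_on \<D>"
    then obtain y where "\<And>z. z \<in> \<D> \<Longrightarrow> K z = y" by (auto simp: constant_on_def)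
    then have "deriv K 0 = deriv (\<lambda>z. y) 0"
      by (intro deriv_cong_ev eventually_nhds_in_open[of "\<D>" 0, THEN eventually_mono]) auto
    then show False using lo c0 by simp
  qed
  \<comment> \<open>By Hurwitz's theorem the nonconstant limit of functions without zeros has no
    zeros, so it can be inverted to a limit \<open>h'\<close> of the maps
    \<open>g (r n)\<close>.\<close>
  have K0: "K z \<noteq> 0" if "z \<in> \<D>" for z
  proof (rule Hurwitz_no_zeros[where S="\<D>" and \<F>="H \<circ> r" and g=K])
    show "(H \<circ> r) n z \<noteq> 0" if "z \<in> \<D>" for n z using gc0[OF that] by (simp add: H_def)
  qed (use K H_hol nonconst that in auto)
  define h' where "h' z = 1 / K z + c" for z
  have h'_hol: "h' holomorphic_on \<D>" unfolding h'_def by (intro holomorphic_intros K K0)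
  have lim_g: "(\<lambda>n. g (r n) z) \<longlonglongrightarrow> h' z" if z: "z \<in> \<D>" for z
  proof -
    have "(\<lambda>n. 1 / H (r n) z + c) \<longlonglongrightarrow> h' z" unfolding h'_def by (intro tendsto_intros K z K0)
    then show ?thesis using gc0[OF z] by (simp add: H_def)
  qed
  have h'_cl: "h' ` \<D> \<subseteq> closure \<Omega>"
  proof
    fix y assume "y \<in> h' ` \<D>"
    then obtain z where z: "z \<in> \<D>" "y = h' z" by blast
    have "(\<lambda>n. \<epsilon> (r n)) \<longlonglongrightarrow> 0" using LIMSEQ_subseq_LIMSEQ[OF \<epsilon>0 K(2)] by (simp add: o_def)
    then show "y \<in> closure \<Omega>" unfolding z(2) using g(2) z(1)
      by (intro closure_from_nbhd[OF lim_g[OF z(1)], of "\<lambda>n. \<epsilon> (r n)"]) blast+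
  qed
  have "\<not> h' constant_on \<D>"
  proof
    assume "h' constant_on \<D>"
    then obtain y where y: "\<And>z. z \<in> \<D> \<Longrightarrow> h' z = y" by (auto simp: constant_on_def)
    have "K z = 1 / (y - c)" if "z \<in> \<D>" for z
    proof -
      have "y - c = 1 / K z" using y[OF that] unfolding h'_def by (metis add_diff_cancel_right')
      then show ?thesis by simp
    qed
    then show False using nonconst by (auto simp: constant_on_def)
  qed
  then have "open (h' ` \<D>)" by (intro open_mapping_thm[OF h'_hol]) auto
  then have h'_\<Omega>: "h' ` \<D> \<subseteq> h ` \<D>" using h'_cl interior_maximal[of "h' ` \<D>" "closure \<Omega>"] int_cl by (simp add: \<Omega>_def)
  have h'0: "h' 0 = w" using LIMSEQ_unique[OF lim_g[of 0]] g(3) by simp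
  obtain hi where hi: "hi holomorphic_on h ` \<D>" "\<And>z. z \<in> \<D> \<Longrightarrow> deriv h z * deriv hi (h z) = 1" "\<And>z. z \<in> \<D> \<Longrightarrow> hi (h z) = z"
    using holomorphic_has_inverse[OF h_hol open_ball h_inj] by metis
  have dh': "(h' has_field_derivative deriv h' 0) (at 0)" by (rule holomorphic_derivI[OF h'_hol]) auto
  have dhi: "(hi has_field_derivative deriv hi (h' 0)) (at (h' 0))"
    by (rule holomorphic_derivI[OF hi(1)]) (use open_\<Omega> h0_\<Omega> in \<open>auto simp: \<Omega>_def h'0 w_def\<close>)
  have "norm (deriv (hi \<circ> h') 0) \<le> 1"
  proof (rule Schwarz_Lemma(2)[where \<xi>=0])
    show "(hi \<circ> h') holomorphic_on \<D>" by (rule holomorphic_on_compose_gen[OF h'_hol hi(1) h'_\<Omega>])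
    show "(hi \<circ> h') 0 = 0" using hi(3)[of 0] by (simp add: h'0 w_def)
    show "norm ((hi \<circ> h') z) < 1" if z: "norm z < 1" for z
    proof -
      obtain y where "y \<in> \<D>" "h' z = h y" using h'_\<Omega> z by (force simp: image_subset_iff)
      then show ?thesis using hi(3)[of y] by simp
    qed
  qed simp
  moreover have "deriv (hi \<circ> h') 0 = deriv hi w * deriv h' 0"
    using DERIV_imp_deriv[OF DERIV_chain[OF dhi dh']] h'0 by simp
  moreover have "deriv h 0 * deriv hi w = 1" using hi(2)[of 0] by (simp add: w_def)
  ultimately have up: "norm (deriv h' 0) \<le> norm (deriv h 0)"
  proof -
    assume A: "norm (deriv (hi \<circ> h') 0) \<le> 1" "deriv (hi \<circ> h') 0 = deriv hi w * deriv h' 0" "deriv h 0 * deriv hi w = 1"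
    have "deriv h' 0 = deriv h 0 * deriv (hi \<circ> h') 0" using A(3) unfolding A(2) by (simp add: mult.assoc[symmetric])
    then have "norm (deriv h' 0) = norm (deriv h 0) * norm (deriv (hi \<circ> h') 0)" by (simp only: norm_mult)
    also have "\<dots> \<le> norm (deriv h 0) * 1" by (intro mult_left_mono A) auto
    finally show ?thesis by simp
  qed
  have Kw: "K 0 = 1 / (w - c)" using h'0 K0[of 0] by (auto simp: h'_def)
  have dK: "(K has_field_derivative deriv K 0) (at 0)" by (rule holomorphic_derivI[OF K(1)]) auto
  have "deriv h' 0 = - deriv K 0 / (K 0)\<^sup>2"
    unfolding h'_def using K0[of 0]
    by (intro DERIV_imp_deriv) (auto intro!: derivative_eq_intros dK simp: power2_eq_square)
  then have "norm (deriv h' 0) = norm (deriv K 0) * (norm (w - c))\<^sup>2"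
    by (simp add: Kw norm_divide norm_mult norm_power power_divide)
  then have "norm (deriv K 0) \<le> c0" using up wc by (simp add: c0_def field_simps)
  with lo have eq: "norm (deriv K 0) = c0" by simp
  \<comment> \<open>The upper and the lower bound have met, so these quotients tend to 1; they turn
    out to be the norms of the derivatives of \<open>f n \<circ> h\<close> at 0.\<close>
  have "(\<lambda>n. c0 / norm (deriv (H (r n)) 0)) \<longlonglongrightarrow> c0 / norm (deriv K 0)"
    using c0 eq by (intro tendsto_intros lim_dH) auto
  then have "(\<lambda>n. c0 / norm (deriv (H (r n)) 0)) \<longlonglongrightarrow> 1" using eq c0 by simp
  moreover have "c0 / norm (deriv (H n) 0) = norm (deriv (f n \<circ> h) 0)" for n
  proof -
    have g0: "deriv (g n) 0 \<noteq> 0" using dfg[of n] by auto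
    have "deriv (f n) w = 1 / deriv (g n) 0" using dfg[of n] g0 by (simp add: field_simps)
    then have "norm (deriv (f n \<circ> h) 0) = norm (deriv h 0) / norm (deriv (g n) 0)" unfolding dk by (simp add: norm_mult norm_divide)
    then show ?thesis unfolding ndH c0_def using wc by simp
  qed
  ultimately have "(\<lambda>n. norm (deriv (f (r n) \<circ> h) 0)) \<longlonglongrightarrow> 1" by simp
  then have "\<forall>\<^sub>F n in sequentially. 1 - \<eta> < norm (deriv (f (r n) \<circ> h) 0)" using \<eta> by (intro order_tendstoD(1)) auto
  then obtain n where "1 - \<eta> < norm (deriv (f (r n) \<circ> h) 0)" using eventually_happens by force
  then show ?thesis using f[of "r n"] \<epsilon>[of "r n"] by (intro exI[of _ "\<epsilon> (r n)"] exI[of _ "f (r n)"]) (auto simp: w_def)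
qed

end

section \<open>Completeness of the eigenfunctions\<close>

context koenigs_strip
begin

text \<open>\<open>f\<close> is bounded but need not decay. Multiplication by
  \<open>1 / (1 + \<i> * of_real \<eta> * w)\<^sup>2\<close> supplies the quadratic decay for the
  Runge grid, and this factor tends to 1 locally uniformly as \<eta> tends to 0.\<close>

lemma nbhd_multiplier:
  assumes e: "0 < e" "e \<le> 1" and f: "f holomorphic_on nbhd e" "f ` nbhd e \<subseteq> \<D>"
  shows "multiplier (\<lambda>z. f (h z))"
proof (rule multiplier_limit[where K=4])
  fix R \<epsilon> :: real assume \<epsilon>: "0 < \<epsilon>"
  define R' where "R' = \<bar>R\<bar> + 1"
  have R': "0 < R'" "R \<le> R'" by (auto simp: R'_def)
  have B0: "0 \<le> B" by (simp add: B_def)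
  \<comment> \<open>The first term keeps \<open>Re (1 + \<i> * of_real \<eta> * w)\<close> at least
    1/2 on the neighbourhood, whence the bound 4 for the inverse square. The other two make the
    factor close to 1 where \<open>norm (h z) \<le> R\<close>.\<close>
  define \<eta> where "\<eta> = min (1 / (2 * (B + 1))) (min (1 / R') (\<epsilon> / (12 * R')))"
  have \<eta>: "0 < \<eta>" "\<eta> \<le> 1 / (2 * (B + 1))" "\<eta> \<le> 1 / R'" "\<eta> \<le> \<epsilon> / (12 * R')"
    using B0 R' \<epsilon> by (auto simp: \<eta>_def)
  have \<eta>': "\<eta> * (B + 1) \<le> 1 / 2" "\<eta> * R' \<le> 1" "12 * (\<eta> * R') \<le> \<epsilon>"
    using \<eta> B0 R' by (auto simp: field_simps)
  define d where "d w = 1 + \<i> * of_real \<eta> * w" for w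
  have d_half: "1 / 2 \<le> norm (d w)" and d_Re: "\<eta> * \<bar>Re w\<bar> \<le> norm (d w)" if w: "w \<in> nbhd e" for w
  proof -
    have "\<bar>Im w\<bar> \<le> B + 1" using nbhd_Im[OF w] e by (auto simp: B_def)
    then have "\<eta> * Im w \<le> \<eta> * (B + 1)" using \<eta>(1) by (intro mult_left_mono) auto
    then have "1 / 2 \<le> Re (d w)" using \<eta>'(1) by (simp add: d_def)
    then show "1 / 2 \<le> norm (d w)" using complex_Re_le_cmod order_trans by blast
    have "\<eta> * \<bar>Re w\<bar> = \<bar>Im (d w)\<bar>" using \<eta>(1) by (simp add: d_def abs_mult)
    then show "\<eta> * \<bar>Re w\<bar> \<le> norm (d w)" using abs_Im_le_cmod by simp
  qed
  have d0: "d w \<noteq> 0" if "w \<in> nbhd e" for w using d_half[OF that] by auto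
  define F where "F w = f w * (1 / (d w)\<^sup>2)" for w
  have fb: "norm (f w) \<le> 1" if "w \<in> nbhd e" for w using f(2) that by (force simp: image_subset_iff)
  \<comment> \<open>The mesh \<open>e / 5\<close> makes \<open>4 * (e / 5) < e\<close>. The decay
    constant comes from
    \<open>1 + \<bar>Re w\<bar> \<le> (2 + 1 / \<eta>) * norm (d w)\<close>.\<close>
  have "runge_grid p a b h F (nbhd e) (e / 5) ((2 + 1 / \<eta>)\<^sup>2)"
  proof (unfold_locales)
    show "F holomorphic_on nbhd e" unfolding F_def d_def using d0 by (intro holomorphic_intros f) (auto simp: d_def)
    show "w \<in> nbhd e" if "x \<in> \<Omega>" "dist x w \<le> 4 * (e / 5)" for x w
      using that e by (auto simp: in_nbhd intro!: bexI[of _ x])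
    show "norm (F w) \<le> (2 + 1 / \<eta>)\<^sup>2 / (1 + \<bar>Re w\<bar>)\<^sup>2" if w: "w \<in> nbhd e" for w
    proof -
      have "1 \<le> 2 * norm (d w)" using d_half[OF w] by simp
      moreover have "\<bar>Re w\<bar> \<le> 1 / \<eta> * norm (d w)" using d_Re[OF w] \<eta>(1) by (simp add: field_simps)
      ultimately have le: "1 + \<bar>Re w\<bar> \<le> (2 + 1 / \<eta>) * norm (d w)" by (simp add: algebra_simps)
      have "norm (F w) \<le> 1 * (1 / norm (d w)) ^ 2"
        unfolding F_def norm_mult norm_divide norm_power norm_one power_one_over
        by (intro mult_right_mono fb[OF w]) auto
      also have "1 / norm (d w) \<le> (2 + 1 / \<eta>) / (1 + \<bar>Re w\<bar>)"
      proof -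
        have "0 < 1 + \<bar>Re w\<bar>" "0 < norm (d w)" using d_half[OF w] by linarith+
        then show ?thesis using le by (simp only: pos_le_divide_eq pos_divide_le_eq times_divide_eq_left mult_1)
      qed
      then have "1 * (1 / norm (d w)) ^ 2 \<le> ((2 + 1 / \<eta>) / (1 + \<bar>Re w\<bar>))\<^sup>2" by (simp add: power_mono)
      finally show ?thesis by (simp add: power_divide)
    qed
  qed (use e in auto)
  then have m: "multiplier (\<lambda>z. F (h z))" by (rule runge_grid.runge_multiplier)
  have hN: "h z \<in> nbhd e" if "z \<in> \<D>" for z using \<Omega>_nbhd[OF e(1)] h_in_\<Omega>[OF that] by blast
  have inv4: "1 / (norm (d w))\<^sup>2 \<le> 4" if "w \<in> nbhd e" for w
  proof -
    have "(1/2)\<^sup>2 \<le> (norm (d w))\<^sup>2" using d_half[OF that] by (intro power_mono) auto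
    then show ?thesis using d0[OF that] by (simp add: divide_le_eq power2_eq_square)
  qed
  have "norm (F (h z)) \<le> 4" if "z \<in> \<D>" for z
  proof -
    have "norm (F (h z)) = norm (f (h z)) * (1 / (norm (d (h z)))\<^sup>2)" by (simp add: F_def norm_mult norm_divide norm_power)
    also have "\<dots> \<le> 1 * 4" using fb[OF hN[OF that]] inv4[OF hN[OF that]] by (intro mult_mono) auto
    finally show ?thesis by simp
  qed
  moreover have "norm (f (h z) - F (h z)) \<le> \<epsilon>" if z: "z \<in> \<D>" and hR: "norm (h z) \<le> R" for z
  proof -
    define x where "x = \<i> * of_real \<eta> * h z"
    have dx: "d (h z) = 1 + x" by (simp add: d_def x_def)
    have x: "norm x \<le> \<eta> * R'" using hR R' \<eta>(1) by (auto simp: x_def norm_mult)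
    have x1: "norm x \<le> 1" using x \<eta>'(2) by simp
    have "f (h z) - F (h z) = f (h z) * ((2 * x + x * x) * (1 / (d (h z))\<^sup>2))"
    proof -
      have eq: "2 * x + x * x = (d (h z))\<^sup>2 - 1" unfolding dx by (simp add: power2_eq_square algebra_simps)
      show ?thesis unfolding eq F_def using d0[OF hN[OF z]] by (simp add: field_simps)
    qed
    then have "norm (f (h z) - F (h z)) = norm (f (h z)) * (norm (2 * x + x * x) * (1 / (norm (d (h z)))\<^sup>2))"
      by (simp only: norm_mult norm_divide norm_power norm_one)
    also have "\<dots> \<le> 1 * ((3 * (\<eta> * R')) * 4)"
    proof (intro mult_mono fb hN z inv4)
      have "norm (2 * x + x * x) \<le> 2 * norm x + norm x * norm x"
        using norm_triangle_ineq[of "2 * x" "x * x"] by (simp add: norm_mult)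
      also have "norm x * norm x \<le> 1 * norm x" using x1 by (intro mult_right_mono) auto
      finally show "norm (2 * x + x * x) \<le> 3 * (\<eta> * R')" using x by simp
    qed (use \<eta>(1) R' in auto)
    also have "\<dots> \<le> \<epsilon>" using \<eta>'(3) by simp
    finally show ?thesis .
  qed
  ultimately show "\<exists>m'. multiplier m' \<and> (\<forall>z\<in>\<D>. norm (m' z) \<le> 4) \<and> (\<forall>z\<in>\<D>. norm (h z) \<le> R \<longrightarrow> norm (f (h z) - m' z) \<le> \<epsilon>)"
    using m by blast
qed

end

text \<open>A self-map of the disc fixing 0 whose derivative there is close to 1 is close to the identity:
  writing \<open>k z = z * q z\<close>, the function \<open>\<bar>1 - q\<bar>\<^sup>2 \<le> Re (2 - 2 * q)\<close> has small mean.\<close>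

lemma Schwarz_almost_identity:
  assumes p: "1 \<le> p" and e: "0 < e"
  shows "\<exists>\<eta>>0. \<forall>k. k holomorphic_on \<D> \<and> k ` \<D> \<subseteq> \<D> \<and> k 0 = 0 \<and> 1 - \<eta> < Re (deriv k 0) \<longrightarrow>
     Hp_norm p (zext (\<lambda>z. z - k z)) \<le> e"
proof -
  define E1 where "E1 = e powr p"
  have E1: "0 < E1" using e by (simp add: E1_def)
  define s where "s = (E1 / (4 * pi)) powr (1 / p)"
  have s: "0 < s" "2 * pi * s powr p = E1 / 2" using E1 p by (auto simp: s_def powr_powr)
  define \<eta> where "\<eta> = E1 * s\<^sup>2 / (8 * pi * 2 powr p)"
  have \<eta>: "0 < \<eta>" using E1 s by (simp add: \<eta>_def)
  have \<eta>2: "2 powr p / s\<^sup>2 * (4 * pi * \<eta>) = E1 / 2" using s by (simp add: \<eta>_def field_simps)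
  \<comment> \<open>Reduces the mean of order \<open>p\<close> to the quadratic one. For
    \<open>t \<le> s\<close> the first term suffices; otherwise
    \<open>t powr p \<le> 2 powr p\<close> and \<open>t\<^sup>2 / s\<^sup>2 \<ge> 1\<close>. The
    choices of \<open>s\<close> and \<eta> give each term half of the admissible total.\<close>
  have pw: "t powr p \<le> s powr p + 2 powr p / s\<^sup>2 * t\<^sup>2" if t: "0 \<le> t" "t \<le> 2" for t
  proof (cases "t \<le> s")
    case True
    then have "t powr p \<le> s powr p" using t p by (intro powr_mono2) auto
    moreover have "0 \<le> 2 powr p / s\<^sup>2 * t\<^sup>2" by simp
    ultimately show ?thesis by linarith
  next
    case False
    have "t powr p \<le> 2 powr p * 1" using t p powr_mono2[of p t 2] by simp
    also have "\<dots> \<le> 2 powr p * (t\<^sup>2 / s\<^sup>2)"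
      using False s by (intro mult_left_mono) (auto simp: le_divide_eq intro!: power_mono)
    finally show ?thesis by (simp add: add_increasing)
  qed
  have "Hp_norm p (zext (\<lambda>z. z - k z)) \<le> e"
    if k: "k holomorphic_on \<D>" "k ` \<D> \<subseteq> \<D>" "k 0 = 0" "1 - \<eta> < Re (deriv k 0)" for k
  proof (rule Hp_norm_leI)
    fix r :: real assume r: "0 < r" "r < 1"
    obtain q where q: "q holomorphic_on \<D>" "\<And>z. norm z < 1 \<Longrightarrow> k z = z * q z" "deriv k 0 = q 0"
      using Schwarz3[OF k(1,3)] by blast
    have k1: "norm (k z) < 1" if "norm z < 1" for z using k(2) that by (auto simp: image_subset_iff)
    have q1: "norm (q z) \<le> 1" if z: "norm z < 1" for z
    proof (cases "z = 0")
      case True then show ?thesis using Schwarz_Lemma(2)[OF k(1,3) k1, of 0] q(3) by simp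
    next
      case False
      have "norm z * norm (q z) \<le> norm z * 1"
        using Schwarz_Lemma(1)[OF k(1,3) k1 z] q(2)[OF z] by (simp add: norm_mult)
      then show ?thesis using False by simp
    qed
    have "(\<lambda>z. 2 - 2 * q z) holomorphic_on cball 0 r"
      by (intro holomorphic_intros holomorphic_on_subset[OF q(1)]) (use r in auto)
    from has_integral_Re[OF circle_mean_value[OF this r(1)]]
    have I: "((\<lambda>t. Re (2 - 2 * q (of_real r * cis t))) has_integral Re (of_real (2 * pi) * (2 - 2 * q 0))) {0..2*pi}" .
    have I': "((\<lambda>t. s powr p + 2 powr p / s\<^sup>2 * Re (2 - 2 * q (of_real r * cis t))) has_integral
        (2 * pi * s powr p + 2 powr p / s\<^sup>2 * Re (of_real (2 * pi) * (2 - 2 * q 0)))) {0..2*pi}"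
      using has_integral_add[OF has_integral_const_real[of "s powr p" 0 "2*pi"] has_integral_mult_right[OF I, of "2 powr p / s\<^sup>2"]] by simp
    have hol: "zext (\<lambda>z. z - k z) holomorphic_on \<D>" by (intro zext_holomorphic holomorphic_intros k)
    have "Hp_mean p (zext (\<lambda>z. z - k z)) r \<le> integral {0..2*pi} (\<lambda>t. s powr p + 2 powr p / s\<^sup>2 * Re (2 - 2 * q (of_real r * cis t)))"
      unfolding Hp_mean_def
    proof (rule integral_le)
      show "(\<lambda>t. norm (zext (\<lambda>z. z - k z) (of_real r * cis t)) powr p) integrable_on {0..2*pi}"
        using p r by (intro Hp_mean_integrable hol) auto
      show "(\<lambda>t. s powr p + 2 powr p / s\<^sup>2 * Re (2 - 2 * q (of_real r * cis t))) integrable_on {0..2*pi}"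
        using I' by blast
      fix t
      define z where "z = of_real r * cis t"
      have z: "norm z < 1" using r by (simp add: z_def norm_mult)
      have zk: "norm (z - k z) \<le> 2" using norm_triangle_ineq4[of z "k z"] k1[OF z] z by linarith
      have "z - k z = z * (1 - q z)" using q(2)[OF z] by (simp add: algebra_simps)
      then have "(norm (z - k z))\<^sup>2 = (norm z)\<^sup>2 * (norm (1 - q z))\<^sup>2" by (simp add: norm_mult power_mult_distrib)
      also have "\<dots> \<le> 1 * (norm (1 - q z))\<^sup>2" using z by (intro mult_right_mono) (auto simp: power_le_one)
      also have "(norm (1 - q z))\<^sup>2 = 1 + (norm (q z))\<^sup>2 - 2 * Re (q z)"
        unfolding cmod_power2 by (simp add: power2_eq_square algebra_simps)
      also have "(norm (q z))\<^sup>2 \<le> 1" using q1[OF z] by (simp add: power_le_one)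
      finally have n2: "(norm (z - k z))\<^sup>2 \<le> Re (2 - 2 * q z)" by simp
      have "norm (z - k z) powr p \<le> s powr p + 2 powr p / s\<^sup>2 * (norm (z - k z))\<^sup>2" by (rule pw[OF norm_ge_zero zk])
      also have "\<dots> \<le> s powr p + 2 powr p / s\<^sup>2 * Re (2 - 2 * q z)" using n2 by (intro add_left_mono mult_left_mono) auto
      finally show "norm (zext (\<lambda>z. z - k z) (of_real r * cis t)) powr p \<le> s powr p + 2 powr p / s\<^sup>2 * Re (2 - 2 * q (of_real r * cis t))"
        using z by (simp add: z_def[symmetric])
    qed
    also have "\<dots> = E1 / 2 + 2 powr p / s\<^sup>2 * (4 * pi * (1 - Re (q 0)))"
      using I' s(2) by (simp add: integral_unique algebra_simps)
    also have "\<dots> \<le> E1 / 2 + 2 powr p / s\<^sup>2 * (4 * pi * \<eta>)"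
      using k(4) q(3) by (intro add_left_mono mult_left_mono) auto
    also have "\<dots> = e powr p" unfolding \<eta>2 by (simp add: E1_def)
    finally show "Hp_mean p (zext (\<lambda>z. z - k z)) r \<le> e powr p" .
  qed (use p e in auto)
  then show ?thesis using \<eta> by blast
qed

context koenigs_strip
begin

text \<open>\<open>z ^ n\<close> is approximated by \<open>k z ^ n\<close>, where \<open>k\<close>
  is a rotated map from \<open>kernel_convergence\<close>. The powers of \<open>k\<close> are
  multipliers, and applied to \<open>ef 0\<close>, the constant 1 on the disc, they stay in
  \<open>E\<close>.\<close>

lemma monomial_E: "zext (\<lambda>z. z ^ n) \<in> E"
proof (rule exp_span.limit)
  have bd: "norm (zext (\<lambda>z. z ^ n) z) \<le> 1" if "z \<in> \<D>" for z using that by (simp add: norm_power power_le_one)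
  show zn: "zext (\<lambda>z. z ^ n) \<in> Hp p"
    by (rule Hp_bounded[OF p1(2) _ _ bd]) (auto intro!: zext_holomorphic holomorphic_intros)
  show "\<forall>e>0. \<exists>g. g \<in> E \<and> Hp_norm p (\<lambda>z. zext (\<lambda>z. z ^ n) z - g z) < e"
  proof (intro allI impI)
    fix e :: real assume e: "0 < e"
    define e1 where "e1 = e / (2 * (real n + 1))"
    have e1: "0 < e1" using e by (simp add: e1_def)
    obtain \<eta> where \<eta>: "0 < \<eta>" "\<And>k. k holomorphic_on \<D> \<Longrightarrow> k ` \<D> \<subseteq> \<D> \<Longrightarrow> k 0 = 0 \<Longrightarrow> 1 - \<eta> < Re (deriv k 0) \<Longrightarrow>
       Hp_norm p (zext (\<lambda>z. z - k z)) \<le> e1"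
      using Schwarz_almost_identity[OF p1(1) e1] by blast
    obtain d f where f: "0 < d" "d \<le> 1" "f holomorphic_on nbhd d" "f ` nbhd d \<subseteq> \<D>" "f (h 0) = 0" "1 - min \<eta> 1 < norm (deriv (f \<circ> h) 0)"
      using kernel_convergence[of "min \<eta> 1"] \<eta>(1) by auto
    define D where "D = deriv (f \<circ> h) 0"
    have D0: "D \<noteq> 0" using f(6) by (auto simp: D_def)
    \<comment> \<open>The rotation that makes the derivative at 0 positive, since
      \<open>Schwarz_almost_identity\<close> needs its real part to be close to 1.\<close>
    define c where "c = cnj D / of_real (norm D)"
    have c1: "norm c = 1" using D0 by (simp add: c_def norm_divide)
    have cD: "c * D = of_real (norm D)"
      using D0 by (simp add: c_def mult.commute[of "cnj D"] complex_norm_square[symmetric] power2_eq_square)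
    define k where "k z = c * f (h z)" for z
    have sub: "h ` \<D> \<subseteq> nbhd d" using \<Omega>_nbhd[OF f(1)] by (simp add: \<Omega>_def)
    have fh: "(f \<circ> h) holomorphic_on \<D>" by (rule holomorphic_on_compose_gen[OF h_hol f(3) sub])
    have k: "k holomorphic_on \<D>" "k ` \<D> \<subseteq> \<D>" "k 0 = 0"
      using holomorphic_on_mult[OF holomorphic_on_const fh, of c] f(4,5) sub c1
      by (auto simp: k_def[abs_def] o_def norm_mult image_subset_iff)
    have "((f \<circ> h) has_field_derivative D) (at 0)" unfolding D_def by (rule holomorphic_derivI[OF fh]) auto
    from DERIV_cmult[OF this, of c] have dk: "deriv k 0 = of_real (norm D)"
      unfolding cD by (intro DERIV_imp_deriv) (simp add: k_def[abs_def] o_def)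
    have close: "Hp_norm p (zext (\<lambda>z. z - k z)) \<le> e1" by (rule \<eta>(2)[OF k]) (use f(6) dk in \<open>simp add: D_def\<close>)
    have km: "multiplier (\<lambda>z. k z ^ n)" unfolding k_def by (intro multiplier_power multiplier_cmult nbhd_multiplier[OF f(1-4)])
    define g where "g z = k z ^ n * ef 0 z" for z
    have gE: "g \<in> E" unfolding g_def by (rule multiplierD(3)[OF km ef_E]) (simp add: s0_pos)
    have zk: "zext (\<lambda>z. z - k z) \<in> Hp p"
    proof (rule Hp_bounded[OF p1(2), where K=2])
      show "norm (zext (\<lambda>z. z - k z) z) \<le> 2" if "z \<in> \<D>" for z
        using that k(2) norm_triangle_ineq4[of z "k z"] by (force simp: image_subset_iff)
    qed (auto intro!: zext_holomorphic holomorphic_intros k)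
    have "Hp_norm p (\<lambda>z. zext (\<lambda>z. z ^ n) z - g z) \<le> real n * Hp_norm p (zext (\<lambda>z. z - k z))"
    proof (rule Hp_dominated1(2)[OF p1(1) _ _ zk])
      show "(\<lambda>z. zext (\<lambda>z. z ^ n) z - g z) holomorphic_on \<D>"
        by (intro holomorphic_on_diff HpD(1)[OF zn] HpD(1)[OF E_Hp[OF gE]])
      show "norm (zext (\<lambda>z. z ^ n) z - g z) \<le> real n * norm (zext (\<lambda>z. z - k z) z)" if z: "z \<in> \<D>" for z
      proof -
        have "norm (z ^ n - k z ^ n) \<le> real n * norm (z - k z)"
          using z k(2) by (intro norm_power_diff) (auto simp: image_subset_iff less_imp_le)
        then show ?thesis using z by (simp add: g_def ef_def)
      qed
    qed (auto simp: g_def ef_def)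
    also have "\<dots> \<le> real n * e1" using close by (intro mult_left_mono) auto
    also have "\<dots> \<le> (real n + 1) * e1" using e1 by (intro mult_right_mono) auto
    also have "\<dots> = e / 2" unfolding e1_def by (simp add: divide_simps)
    also have "\<dots> < e" using e by simp
    finally show "\<exists>g. g \<in> E \<and> Hp_norm p (\<lambda>z. zext (\<lambda>z. z ^ n) z - g z) < e" using gE by blast
  qed
qed

lemma E_zero: "(\<lambda>z. 0) \<in> E"
  using exp_span.scale[OF monomial_E[of 0], of 0] by simp

lemma E_sum: "(\<And>i. i \<in> I \<Longrightarrow> f i \<in> E) \<Longrightarrow> (\<lambda>z. \<Sum>i\<in>I. f i z) \<in> E"
  by (induction I rule: infinite_finite_induct) (auto intro: E_zero exp_span.add)

lemma E_eq_Hp: "E = Hp p"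
proof (intro equalityI subsetI)
  fix f assume f: "f \<in> Hp p"
  have poly: "zext (poly q) \<in> E" for q
  proof -
    have "(\<lambda>z. \<Sum>i\<le>degree q. coeff q i * zext (\<lambda>z. z ^ i) z) \<in> E"
      by (intro E_sum exp_span.scale monomial_E)
    moreover have "(\<lambda>z. \<Sum>i\<le>degree q. coeff q i * zext (\<lambda>z. z ^ i) z) = zext (poly q)"
      by (auto simp: fun_eq_iff zext_def poly_altdef)
    ultimately show ?thesis by simp
  qed
  show "f \<in> E"
    by (rule exp_span.limit[OF f]) (use Hp_poly_dense[OF p f] poly in blast)
qed (rule E_Hp)

end

section \<open>Bounded operators and the weak operator topology\<close>

lemma bounded_opsD:
  assumes "A \<in> bounded_ops X N"
  shows "f \<in> X \<Longrightarrow> A f \<in> X"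
    "f \<in> X \<Longrightarrow> g \<in> X \<Longrightarrow> A (\<lambda>z. f z + g z) = (\<lambda>z. A f z + A g z)"
    "f \<in> X \<Longrightarrow> A (\<lambda>z. c * f z) = (\<lambda>z. c * A f z)"
  using assms by (auto simp: bounded_ops_def)

lemma bounded_ops_bound:
  assumes "A \<in> bounded_ops (Hp p) (Hp_norm p)"
  shows "\<exists>K\<ge>0. \<forall>f\<in>Hp p. Hp_norm p (A f) \<le> K * Hp_norm p f"
proof -
  obtain K where K: "\<forall>f\<in>Hp p. Hp_norm p (A f) \<le> K * Hp_norm p f" using assms by (auto simp: bounded_ops_def)
  have "Hp_norm p (A f) \<le> \<bar>K\<bar> * Hp_norm p f" if "f \<in> Hp p" for f
    using K that mult_right_mono[of K "\<bar>K\<bar>" "Hp_norm p f"] Hp_norm_nonneg[of p f] by force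
  then show ?thesis by (intro exI[of _ "\<bar>K\<bar>"]) auto
qed

text \<open>The upper estimate, used for \<open>c\<close> and for \<open>inverse c\<close>.\<close>

lemma Hp_norm_cmult:
  assumes "1 \<le> p" "f \<in> Hp p" shows "Hp_norm p (\<lambda>z. c * f z) = norm c * Hp_norm p f"
proof (cases "c = 0")
  case True
  have "Hp_norm p (\<lambda>z. 0 * f z) \<le> norm (0::complex) * Hp_norm p f" by (rule Hp_cmult(2)[OF assms])
  then show ?thesis using True Hp_norm_nonneg[of p "\<lambda>z. 0 * f z"] by simp
next
  case False
  have "Hp_norm p f = Hp_norm p (\<lambda>z. inverse c * (c * f z))" using False by (simp add: mult.assoc[symmetric])
  also have "\<dots> \<le> norm (inverse c) * Hp_norm p (\<lambda>z. c * f z)" by (intro Hp_cmult assms)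
  finally have "norm c * Hp_norm p f \<le> norm c * (norm (inverse c) * Hp_norm p (\<lambda>z. c * f z))" by (rule mult_left_mono) simp
  also have "\<dots> = Hp_norm p (\<lambda>z. c * f z)" using False by (simp add: norm_inverse)
  finally show ?thesis using Hp_cmult(2)[OF assms, of c] by simp
qed

lemma Hp_sum:
  assumes "1 \<le> p" shows "(\<And>i. i \<in> I \<Longrightarrow> f i \<in> Hp p) \<Longrightarrow> (\<lambda>z. \<Sum>i\<in>I. f i z) \<in> Hp p"
  by (induction I rule: infinite_finite_induct) (auto intro: Hp_zero Hp_add(1)[OF assms])

lemma bounded_ops_sum:
  assumes A: "A \<in> bounded_ops (Hp p) (Hp_norm p)" and p: "1 \<le> p" and f: "finite I" "\<And>i. i \<in> I \<Longrightarrow> f i \<in> Hp p"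
  shows "A (\<lambda>z. \<Sum>i\<in>I. c i * f i z) = (\<lambda>z. \<Sum>i\<in>I. c i * A (f i) z)"
  using f
proof (induction I rule: finite_induct)
  case empty
  have "A (\<lambda>z. 0 * 0) = (\<lambda>z. 0 * A (\<lambda>z. 0) z)" by (rule bounded_opsD(3)[OF A Hp_zero])
  then show ?case by simp
next
  case (insert i I)
  have "A (\<lambda>z. c i * f i z + (\<Sum>i\<in>I. c i * f i z)) = (\<lambda>z. A (\<lambda>z. c i * f i z) z + A (\<lambda>z. \<Sum>i\<in>I. c i * f i z) z)"
    using insert.prems by (intro bounded_opsD(2)[OF A] Hp_cmult Hp_sum p) auto
  then show ?case using insert bounded_opsD(3)[OF A, of "f i" "c i"] by simp
qed

lemma bounded_ops_power:
  assumes A: "A \<in> bounded_ops (Hp p) (Hp_norm p)"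
  shows "f \<in> Hp p \<Longrightarrow> (A ^^ n) f \<in> Hp p"
    "f \<in> Hp p \<Longrightarrow> g \<in> Hp p \<Longrightarrow> (A ^^ n) (\<lambda>z. f z + g z) = (\<lambda>z. (A ^^ n) f z + (A ^^ n) g z)"
    "f \<in> Hp p \<Longrightarrow> (A ^^ n) (\<lambda>z. c * f z) = (\<lambda>z. c * (A ^^ n) f z)"
    "\<exists>K\<ge>0. \<forall>f\<in>Hp p. Hp_norm p ((A ^^ n) f) \<le> K * Hp_norm p f"
proof -
  show in_Hp: "f \<in> Hp p \<Longrightarrow> (A ^^ n) f \<in> Hp p" for f n by (induction n) (auto intro: bounded_opsD(1)[OF A])
  show "f \<in> Hp p \<Longrightarrow> g \<in> Hp p \<Longrightarrow> (A ^^ n) (\<lambda>z. f z + g z) = (\<lambda>z. (A ^^ n) f z + (A ^^ n) g z)"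
    by (induction n) (auto intro: bounded_opsD(2)[OF A] in_Hp)
  show "f \<in> Hp p \<Longrightarrow> (A ^^ n) (\<lambda>z. c * f z) = (\<lambda>z. c * (A ^^ n) f z)"
    by (induction n) (auto intro: bounded_opsD(3)[OF A] in_Hp)
  obtain K where K: "K \<ge> 0" "\<And>f. f \<in> Hp p \<Longrightarrow> Hp_norm p (A f) \<le> K * Hp_norm p f" using bounded_ops_bound[OF A] by blast
  have "Hp_norm p ((A ^^ n) f) \<le> K ^ n * Hp_norm p f" if "f \<in> Hp p" for f
  proof (induction n)
    case (Suc n)
    have "Hp_norm p ((A ^^ Suc n) f) \<le> K * Hp_norm p ((A ^^ n) f)" using K(2)[OF in_Hp[OF that]] by simp
    also have "\<dots> \<le> K * (K ^ n * Hp_norm p f)" using Suc K(1) by (intro mult_left_mono) auto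
    finally show ?case by (simp add: mult.assoc)
  qed simp
  then show "\<exists>K\<ge>0. \<forall>f\<in>Hp p. Hp_norm p ((A ^^ n) f) \<le> K * Hp_norm p f" using K(1) by (intro exI[of _ "K ^ n"]) auto
qed

lemma Hp_norm_sum_bound:
  assumes p: "1 \<le> p" and I: "finite I" and F: "\<And>i f. i \<in> I \<Longrightarrow> f \<in> Hp p \<Longrightarrow> F i f \<in> Hp p"
    "\<And>i. i \<in> I \<Longrightarrow> \<exists>K\<ge>0. \<forall>f\<in>Hp p. Hp_norm p (F i f) \<le> K * Hp_norm p f"
  shows "\<exists>K\<ge>0. \<forall>f\<in>Hp p. Hp_norm p (\<lambda>z. \<Sum>i\<in>I. c i * F i f z) \<le> K * Hp_norm p f"
  using I F
proof (induction I rule: finite_induct)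
  case empty
  have "Hp_norm p (\<lambda>z. 0) = 0" using Hp_norm_cmult[OF p Hp_zero, of 0] by simp
  then show ?case by (intro exI[of _ 0]) simp
next
  case (insert i I)
  obtain K where K: "K \<ge> 0" "\<And>f. f \<in> Hp p \<Longrightarrow> Hp_norm p (\<lambda>z. \<Sum>i\<in>I. c i * F i f z) \<le> K * Hp_norm p f" using insert by auto
  obtain L where L: "L \<ge> 0" "\<And>f. f \<in> Hp p \<Longrightarrow> Hp_norm p (F i f) \<le> L * Hp_norm p f" using insert.prems(2)[of i] by auto
  have "Hp_norm p (\<lambda>z. \<Sum>i\<in>insert i I. c i * F i f z) \<le> (2 * (norm (c i) * L + K)) * Hp_norm p f" if f: "f \<in> Hp p" for f
  proof -
    have h: "(\<lambda>z. c i * F i f z) \<in> Hp p" "(\<lambda>z. \<Sum>i\<in>I. c i * F i f z) \<in> Hp p"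
      using f insert.prems(1) by (auto intro!: Hp_cmult Hp_sum p)
    have "Hp_norm p (\<lambda>z. \<Sum>i\<in>insert i I. c i * F i f z) \<le> 2 * (Hp_norm p (\<lambda>z. c i * F i f z) + Hp_norm p (\<lambda>z. \<Sum>i\<in>I. c i * F i f z))"
      using Hp_add(2)[OF p h] insert.hyps by simp
    also have "Hp_norm p (\<lambda>z. c i * F i f z) \<le> norm (c i) * Hp_norm p (F i f)" using f insert.prems(1) by (intro Hp_cmult p) auto
    also have "norm (c i) * Hp_norm p (F i f) \<le> norm (c i) * (L * Hp_norm p f)" using L f by (intro mult_left_mono) auto
    also have "Hp_norm p (\<lambda>z. \<Sum>i\<in>I. c i * F i f z) \<le> K * Hp_norm p f" by (rule K(2)[OF f])
    finally show ?thesis by (simp add: algebra_simps)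
  qed
  then show ?case using K L by (intro exI[of _ "2 * (norm (c i) * L + K)"]) auto
qed

lemma poly_op_bounded:
  assumes p: "1 \<le> p" and A: "A \<in> bounded_ops (Hp p) (Hp_norm p)"
  shows "poly_op (Hp p) q A \<in> bounded_ops (Hp p) (Hp_norm p)"
proof -
  note pw = bounded_ops_power[OF A]
  have mem: "(\<lambda>z. \<Sum>i\<le>degree q. coeff q i * (A ^^ i) f z) \<in> Hp p" if "f \<in> Hp p" for f
    by (intro Hp_sum Hp_cmult p pw that)
  have "\<exists>K\<ge>0. \<forall>f\<in>Hp p. Hp_norm p (\<lambda>z. \<Sum>i\<le>degree q. coeff q i * (A ^^ i) f z) \<le> K * Hp_norm p f"
    by (rule Hp_norm_sum_bound[OF p finite_atMost pw(1) pw(4)])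
  then obtain K where K: "\<And>f. f \<in> Hp p \<Longrightarrow> Hp_norm p (\<lambda>z. \<Sum>i\<le>degree q. coeff q i * (A ^^ i) f z) \<le> K * Hp_norm p f"
    by blast
  show ?thesis
    unfolding bounded_ops_def
  proof (intro CollectI conjI ballI allI)
    show "poly_op (Hp p) q A \<in> Hp p \<rightarrow>\<^sub>E Hp p" using mem by (auto simp: poly_op_def)
    show "poly_op (Hp p) q A (\<lambda>z. f z + g z) = (\<lambda>z. poly_op (Hp p) q A f z + poly_op (Hp p) q A g z)"
      if "f \<in> Hp p" "g \<in> Hp p" for f g
      using that pw(2)[OF that] Hp_add(1)[OF p that] by (simp add: poly_op_def sum.distrib distrib_left)
    show "poly_op (Hp p) q A (\<lambda>z. c * f z) = (\<lambda>z. c * poly_op (Hp p) q A f z)" if "f \<in> Hp p" for c f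
      using that pw(3)[OF that] Hp_cmult(1)[OF p that] by (simp add: poly_op_def sum_distrib_left mult.left_commute)
    show "\<exists>K. \<forall>f\<in>Hp p. Hp_norm p (poly_op (Hp p) q A f) \<le> K * Hp_norm p f"
      using K by (auto simp: poly_op_def)
  qed
qed

lemma op_norm_bound:
  assumes p: "1 \<le> p" and A: "A \<in> bounded_ops (Hp p) (Hp_norm p)" and f: "f \<in> Hp p"
  shows "Hp_norm p (A f) \<le> op_norm (Hp p) (Hp_norm p) A * Hp_norm p f"
proof -
  obtain K where K: "K \<ge> 0" "\<And>f. f \<in> Hp p \<Longrightarrow> Hp_norm p (A f) \<le> K * Hp_norm p f" using bounded_ops_bound[OF A] by blast
  show ?thesis
  proof (cases "Hp_norm p f = 0")
    case True then show ?thesis using K(2)[OF f] by simp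
  next
    case False
    define n where "n = Hp_norm p f"
    have n: "0 < n" using False Hp_norm_nonneg[of p f] by (simp add: n_def)
    let ?g = "\<lambda>z. of_real (1 / n) * f z"
    have g: "?g \<in> Hp p" by (intro Hp_cmult p f)
    have g1: "Hp_norm p ?g \<le> 1" using n by (subst Hp_norm_cmult[OF p f]) (simp add: n_def[symmetric] norm_divide)
    \<comment> \<open>Boundedness is what makes the real supremum in \<open>op_norm\<close> an upper
      bound.\<close>
    have "bdd_above ((\<lambda>f. Hp_norm p (A f)) ` {f \<in> Hp p. Hp_norm p f \<le> 1})"
    proof (rule bdd_aboveI2)
      fix f assume "f \<in> {f \<in> Hp p. Hp_norm p f \<le> 1}"
      then show "Hp_norm p (A f) \<le> K" using K(2)[of f] mult_left_mono[of "Hp_norm p f" 1 K] K(1) by auto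
    qed
    then have "Hp_norm p (A ?g) \<le> op_norm (Hp p) (Hp_norm p) A"
      unfolding op_norm_def using g g1 by (intro cSUP_upper) auto
    moreover have "Hp_norm p (A ?g) = 1 / n * Hp_norm p (A f)"
      using n by (simp only: bounded_opsD(3)[OF A f] Hp_norm_cmult[OF p bounded_opsD(1)[OF A f]]) (simp add: norm_divide)
    ultimately have "n * (1 / n * Hp_norm p (A f)) \<le> n * op_norm (Hp p) (Hp_norm p) A"
      using n by (intro mult_left_mono) auto
    then show ?thesis using n by (simp add: n_def[symmetric] mult.commute)
  qed
qed

lemma multiplication_bounded:
  assumes p: "1 \<le> p" and m: "m holomorphic_on \<D>" "\<And>z. z \<in> \<D> \<Longrightarrow> norm (m z) \<le> K" "0 \<le> K"
  shows "(\<lambda>f\<in>Hp p. \<lambda>z. m z * f z) \<in> bounded_ops (Hp p) (Hp_norm p)"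
proof -
  have mem: "(\<lambda>z. m z * f z) \<in> Hp p" "Hp_norm p (\<lambda>z. m z * f z) \<le> K * Hp_norm p f" if "f \<in> Hp p" for f
    using Hp_mult_bounded[OF p that m] by auto
  show ?thesis
    unfolding bounded_ops_def
    by (auto simp: mem Hp_add[OF p] Hp_cmult[OF p] distrib_left mult.left_commute intro!: exI[of _ K])
qed

lemma comp_op_bounded:
  assumes p: "1 \<le> p" and \<phi>: "\<phi> holomorphic_on \<D>" "\<phi> ` \<D> \<subseteq> \<D>"
  shows "comp_op p \<phi> \<in> bounded_ops (Hp p) (Hp_norm p)"
proof -
  define F where "F f z = (if z \<in> \<D> then f (\<phi> z) else 0)" for f :: "complex \<Rightarrow> complex" and z
  have L: "F f \<in> Hp p" "Hp_norm p (F f) \<le> (4 / (1 - norm (\<phi> 0))) powr (1/p) * Hp_norm p f" if "f \<in> Hp p" for f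
    using Littlewood_subordination[OF p that \<phi>] unfolding F_def[abs_def] by auto
  have eq: "comp_op p \<phi> = (\<lambda>f\<in>Hp p. F f)" by (simp add: comp_op_def F_def[abs_def])
  have "F (\<lambda>z. f z + g z) = (\<lambda>z. F f z + F g z)" "F (\<lambda>z. c * f z) = (\<lambda>z. c * F f z)" for f g c
    by (auto simp: F_def)
  then show ?thesis
    unfolding bounded_ops_def eq using L
    by (auto simp: Hp_add[OF p] Hp_cmult[OF p] intro!: exI[of _ "(4 / (1 - norm (\<phi> 0))) powr (1/p)"])
qed

section \<open>The weak operator closure of the polynomials in an operator\<close>

text \<open>The sets that contain \<open>T n\<close> eventually whenever they contain
  \<open>A\<close> are stable under finite intersections and arbitrary unions, so it is enough to
  look at the generating sets.\<close>

lemma closure_of_sequence: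
  assumes A: "A \<in> bounded_ops X N" and X: "(\<lambda>z. 0) \<in> X"
    and S: "\<And>n. T n \<in> S" "\<And>n. T n \<in> bounded_ops X N"
    and lim: "\<And>l f. l \<in> bounded_functionals X N \<Longrightarrow> f \<in> X \<Longrightarrow> (\<lambda>n. l (T n f)) \<longlonglongrightarrow> l (A f)"
  shows "A \<in> weak_operator_topology X N closure_of S"
proof -
  let ?B = "{{A \<in> bounded_ops X N. l (A f) \<in> U} | l f U. l \<in> bounded_functionals X N \<and> f \<in> X \<and> open U}"
  have ev: "A \<in> V \<longrightarrow> (\<forall>\<^sub>F n in sequentially. T n \<in> V)" if "generate_topology_on ?B V" for V
    using that
  proof (induction rule: generate_topology_on.induct)
    case (Int a b)
    then show ?case by (auto intro: eventually_conj)
  next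
    case (UN K)
    show ?case
    proof
      assume "A \<in> \<Union> K"
      then obtain k where "k \<in> K" "A \<in> k" by blast
      then have "\<forall>\<^sub>F n in sequentially. T n \<in> k" using UN.IH by blast
      then show "\<forall>\<^sub>F n in sequentially. T n \<in> \<Union> K"
        by (rule eventually_mono) (use \<open>k \<in> K\<close> in blast)
    qed
  next
    case (Basis s)
    then obtain l f V where s: "s = {A \<in> bounded_ops X N. l (A f) \<in> V}" "l \<in> bounded_functionals X N" "f \<in> X" "open V" by blast
    show ?case
    proof
      assume "A \<in> s"
      then have "\<forall>\<^sub>F n in sequentially. l (T n f) \<in> V" using topological_tendstoD[OF lim[OF s(2,3)] s(4)] s(1) by simp
      then show "\<forall>\<^sub>F n in sequentially. T n \<in> s" using s(1) S(2) by simp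
    qed
  qed simp
  have top: "A \<in> topspace (weak_operator_topology X N)"
  proof -
    \<comment> \<open>The space of the topology is the union of its generating sets. The zero
      functional makes one of them all of \<open>bounded_ops X N\<close>.\<close>
    have "(\<lambda>_. 0) \<in> bounded_functionals X N" by (auto simp: bounded_functionals_def intro!: exI[of _ 0])
    then have "{A \<in> bounded_ops X N. (\<lambda>_. 0::complex) (A (\<lambda>z. 0)) \<in> UNIV} \<in> ?B" using X open_UNIV by blast
    then show ?thesis using A unfolding weak_operator_topology_def topology_generated_by_topspace by blast
  qed
  show ?thesis
    unfolding in_closure_of
  proof (intro conjI allI impI top)
    fix V assume V: "A \<in> V \<and> openin (weak_operator_topology X N) V"
    then have "generate_topology_on ?B V" by (simp add: weak_operator_topology_def openin_topology_generated_by_iff)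
    then have "\<forall>\<^sub>F n in sequentially. T n \<in> V" using ev V by blast
    then obtain n where "T n \<in> V" using eventually_happens by force
    then show "\<exists>y. y \<in> S \<and> y \<in> V" using S(1) by blast
  qed
qed

text \<open>The operator \<open>A\<close> is a parameter so that \<open>g \<mapsto> g z\<close> and
  \<open>g \<mapsto> Bo g z\<close> are both covered, the two functionals that test whether
  operators commute.\<close>

lemma evaluation_functional:
  assumes p: "1 \<le> p" and A: "A \<in> bounded_ops (Hp p) (Hp_norm p)" and z: "z \<in> \<D>"
  shows "(\<lambda>f. A f z) \<in> bounded_functionals (Hp p) (Hp_norm p)"
proof -
  obtain K where K: "K \<ge> 0" "\<And>f. f \<in> Hp p \<Longrightarrow> Hp_norm p (A f) \<le> K * Hp_norm p f" using bounded_ops_bound[OF A] by blast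
  obtain L where L: "L \<ge> 0" "\<And>f. f \<in> Hp p \<Longrightarrow> norm (f z) \<le> L * Hp_norm p f" using Hp_eval_bound[OF p z] by blast
  have "norm (A f z) \<le> L * K * Hp_norm p f" if "f \<in> Hp p" for f
  proof -
    have "norm (A f z) \<le> L * Hp_norm p (A f)" by (intro L bounded_opsD(1)[OF A that])
    also have "\<dots> \<le> L * (K * Hp_norm p f)" using L K that by (intro mult_left_mono) auto
    finally show ?thesis by (simp add: mult.assoc)
  qed
  then show ?thesis using bounded_opsD(2,3)[OF A] by (auto simp: bounded_functionals_def)
qed

lemma identity_bounded: "(\<lambda>f\<in>Hp p. f) \<in> bounded_ops (Hp p) (Hp_norm p)" if "1 \<le> p"
  using Hp_add(1)[OF that] Hp_cmult(1)[OF that] by (auto simp: bounded_ops_def intro!: exI[of _ 1])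

lemma poly_op_commute:
  assumes p: "1 \<le> p" and T: "T \<in> bounded_ops (Hp p) (Hp_norm p)" and Bc: "Bo \<in> commutant (Hp p) (Hp_norm p) T"
    and f: "f \<in> Hp p"
  shows "poly_op (Hp p) q T (Bo f) = Bo (poly_op (Hp p) q T f)"
proof -
  have Bb: "Bo \<in> bounded_ops (Hp p) (Hp_norm p)" and Bcomm: "\<And>f. f \<in> Hp p \<Longrightarrow> Bo (T f) = T (Bo f)"
    using Bc by (auto simp: commutant_def)
  note pw = bounded_ops_power(1)[OF T]
  have pc: "(T ^^ i) (Bo f) = Bo ((T ^^ i) f)" for i
    by (induction i) (simp_all add: Bcomm pw f)
  have "Bo (\<lambda>z. \<Sum>i\<le>degree q. coeff q i * (T ^^ i) f z) = (\<lambda>z. \<Sum>i\<le>degree q. coeff q i * Bo ((T ^^ i) f) z)"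
    by (rule bounded_ops_sum[OF Bb p]) (auto simp: pw f)
  then show ?thesis using f bounded_opsD(1)[OF Bb f] by (simp add: poly_op_def pc)
qed

text \<open>If \<open>A (Bo f)\<close> and \<open>Bo (A f)\<close> differ at a point
  \<open>z\<close>, disjoint open sets around the two values give a weak neighbourhood of
  \<open>A\<close>. It contains a polynomial in \<open>T\<close>, which commutes with
  \<open>Bo\<close>, and this is a contradiction.\<close>

lemma alg_closure_subset_bicommutant:
  assumes p: "1 \<le> p" and T: "T \<in> bounded_ops (Hp p) (Hp_norm p)"
  shows "weak_operator_topology (Hp p) (Hp_norm p) closure_of alg_op (Hp p) T \<subseteq> bicommutant (Hp p) (Hp_norm p) T"
proof
  let ?X = "Hp p" and ?N = "Hp_norm p"
  let ?W = "weak_operator_topology ?X ?N"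
  fix A assume A: "A \<in> ?W closure_of alg_op ?X T"
  have "topspace ?W \<subseteq> bounded_ops ?X ?N"
    unfolding weak_operator_topology_def topology_generated_by_topspace by blast
  then have Ab: "A \<in> bounded_ops ?X ?N" using A by (auto simp: in_closure_of)
  have "A (Bo f) = Bo (A f)" if Bc: "Bo \<in> commutant ?X ?N T" and f: "f \<in> ?X" for Bo f
  proof (rule ccontr)
    assume ne: "A (Bo f) \<noteq> Bo (A f)"
    have Bb: "Bo \<in> bounded_ops ?X ?N" using Bc by (simp add: commutant_def)
    have Bf: "Bo f \<in> ?X" and BAf: "Bo (A f) \<in> ?X" and ABf: "A (Bo f) \<in> ?X"
      using bounded_opsD(1)[OF Bb] bounded_opsD(1)[OF Ab] f by auto
    obtain z where z: "A (Bo f) z \<noteq> Bo (A f) z" using ne by (auto simp: fun_eq_iff)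
    have zD: "z \<in> \<D>" using z HpD(2)[OF ABf] HpD(2)[OF BAf] by metis
    obtain V1 V2 where V: "open V1" "open V2" "A (Bo f) z \<in> V1" "Bo (A f) z \<in> V2" "V1 \<inter> V2 = {}"
      using hausdorff[OF z] by blast
    let ?l1 = "\<lambda>g. (\<lambda>f\<in>?X. f) g z" and ?l2 = "\<lambda>g. Bo g z"
    have l: "?l1 \<in> bounded_functionals ?X ?N" "?l2 \<in> bounded_functionals ?X ?N"
      using evaluation_functional[OF p identity_bounded[OF p] zD] evaluation_functional[OF p Bb zD] by auto
    let ?S1 = "{A \<in> bounded_ops ?X ?N. ?l1 (A (Bo f)) \<in> V1}" and ?S2 = "{A \<in> bounded_ops ?X ?N. ?l2 (A f) \<in> V2}"
    have basic: "openin ?W {A \<in> bounded_ops ?X ?N. l (A f) \<in> V}"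
      if "l \<in> bounded_functionals ?X ?N" "f \<in> ?X" "open V" for l f V
      unfolding weak_operator_topology_def using that by (intro topology_generated_by_Basis CollectI exI conjI) simp_all
    have "openin ?W ?S1" "openin ?W ?S2" by (rule basic[OF l(1) Bf V(1)], rule basic[OF l(2) f V(2)])
    then have op: "openin ?W (?S1 \<inter> ?S2)" by (rule openin_Int)
    have mem: "A \<in> ?S1 \<inter> ?S2" using V Ab ABf by simp
    from conjunct2[OF A[unfolded in_closure_of]] have "\<exists>y. y \<in> alg_op ?X T \<and> y \<in> ?S1 \<inter> ?S2"
      by (rule allE[of _ "?S1 \<inter> ?S2"]) (erule impE, rule conjI[OF mem op])
    then obtain Q where Q: "Q \<in> alg_op ?X T" "Q \<in> ?S1 \<inter> ?S2" by (elim exE conjE)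
    obtain q where q: "Q = poly_op ?X q T" using Q(1) by (auto simp: alg_op_def)
    have "Q (Bo f) = Bo (Q f)" unfolding q by (rule poly_op_commute[OF p T Bc f])
    moreover have "Q (Bo f) \<in> ?X" using Q(2) Bf bounded_opsD(1) by blast
    ultimately show False using Q(2) V(5) by auto
  qed
  then show "A \<in> bicommutant ?X ?N T" using Ab by (auto simp: bicommutant_def commutant_def)
qed

section \<open>The bicommutant\<close>

locale koenigs_semiflow = koenigs_strip p a b h for p a b h +
  fixes \<Phi> :: "real \<Rightarrow> complex \<Rightarrow> complex"
  assumes \<Phi>_hol: "\<And>t. 0 \<le> t \<Longrightarrow> \<Phi> t holomorphic_on \<D>" and \<Phi>_self: "\<And>t. 0 \<le> t \<Longrightarrow> \<Phi> t ` \<D> \<subseteq> \<D>"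
    and h_\<Phi>: "\<And>t z. 0 \<le> t \<Longrightarrow> z \<in> \<D> \<Longrightarrow> h (\<Phi> t z) = h z + of_real t"
begin

abbreviation X where "X \<equiv> Hp p"
abbreviation N where "N \<equiv> Hp_norm p"
definition T where "T = comp_op p (\<Phi> 1)"
definition Mexp where "Mexp = (\<lambda>f\<in>X. \<lambda>z. exp (\<i> * of_real (2 * pi) * h z) * f z)"

lemma \<Phi>_in: "0 \<le> t \<Longrightarrow> z \<in> \<D> \<Longrightarrow> \<Phi> t z \<in> \<D>" using \<Phi>_self by blast

lemma \<Phi>_commute:
  assumes "0 \<le> s" "0 \<le> t" "z \<in> \<D>" shows "\<Phi> s (\<Phi> t z) = \<Phi> t (\<Phi> s z)"
  using h_inj by (rule inj_onD) (simp_all only: assms h_\<Phi> \<Phi>_in add.assoc, simp add: add.commute)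

lemma T_bounded: "T \<in> bounded_ops X N"
  unfolding T_def by (intro comp_op_bounded p1 \<Phi>_hol \<Phi>_self) auto

lemma comp_apply: "f \<in> X \<Longrightarrow> comp_op p \<phi> f = (\<lambda>z. if z \<in> \<D> then f (\<phi> z) else 0)"
  by (simp add: comp_op_def)

lemma comp_commutant:
  assumes t: "0 \<le> t" shows "comp_op p (\<Phi> t) \<in> commutant X N T"
proof -
  have b: "comp_op p (\<Phi> t) \<in> bounded_ops X N" by (intro comp_op_bounded p1 \<Phi>_hol \<Phi>_self t)
  have "comp_op p (\<Phi> t) (T f) = T (comp_op p (\<Phi> t) f)" if f: "f \<in> X" for f
  proof -
    have "T f \<in> X" "comp_op p (\<Phi> t) f \<in> X" using f bounded_opsD(1) b T_bounded by auto
    then show ?thesis using f t \<Phi>_in \<Phi>_commute[of t 1]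
      by (auto simp: T_def comp_apply fun_eq_iff simp del: mem_ball_0 mem_ball)
  qed
  then show ?thesis using b by (simp add: commutant_def)
qed

lemma norm_exp_ih: "z \<in> \<D> \<Longrightarrow> norm (exp (\<i> * of_real \<beta> * h z)) \<le> exp (\<bar>\<beta>\<bar> * B)"
  using norm_exp_h[of z "\<i> * of_real \<beta>"] by simp

text \<open>\<open>h (\<Phi> 1 z) = h z + 1\<close>, and 1 is a period of
  \<open>exp (2 * pi * \<i> * w)\<close>. The factor is bounded since \<open>Im h\<close>
  is.\<close>

lemma Mexp_commutant: "Mexp \<in> commutant X N T"
proof -
  have b: "Mexp \<in> bounded_ops X N"
    unfolding Mexp_def by (rule multiplication_bounded[OF p1(1) _ norm_exp_ih]) (auto intro!: holomorphic_intros h_hol)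
  have "Mexp (T f) = T (Mexp f)" if f: "f \<in> X" for f
  proof -
    have m: "T f \<in> X" "Mexp f \<in> X" using f bounded_opsD(1) b T_bounded by auto
    have "exp (\<i> * of_real (2 * pi) * h (\<Phi> 1 z)) = exp (\<i> * of_real (2 * pi) * h z)" if "z \<in> \<D>" for z
    proof -
      have "\<i> * of_real (2 * pi) * h (\<Phi> 1 z) = \<i> * of_real (2 * pi) * h z + 2 * of_real pi * \<i>"
        using h_\<Phi>[of 1 z] that by (simp add: algebra_simps)
      then show ?thesis by (simp add: exp_add)
    qed
    then have "Mexp (T f) z = T (Mexp f) z" for z
      using f m by (simp add: T_def comp_apply Mexp_def del: mem_ball_0 mem_ball)
    then show ?thesis by blast
  qed
  then show ?thesis using b by (simp add: commutant_def)
qed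

lemma comp_ef:
  assumes "Re \<mu> < s0" "0 \<le> t" shows "comp_op p (\<Phi> t) (ef \<mu>) = (\<lambda>z. exp (\<mu> * of_real t) * ef \<mu> z)"
  using comp_apply[OF ef_Hp[OF assms(1)]] assms(2) \<Phi>_in h_\<Phi>
  by (auto simp: fun_eq_iff ef_def zext_def exp_add[symmetric] algebra_simps simp del: mem_ball_0 mem_ball)

lemma ef_norm_pos:
  assumes "Re \<mu> < s0" shows "0 < N (ef \<mu>)"
proof (rule ccontr)
  assume "\<not> 0 < N (ef \<mu>)"
  then have n: "N (ef \<mu>) = 0" using Hp_norm_nonneg[of p "ef \<mu>"] by simp
  obtain K where "\<forall>f\<in>X. norm (f 0) \<le> K * N f" using Hp_eval_bound[OF p1(1), of 0] by auto
  then have "norm (ef \<mu> 0) \<le> K * N (ef \<mu>)" using ef_Hp[OF assms] by blast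
  then show False using n by (simp add: ef_def)
qed

section \<open>The symbol of an operator in the bicommutant\<close>

definition symbol where "symbol A \<mu> = A (ef \<mu>) 0 / exp (\<mu> * h 0)"

text \<open>The quotient of \<open>A (ef \<mu>)\<close> by \<open>exp (\<mu> * h)\<close> is invariant under translations in \<open>\<Omega>\<close>, hence constant.\<close>

lemma bicommutant_ef:
  assumes A: "A \<in> bicommutant X N T" and \<mu>: "Re \<mu> < s0"
  shows "A (ef \<mu>) = (\<lambda>z. symbol A \<mu> * ef \<mu> z)"
proof -
  define F where "F = A (ef \<mu>)"
  have Ab: "A \<in> bounded_ops X N" using A comp_commutant[of 0] by (auto simp: bicommutant_def commutant_def)
  have FX: "F \<in> X" unfolding F_def by (intro bounded_opsD(1)[OF Ab] ef_Hp \<mu>)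
  have F_inv: "F (\<Phi> t z) = exp (\<mu> * of_real t) * F z" if t: "0 \<le> t" and z: "z \<in> \<D>" for t z
  proof -
    have "A (comp_op p (\<Phi> t) (ef \<mu>)) = comp_op p (\<Phi> t) (A (ef \<mu>))"
      using A comp_commutant[OF t] ef_Hp[OF \<mu>] by (auto simp: bicommutant_def commutant_def)
    then have "(\<lambda>z. exp (\<mu> * of_real t) * F z) = comp_op p (\<Phi> t) F"
      unfolding comp_ef[OF \<mu> t] bounded_opsD(3)[OF Ab ef_Hp[OF \<mu>]] by (simp add: F_def)
    then have "exp (\<mu> * of_real t) * F z = comp_op p (\<Phi> t) F z" by (rule fun_cong)
    then show ?thesis using z by (simp add: comp_apply[OF FX])
  qed
  obtain hi where hi: "hi holomorphic_on h ` \<D>" "\<And>z. z \<in> \<D> \<Longrightarrow> hi (h z) = z"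
    using holomorphic_has_inverse[OF h_hol open_ball h_inj] by metis
  have hiD: "hi ` (h ` \<D>) \<subseteq> \<D>" using hi(2) by auto
  \<comment> \<open>In the coordinate \<open>w = h z\<close>, the quotient minus its value at
    \<open>h 0\<close>. It vanishes on the orbit of \<open>h 0\<close>, a ray with
    \<open>h 0\<close> as limit point, hence on the connected set \<Omega>.\<close>
  define Q where "Q w = F (hi w) / exp (\<mu> * w) - F 0 / exp (\<mu> * h 0)" for w
  have "Q holomorphic_on \<Omega>"
    unfolding Q_def \<Omega>_def
    by (intro holomorphic_intros holomorphic_on_compose_gen[OF hi(1) HpD(1)[OF FX] hiD, unfolded o_def]) auto
  moreover have "h 0 islimpt ((\<lambda>t. h 0 + of_real t) ` {0..})"
    unfolding islimpt_approachable
  proof (intro allI impI)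
    fix e :: real assume "0 < e"
    then show "\<exists>x'\<in>(\<lambda>t. h 0 + of_real t) ` {0..}. x' \<noteq> h 0 \<and> dist x' (h 0) < e"
      by (intro bexI[of _ "h 0 + of_real (e / 2)"] conjI imageI) (auto simp: dist_norm)
  qed
  moreover have "(\<lambda>t. h 0 + of_real t) ` {0..} \<subseteq> \<Omega>" using \<Omega>_shift[OF h0_\<Omega>] by auto
  moreover have "Q w = 0" if w: "w \<in> (\<lambda>t. h 0 + of_real t) ` {0..}" for w
  proof -
    obtain t where t: "0 \<le> t" "w = h 0 + of_real t" using w by auto
    have "w = h (\<Phi> t 0)" using h_\<Phi>[OF t(1), of 0] t by simp
    then have "hi w = \<Phi> t 0" using hi(2)[OF \<Phi>_in[OF t(1), of 0]] by simp
    then have "F (hi w) / exp (\<mu> * w) = exp (\<mu> * of_real t) * F 0 / exp (\<mu> * h 0 + \<mu> * of_real t)"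
      using F_inv[OF t(1), of 0] t by (simp add: algebra_simps)
    then show ?thesis by (simp add: Q_def exp_add)
  qed
  ultimately have Q0: "Q w = 0" if "w \<in> \<Omega>" for w
    using analytic_continuation[of Q \<Omega> "(\<lambda>t. h 0 + of_real t) ` {0..}" "h 0" w] open_\<Omega> connected_\<Omega> h0_\<Omega> that by blast
  have "F z = symbol A \<mu> * ef \<mu> z" for z
  proof (cases "z \<in> \<D>")
    case True
    then have "F z / exp (\<mu> * h z) = symbol A \<mu>"
      using Q0[OF h_in_\<Omega>[OF True]] hi(2)[OF True] by (simp add: Q_def symbol_def F_def)
    then show ?thesis using True by (simp add: ef_def field_simps)
  next
    case False
    then show ?thesis using HpD(2)[OF FX False] by (simp add: ef_def)
  qed
  then show ?thesis unfolding F_def by blast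
qed

lemma bicommutant_bounded: "A \<in> bicommutant X N T \<Longrightarrow> A \<in> bounded_ops X N"
  using comp_commutant[of 0] by (auto simp: bicommutant_def commutant_def)

lemma symbol_bounded:
  assumes A: "A \<in> bicommutant X N T"
  shows "\<exists>K\<ge>0. \<forall>\<mu>. Re \<mu> < s0 \<longrightarrow> norm (symbol A \<mu>) \<le> K"
proof -
  obtain K where K: "K \<ge> 0" "\<And>f. f \<in> X \<Longrightarrow> N (A f) \<le> K * N f" using bounded_ops_bound[OF bicommutant_bounded[OF A]] by blast
  have "norm (symbol A \<mu>) \<le> K" if \<mu>: "Re \<mu> < s0" for \<mu>
  proof -
    have "norm (symbol A \<mu>) * N (ef \<mu>) = N (A (ef \<mu>))"
      unfolding bicommutant_ef[OF A \<mu>] by (rule Hp_norm_cmult[OF p1(1) ef_Hp[OF \<mu>], symmetric])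
    also have "\<dots> \<le> K * N (ef \<mu>)" by (intro K ef_Hp \<mu>)
    finally show ?thesis using ef_norm_pos[OF \<mu>] by simp
  qed
  then show ?thesis using K(1) by blast
qed

text \<open>\<open>Mexp\<close> maps \<open>ef \<mu>\<close> to
  \<open>ef (\<mu> + 2 * pi * \<i>)\<close>. As \<open>A\<close> commutes with it, both
  eigenfunctions have the same eigenvalue.\<close>

lemma symbol_periodic1:
  assumes A: "A \<in> bicommutant X N T" and \<mu>: "Re \<mu> < s0"
  shows "symbol A (\<mu> + 2 * pi * \<i>) = symbol A \<mu>"
proof -
  let ?\<nu> = "\<mu> + 2 * pi * \<i>"
  have \<nu>: "Re ?\<nu> < s0" using \<mu> by simp
  have M: "Mexp (ef \<mu>) = ef ?\<nu>"
    using ef_Hp[OF \<mu>] by (auto simp: Mexp_def fun_eq_iff ef_def zext_def exp_add[symmetric] algebra_simps)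
  have Mb: "Mexp \<in> bounded_ops X N" using Mexp_commutant by (simp add: commutant_def)
  have "(\<lambda>z. symbol A ?\<nu> * ef ?\<nu> z) = A (Mexp (ef \<mu>))" unfolding M by (rule bicommutant_ef[OF A \<nu>, symmetric])
  also have "\<dots> = Mexp (A (ef \<mu>))"
    using A Mexp_commutant ef_Hp[OF \<mu>] by (auto simp: bicommutant_def commutant_def)
  also have "\<dots> = (\<lambda>z. symbol A \<mu> * ef ?\<nu> z)"
    unfolding bicommutant_ef[OF A \<mu>] bounded_opsD(3)[OF Mb ef_Hp[OF \<mu>]] M ..
  finally have "symbol A ?\<nu> * ef ?\<nu> 0 = symbol A \<mu> * ef ?\<nu> 0" by (rule fun_cong)
  then show ?thesis by (simp add: ef_def)
qed

lemma symbol_periodic: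
  assumes A: "A \<in> bicommutant X N T" and \<mu>: "Re \<mu> < s0"
  shows "symbol A (\<mu> + of_int (2 * k) * pi * \<i>) = symbol A \<mu>"
proof (induction k rule: int_induct[where k=0])
  case (step1 k)
  have "symbol A ((\<mu> + of_int (2 * k) * pi * \<i>) + 2 * pi * \<i>) = symbol A (\<mu> + of_int (2 * k) * pi * \<i>)"
    by (rule symbol_periodic1[OF A]) (use \<mu> in simp)
  then show ?case using step1 by (simp add: algebra_simps)
next
  case (step2 k)
  have "symbol A ((\<mu> + of_int (2 * (k - 1)) * pi * \<i>) + 2 * pi * \<i>) = symbol A (\<mu> + of_int (2 * (k - 1)) * pi * \<i>)"
    by (rule symbol_periodic1[OF A]) (use \<mu> in simp)
  then show ?case using step2 by (simp add: algebra_simps)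
qed simp

text \<open>By Taylor's formula the remainder is of order \<open>norm \<epsilon>\<close> times
  \<open>(norm h)\<^sup>2 * exp (\<delta> * norm h)\<close>. The square grows at most like
  \<open>exp (2 * \<delta> * \<bar>Re h\<bar>)\<close>, so \<open>3 * \<delta>\<close> suffices in
  \<open>exp_dominated\<close>. Differences appear as sums with \<open>(-1) *\<close>, the form to
  which linearity of a functional applies.\<close>

lemma ef_difference_quotient:
  assumes \<mu>: "Re \<mu> < s0"
  shows "\<exists>\<delta>>0. \<exists>C. \<forall>\<epsilon>. \<epsilon> \<noteq> 0 \<and> norm \<epsilon> < \<delta> \<longrightarrow>
     N (\<lambda>z. (1 / \<epsilon>) * (ef (\<mu> + \<epsilon>) z + (-1) * ef \<mu> z) + (-1) * (h z * ef \<mu> z)) \<le> norm \<epsilon> * C"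
proof -
  define \<delta> where "\<delta> = (s0 - Re \<mu>) / 4"
  have \<delta>: "0 < \<delta>" "Re \<mu> + 3 * \<delta> < s0" using \<mu> by (auto simp: \<delta>_def field_simps)
  define C1 where "C1 = (1 / \<delta> + B)\<^sup>2 * exp (\<delta> * B)"
  have C1: "0 \<le> C1" by (simp add: C1_def)
  let ?C = "2 * C1 * (N (ef (\<mu> + of_real (3 * \<delta>))) + N (ef (\<mu> - of_real (3 * \<delta>))))"
  have "N (\<lambda>z. (1 / \<epsilon>) * (ef (\<mu> + \<epsilon>) z + (-1) * ef \<mu> z) + (-1) * (h z * ef \<mu> z)) \<le> norm \<epsilon> * ?C"
    if \<epsilon>: "\<epsilon> \<noteq> 0" "norm \<epsilon> < \<delta>" for \<epsilon>
  proof -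
    let ?r = "\<lambda>z. (1 / \<epsilon>) * (ef (\<mu> + \<epsilon>) z + (-1) * ef \<mu> z) + (-1) * (h z * ef \<mu> z)"
    have "N ?r \<le> 2 * (norm \<epsilon> * C1) * (N (ef (\<mu> + of_real (3 * \<delta>))) + N (ef (\<mu> - of_real (3 * \<delta>))))"
    proof (rule exp_dominated(2))
      show "?r holomorphic_on \<D>" by (intro holomorphic_intros ef_hol h_hol \<epsilon>)
      show "norm (?r z) \<le> norm \<epsilon> * C1 * exp (3 * \<delta> * \<bar>Re (h z)\<bar>) * norm (ef \<mu> z)" if z: "z \<in> \<D>" for z
      proof -
        let ?e = "exp (\<epsilon> * h z)"
        have "?r z = (1 / \<epsilon>) * ((?e - (\<Sum>k\<le>1. (\<epsilon> * h z) ^ k / fact k)) * ef \<mu> z)"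
          using z \<epsilon> by (simp add: ef_def exp_add algebra_simps add_divide_distrib diff_divide_distrib)
        then have "norm (?r z) = 1 / norm \<epsilon> * (norm (?e - (\<Sum>k\<le>1. (\<epsilon> * h z) ^ k / fact k)) * norm (ef \<mu> z))"
          by (simp only: norm_mult norm_divide norm_one)
        also have "\<dots> \<le> 1 / norm \<epsilon> * ((norm \<epsilon>)\<^sup>2 * (C1 * exp (3 * \<delta> * \<bar>Re (h z)\<bar>)) * norm (ef \<mu> z))"
        proof (intro mult_left_mono mult_right_mono)
          have "norm (?e - (\<Sum>k\<le>1. (\<epsilon> * h z) ^ k / fact k)) \<le> exp \<bar>Re (\<epsilon> * h z)\<bar> * norm (\<epsilon> * h z) ^ Suc 1 / fact 1" by (rule Taylor_exp)
          also have "\<dots> = exp \<bar>Re (\<epsilon> * h z)\<bar> * ((norm \<epsilon>)\<^sup>2 * (norm (h z))\<^sup>2)" by (simp add: norm_mult power2_eq_square mult_ac)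
          also have "\<dots> \<le> exp (\<delta> * (\<bar>Re (h z)\<bar> + B)) * ((norm \<epsilon>)\<^sup>2 * ((1 / \<delta> + B) * exp (\<delta> * \<bar>Re (h z)\<bar>))\<^sup>2)"
          proof (intro mult_mono power_mono h_growth z \<delta>)
            have "\<bar>Re (\<epsilon> * h z)\<bar> \<le> norm \<epsilon> * norm (h z)" using abs_Re_le_cmod[of "\<epsilon> * h z"] by (simp add: norm_mult)
            also have "\<dots> \<le> \<delta> * (\<bar>Re (h z)\<bar> + B)"
              using \<epsilon>(2) cmod_le[of "h z"] B_bound[OF z] \<delta> by (intro mult_mono) auto
            finally show "exp \<bar>Re (\<epsilon> * h z)\<bar> \<le> exp (\<delta> * (\<bar>Re (h z)\<bar> + B))" by simp
          qed auto
          also have "\<dots> = (norm \<epsilon>)\<^sup>2 * (C1 * exp (3 * \<delta> * \<bar>Re (h z)\<bar>))"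
          proof -
            have "exp (3 * \<delta> * \<bar>Re (h z)\<bar>) = exp (\<delta> * \<bar>Re (h z)\<bar>) * (exp (\<delta> * \<bar>Re (h z)\<bar>))\<^sup>2"
              unfolding power2_eq_square exp_add[symmetric] by simp
            then show ?thesis by (simp add: C1_def distrib_left exp_add power_mult_distrib mult_ac)
          qed
          finally show "norm (?e - (\<Sum>k\<le>1. (\<epsilon> * h z) ^ k / fact k)) \<le> (norm \<epsilon>)\<^sup>2 * (C1 * exp (3 * \<delta> * \<bar>Re (h z)\<bar>))" .
        qed auto
        also have "\<dots> = norm \<epsilon> * C1 * exp (3 * \<delta> * \<bar>Re (h z)\<bar>) * norm (ef \<mu> z)"
          using \<epsilon>(1) by (simp add: power2_eq_square)
        finally show ?thesis .
      qed
    qed (use C1 \<delta> in \<open>auto simp: ef_out\<close>)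
    then show ?thesis by (simp add: mult_ac)
  qed
  then show ?thesis using \<delta>(1) by blast
qed

text \<open>\<open>ef\<close> is differentiable in \<mu> with respect to the norm, with derivative
  \<open>h * ef \<mu>\<close>; the bounded functional \<open>f \<mapsto> A f 0\<close> transfers
  this to the numerator of the symbol.\<close>

lemma symbol_holomorphic:
  assumes A: "A \<in> bicommutant X N T"
  shows "symbol A holomorphic_on {\<mu>. Re \<mu> < s0}"
proof -
  have Ab: "A \<in> bounded_ops X N" by (rule bicommutant_bounded[OF A])
  define l where "l f = A f 0" for f
  obtain K where K: "K \<ge> 0" "\<And>f. f \<in> X \<Longrightarrow> norm (l f) \<le> K * N f"
  proof -
    have "l \<in> bounded_functionals X N" unfolding l_def[abs_def] by (rule evaluation_functional[OF p1(1) Ab]) simp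
    then obtain K where K: "\<forall>f\<in>X. norm (l f) \<le> K * N f" by (auto simp: bounded_functionals_def)
    have "norm (l f) \<le> \<bar>K\<bar> * N f" if "f \<in> X" for f
      using K that mult_right_mono[of K "\<bar>K\<bar>" "N f"] Hp_norm_nonneg[of p f] by force
    then show ?thesis by (intro that[of "\<bar>K\<bar>"]) auto
  qed
  have l_add: "l (\<lambda>z. f z + g z) = l f + l g" if "f \<in> X" "g \<in> X" for f g
    unfolding l_def bounded_opsD(2)[OF Ab that] ..
  have l_mult: "l (\<lambda>z. c * f z) = c * l f" if "f \<in> X" for f c
    unfolding l_def bounded_opsD(3)[OF Ab that] ..
  have "((\<lambda>\<mu>. l (ef \<mu>)) has_field_derivative l (\<lambda>z. h z * ef \<mu> z)) (at \<mu>)" if \<mu>: "Re \<mu> < s0" for \<mu>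
  proof -
    obtain \<delta> C where C: "0 < \<delta>" "\<And>\<epsilon>. \<epsilon> \<noteq> 0 \<Longrightarrow> norm \<epsilon> < \<delta> \<Longrightarrow>
       N (\<lambda>z. (1 / \<epsilon>) * (ef (\<mu> + \<epsilon>) z + (-1) * ef \<mu> z) + (-1) * (h z * ef \<mu> z)) \<le> norm \<epsilon> * C"
      using ef_difference_quotient[OF \<mu>] by blast
    define \<delta>' where "\<delta>' = min \<delta> (s0 - Re \<mu>)"
    have \<delta>': "0 < \<delta>'" using C(1) \<mu> by (simp add: \<delta>'_def)
    have bound: "norm ((l (ef (\<mu> + \<epsilon>)) - l (ef \<mu>)) / \<epsilon> - l (\<lambda>z. h z * ef \<mu> z)) \<le> K * (norm \<epsilon> * C)"
      if \<epsilon>: "\<epsilon> \<noteq> 0" "norm \<epsilon> < \<delta>'" for \<epsilon>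
    proof -
      have "Re \<epsilon> < s0 - Re \<mu>" using \<epsilon> complex_Re_le_cmod[of \<epsilon>] by (simp add: \<delta>'_def)
      then have x1: "ef (\<mu> + \<epsilon>) \<in> X" by (intro ef_Hp) simp
      note x2 = ef_Hp[OF \<mu>] and x3 = h_ef_Hp[OF \<mu>]
      have x4: "(\<lambda>z. (-1) * ef \<mu> z) \<in> X" "(\<lambda>z. (-1) * (h z * ef \<mu> z)) \<in> X" by (intro Hp_cmult p1 x2 x3)+
      have x5: "(\<lambda>z. ef (\<mu> + \<epsilon>) z + (-1) * ef \<mu> z) \<in> X" by (intro Hp_add p1 x1 x4)
      have x6: "(\<lambda>z. (1 / \<epsilon>) * (ef (\<mu> + \<epsilon>) z + (-1) * ef \<mu> z)) \<in> X" by (intro Hp_cmult p1 x5)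
      have x7: "(\<lambda>z. (1 / \<epsilon>) * (ef (\<mu> + \<epsilon>) z + (-1) * ef \<mu> z) + (-1) * (h z * ef \<mu> z)) \<in> X" by (intro Hp_add p1 x6 x4)
      have "l (\<lambda>z. (1 / \<epsilon>) * (ef (\<mu> + \<epsilon>) z + (-1) * ef \<mu> z) + (-1) * (h z * ef \<mu> z))
         = (1 / \<epsilon>) * (l (ef (\<mu> + \<epsilon>)) + (-1) * l (ef \<mu>)) + (-1) * l (\<lambda>z. h z * ef \<mu> z)"
        unfolding l_add[OF x6 x4(2)] l_mult[OF x5] l_add[OF x1 x4(1)] l_mult[OF x2] l_mult[OF x3] ..
      then have eq: "(l (ef (\<mu> + \<epsilon>)) - l (ef \<mu>)) / \<epsilon> - l (\<lambda>z. h z * ef \<mu> z)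
         = l (\<lambda>z. (1 / \<epsilon>) * (ef (\<mu> + \<epsilon>) z + (-1) * ef \<mu> z) + (-1) * (h z * ef \<mu> z))" by simp
      have "norm \<epsilon> < \<delta>" using \<epsilon>(2) by (simp add: \<delta>'_def)
      then show ?thesis
        unfolding eq by (rule order_trans[OF K(2)[OF x7] mult_left_mono[OF C(2)[OF \<epsilon>(1)] K(1)]])
    qed
    have "((\<lambda>\<epsilon>. (l (ef (\<mu> + \<epsilon>)) - l (ef \<mu>)) / \<epsilon> - l (\<lambda>z. h z * ef \<mu> z)) \<longlongrightarrow> 0) (at 0)"
    proof (rule Lim_null_comparison)
      show "\<forall>\<^sub>F \<epsilon> in at 0. norm ((l (ef (\<mu> + \<epsilon>)) - l (ef \<mu>)) / \<epsilon> - l (\<lambda>z. h z * ef \<mu> z)) \<le> K * (norm \<epsilon> * C)"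
        unfolding eventually_at using \<delta>' bound by (intro exI[of _ \<delta>']) (auto simp: dist_norm)
      have "((\<lambda>\<epsilon>::complex. K * (norm \<epsilon> * C)) \<longlongrightarrow> K * (norm (0::complex) * C)) (at 0)" by (intro tendsto_intros)
      then show "((\<lambda>\<epsilon>::complex. K * (norm \<epsilon> * C)) \<longlongrightarrow> 0) (at 0)" by simp
    qed
    then show ?thesis unfolding DERIV_def by (rule LIM_zero_cancel)
  qed
  then have "(\<lambda>\<mu>. l (ef \<mu>)) holomorphic_on {\<mu>. Re \<mu> < s0}"
    unfolding holomorphic_on_def field_differentiable_def by (blast intro: has_field_derivative_at_within)
  then show ?thesis unfolding symbol_def l_def by (intro holomorphic_intros) simp_all
qed

definition R0 where "R0 = exp s0"

text \<open>Periodicity makes the symbol a function of \<open>exp \<mu>\<close>, which is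
  holomorphic across the cut of \<open>Ln\<close>. Since the symbol is bounded on the entire half
  plane, the singularity at 0 is removable.\<close>

lemma symbol_descends:
  assumes A: "A \<in> bicommutant X N T"
  shows "\<exists>G K. G holomorphic_on ball 0 R0 \<and> 0 \<le> K \<and> (\<forall>z\<in>ball 0 R0. norm (G z) \<le> K) \<and>
     (\<forall>\<mu>. Re \<mu> < s0 \<longrightarrow> G (exp \<mu>) = symbol A \<mu>)"
proof -
  obtain K where K: "K \<ge> 0" "\<And>\<mu>. Re \<mu> < s0 \<Longrightarrow> norm (symbol A \<mu>) \<le> K" using symbol_bounded[OF A] by blast
  have R0: "0 < R0" by (simp add: R0_def)
  have exp_lt: "Re \<mu> < s0 \<longleftrightarrow> norm (exp \<mu>) < R0" for \<mu> :: complex by (simp add: R0_def norm_exp_eq_Re)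
  have per: "symbol A \<mu> = symbol A \<nu>" if eq: "exp \<mu> = exp (\<nu>::complex)" and \<nu>: "Re \<nu> < s0" for \<mu> \<nu>
  proof -
    obtain k :: int where "\<mu> = \<nu> + complex_of_real (real_of_int (2 * k) * pi) * \<i>" using eq unfolding exp_eq by blast
    then show ?thesis using symbol_periodic[OF A \<nu>, of k] by simp
  qed
  define g where "g z = symbol A (Ln z)" for z
  have g_exp: "g (exp \<mu>) = symbol A \<mu>" if "Re \<mu> < s0" for \<mu>
    unfolding g_def by (rule per[OF _ that]) simp
  have g_hol: "g holomorphic_on ball 0 R0 - {0}"
  proof (rule holomorphic_onI)
    fix z :: complex assume z: "z \<in> ball 0 R0 - {0}"
    define \<mu> where "\<mu> = Ln z"
    have \<mu>: "exp \<mu> = z" "Re \<mu> < s0" using z exp_lt[of \<mu>] by (auto simp: \<mu>_def)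
    \<comment> \<open>A neighbourhood of \<open>z\<close> on which \<open>Ln (u / z) + Ln z\<close>
      is a holomorphic logarithm, even if \<open>z\<close> lies on the cut of
      \<open>Ln\<close>.\<close>
    define S where "S = (\<lambda>u. u / z) -` (- \<real>\<^sub>\<le>\<^sub>0) \<inter> (ball 0 R0 - {0})"
    have oS: "open S" unfolding S_def using z
      by (intro open_Int open_vimage open_Diff continuous_intros) (auto simp: open_Compl)
    have zS: "z \<in> S" using z by (simp add: S_def)
    have e: "exp (Ln (u / z) + \<mu>) = u" if "u \<in> S" for u using that z \<mu> by (auto simp: S_def exp_add)
    have "(\<lambda>u. Ln (u / z) + \<mu>) holomorphic_on S" using z by (intro holomorphic_intros) (auto simp: S_def)
    moreover have "(\<lambda>u. Ln (u / z) + \<mu>) ` S \<subseteq> {\<mu>. Re \<mu> < s0}"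
    proof
      fix v assume "v \<in> (\<lambda>u. Ln (u / z) + \<mu>) ` S"
      then obtain u where u: "u \<in> S" "v = Ln (u / z) + \<mu>" by blast
      have "norm (exp v) < R0" unfolding u(2) e[OF u(1)] using u(1) by (simp add: S_def)
      then show "v \<in> {\<mu>. Re \<mu> < s0}" by (simp add: exp_lt)
    qed
    ultimately have "(symbol A \<circ> (\<lambda>u. Ln (u / z) + \<mu>)) holomorphic_on S"
      by (intro holomorphic_on_compose_gen[OF _ symbol_holomorphic[OF A]])
    then have "g holomorphic_on S"
    proof (rule holomorphic_transform)
      fix u assume u: "u \<in> S"
      have "Re (Ln (u / z) + \<mu>) < s0" unfolding exp_lt e[OF u] using u by (simp add: S_def)
      then show "(symbol A \<circ> (\<lambda>u. Ln (u / z) + \<mu>)) u = g u" using g_exp e[OF u] by (metis o_apply)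
    qed
    then have "g field_differentiable at z" using oS zS holomorphic_on_imp_differentiable_at by blast
    then show "g field_differentiable at z within ball 0 R0 - {0}" using field_differentiable_at_within by blast
  qed
  have g_bd: "norm (g z) \<le> K" if z: "z \<in> ball 0 R0 - {0}" for z
  proof -
    have "Re (Ln z) < s0" using z exp_lt[of "Ln z"] by auto
    then show ?thesis unfolding g_def by (rule K(2))
  qed
  have ev: "\<forall>\<^sub>F z in at 0. norm (g z) \<le> K"
    unfolding eventually_at using R0 g_bd by (intro exI[of _ R0]) auto
  have "0 \<in> interior (ball (0::complex) R0)" using R0 by simp
  then obtain G where G: "G holomorphic_on ball 0 R0" "\<forall>z\<in>ball 0 R0 - {0}. G z = g z"
    using holomorphic_on_extend_bounded[OF g_hol] ev by blast
  have G_bd: "norm (G z) \<le> K" if z: "z \<in> ball 0 R0" for z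
  proof (cases "z = 0")
    case True
    \<comment> \<open>At 0 the bound is inherited from nearby points by continuity.\<close>
    have "isCont G 0" using holomorphic_on_imp_continuous_on[OF G(1)] R0 by (simp add: continuous_on_eq_continuous_at)
    then have "((\<lambda>z. norm (G z)) \<longlongrightarrow> norm (G 0)) (at 0)" unfolding isCont_def by (rule tendsto_norm)
    moreover have "\<forall>\<^sub>F z in at 0. norm (G z) \<le> K"
      unfolding eventually_at using R0 g_bd G(2) by (intro exI[of _ R0]) auto
    ultimately show ?thesis unfolding True by (rule tendsto_upperbound) simp
  next
    case False
    then show ?thesis using z G(2) g_bd by auto
  qed
  have "G (exp \<mu>) = symbol A \<mu>" if "Re \<mu> < s0" for \<mu>
    using G(2) g_exp[OF that] that exp_lt[of \<mu>] by simp
  then show ?thesis using G(1) G_bd K(1) by blast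
qed

section \<open>Approximation by polynomials in the operator\<close>

text \<open>A dilate of \<open>G\<close> is holomorphic beyond the closed disc, hence uniformly
  close to a polynomial on it, with the same bound up to 1. The dilates tend to \<open>G\<close>
  pointwise on the open disc.\<close>

lemma bounded_poly_approx:
  assumes G: "G holomorphic_on ball 0 R0" and K: "\<And>z. z \<in> ball 0 R0 \<Longrightarrow> norm (G z) \<le> K"
  shows "\<exists>q :: nat \<Rightarrow> complex poly. (\<forall>n. \<forall>z\<in>cball 0 R0. norm (poly (q n) z) \<le> K + 1) \<and>
     (\<forall>z\<in>ball 0 R0. (\<lambda>n. poly (q n) z) \<longlonglongrightarrow> G z)"
proof -
  have R0: "0 < R0" by (simp add: R0_def)
  \<comment> \<open>The offset 2 keeps \<open>r 0\<close> positive.\<close>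
  define r where "r n = 1 - 1 / real (n + 2)" for n
  have r: "0 < r n" "r n < 1" for n by (auto simp: r_def)
  have in_ball: "of_real (r n) * z \<in> ball 0 R0" if "norm z < R0 / r n" for n and z :: complex
    using that r[of n] by (simp add: norm_mult field_simps)
  have sub: "norm z < R0 / r n" if "z \<in> cball 0 R0" for z :: complex and n
  proof -
    have "R0 * r n < R0" using r[of n] R0 by simp
    then have "R0 < R0 / r n" using r[of n] by (simp add: field_simps)
    then show ?thesis using that by simp
  qed
  have "\<exists>q. \<forall>z\<in>cball 0 R0. norm (G (of_real (r n) * z) - poly q z) < 1 / real (Suc n)" for n
  proof (rule holomorphic_poly_approx)
    show "(\<lambda>z. G (of_real (r n) * z)) holomorphic_on ball 0 (R0 / r n)"
      by (intro holomorphic_on_compose_gen[OF _ G, unfolded o_def] holomorphic_intros) (use in_ball in auto)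
    show "R0 < R0 / r n" using sub[of "of_real R0" n] R0 by simp
  qed (use R0 in auto)
  then obtain q where q: "\<And>n z. z \<in> cball 0 R0 \<Longrightarrow> norm (G (of_real (r n) * z) - poly (q n) z) < 1 / real (Suc n)"
    by metis
  have "norm (poly (q n) z) \<le> K + 1" if z: "z \<in> cball 0 R0" for n z
  proof -
    have "norm (G (of_real (r n) * z)) \<le> K" by (intro K in_ball sub z)
    moreover have "1 / real (Suc n) \<le> 1" by simp
    moreover have "norm (poly (q n) z) \<le> norm (G (of_real (r n) * z)) + norm (G (of_real (r n) * z) - poly (q n) z)"
      by (metis norm_triangle_sub norm_minus_commute)
    ultimately show ?thesis using q[OF z, of n] by linarith
  qed
  moreover have "(\<lambda>n. poly (q n) z) \<longlonglongrightarrow> G z" if z: "z \<in> ball 0 R0" for z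
  proof -
    have zc: "z \<in> cball 0 R0" using z by auto
    have "r \<longlonglongrightarrow> 1 - 0" unfolding r_def
      by (intro tendsto_diff tendsto_const LIMSEQ_ignore_initial_segment[OF lim_inverse_n', of 2])
    then have "(\<lambda>n. of_real (r n) * z) \<longlonglongrightarrow> of_real (1 - 0) * z" by (intro tendsto_intros)
    then have "(\<lambda>n. of_real (r n) * z) \<longlonglongrightarrow> z" by simp
    moreover have "isCont G z" using holomorphic_on_imp_continuous_on[OF G] z by (simp add: continuous_on_eq_continuous_at)
    ultimately have lim: "(\<lambda>n. G (of_real (r n) * z)) \<longlonglongrightarrow> G z" by (rule isCont_tendsto_compose[rotated])
    have "(\<lambda>n. G (of_real (r n) * z) - poly (q n) z) \<longlonglongrightarrow> 0"
    proof (rule Lim_null_comparison)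
      show "\<forall>\<^sub>F n in sequentially. norm (G (of_real (r n) * z) - poly (q n) z) \<le> 1 / real (Suc n)"
        using q[OF zc] by (intro always_eventually allI less_imp_le)
      show "(\<lambda>n. 1 / real (Suc n)) \<longlonglongrightarrow> 0" by (rule lim_inverse_n'[THEN LIMSEQ_Suc])
    qed
    from tendsto_diff[OF lim this] show ?thesis by simp
  qed
  ultimately show ?thesis by blast
qed

lemma poly_op_ef:
  assumes \<mu>: "Re \<mu> < s0" shows "poly_op X q T (ef \<mu>) = (\<lambda>z. poly q (exp \<mu>) * ef \<mu> z)"
proof -
  have T1: "T (ef \<mu>) = (\<lambda>z. exp \<mu> * ef \<mu> z)" unfolding T_def using comp_ef[OF \<mu>, of 1] by simp
  have "(T ^^ i) (ef \<mu>) = (\<lambda>z. exp \<mu> ^ i * ef \<mu> z)" for i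
  proof (induction i)
    case (Suc i)
    have "(T ^^ Suc i) (ef \<mu>) = T (\<lambda>z. exp \<mu> ^ i * ef \<mu> z)" using Suc by simp
    also have "\<dots> = (\<lambda>z. exp \<mu> ^ i * T (ef \<mu>) z)" by (rule bounded_opsD(3)[OF T_bounded ef_Hp[OF \<mu>]])
    finally show ?case unfolding T1 by (simp add: mult_ac)
  qed simp
  then show ?thesis using ef_Hp[OF \<mu>] by (simp add: poly_op_def poly_altdef sum_distrib_right mult.assoc)
qed

text \<open>The operators \<open>Q n\<close> are uniformly bounded, so their convergence to
  \<open>A\<close> in norm at each vector passes from the exponentials to sums, multiples and
  limits, hence to all of \<open>E = Hp p\<close>. It implies weak operator convergence.\<close>

lemma bicommutant_subset_alg_closure:
  assumes bound: "\<And>q. op_norm X N (poly_op X q T) \<le> C * (SUP z\<in>cball 0 R0. norm (poly q z))" and C: "0 < C"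
    and A: "A \<in> bicommutant X N T"
  shows "A \<in> weak_operator_topology X N closure_of alg_op X T"
proof -
  have R0: "0 < R0" by (simp add: R0_def)
  have Ab: "A \<in> bounded_ops X N" by (rule bicommutant_bounded[OF A])
  obtain KA where KA: "KA \<ge> 0" "\<And>f. f \<in> X \<Longrightarrow> N (A f) \<le> KA * N f" using bounded_ops_bound[OF Ab] by blast
  obtain G K where G: "G holomorphic_on ball 0 R0" "0 \<le> K" "\<And>z. z \<in> ball 0 R0 \<Longrightarrow> norm (G z) \<le> K"
     "\<And>\<mu>. Re \<mu> < s0 \<Longrightarrow> G (exp \<mu>) = symbol A \<mu>"
    using symbol_descends[OF A] by blast
  obtain q :: "nat \<Rightarrow> complex poly" where q: "\<And>n z. z \<in> cball 0 R0 \<Longrightarrow> norm (poly (q n) z) \<le> K + 1"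
     "\<And>z. z \<in> ball 0 R0 \<Longrightarrow> (\<lambda>n. poly (q n) z) \<longlonglongrightarrow> G z"
    using bounded_poly_approx[OF G(1,3)] by blast
  define Q where "Q n = poly_op X (q n) T" for n
  have Qb: "Q n \<in> bounded_ops X N" for n unfolding Q_def by (rule poly_op_bounded[OF p1(1) T_bounded])
  define KQ where "KQ = C * (K + 1)"
  have KQ: "0 \<le> KQ" using C G(2) by (simp add: KQ_def)
  have QK: "N (Q n f) \<le> KQ * N f" if f: "f \<in> X" for n f
  proof -
    have "(SUP z\<in>cball 0 R0. norm (poly (q n) z)) \<le> K + 1" using R0 q(1) by (intro cSUP_least) auto
    then have "C * (SUP z\<in>cball 0 R0. norm (poly (q n) z)) \<le> KQ" unfolding KQ_def using C by (intro mult_left_mono) auto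
    then have "op_norm X N (Q n) \<le> KQ" using bound[of "q n"] unfolding Q_def by linarith
    then have "op_norm X N (Q n) * N f \<le> KQ * N f" by (intro mult_right_mono) (auto simp: Hp_norm_nonneg)
    then show ?thesis using op_norm_bound[OF p1(1) Qb f, of n] by linarith
  qed
  have QX: "f \<in> X \<Longrightarrow> Q n f \<in> X" and AX: "f \<in> X \<Longrightarrow> A f \<in> X" for f n
    using bounded_opsD(1)[OF Qb] bounded_opsD(1)[OF Ab] by auto
  define D where "D n f = (\<lambda>z. Q n f z - A f z)" for n f
  have DX: "f \<in> X \<Longrightarrow> D n f \<in> X" for n f unfolding D_def by (intro Hp_diff p1 QX AX)
  have "(\<lambda>n. N (D n f)) \<longlonglongrightarrow> 0" if "f \<in> E" for f
    using that
  proof (induction rule: exp_span.induct)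
    case (base \<mu>)
    have "exp \<mu> \<in> ball 0 R0" using base by (simp add: R0_def norm_exp_eq_Re)
    then have "(\<lambda>n. poly (q n) (exp \<mu>) - G (exp \<mu>)) \<longlonglongrightarrow> G (exp \<mu>) - G (exp \<mu>)" by (intro tendsto_intros q(2))
    from tendsto_mult_right[OF tendsto_norm[OF this], of "N (ef \<mu>)"]
    have "(\<lambda>n. norm (poly (q n) (exp \<mu>) - G (exp \<mu>)) * N (ef \<mu>)) \<longlonglongrightarrow> 0" by simp
    moreover have "N (D n (ef \<mu>)) = norm (poly (q n) (exp \<mu>) - G (exp \<mu>)) * N (ef \<mu>)" for n
    proof -
      have "D n (ef \<mu>) = (\<lambda>z. (poly (q n) (exp \<mu>) - G (exp \<mu>)) * ef \<mu> z)"
        unfolding D_def Q_def poly_op_ef[OF base] bicommutant_ef[OF A base] G(4)[OF base] by (simp add: left_diff_distrib)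
      then show ?thesis using Hp_norm_cmult[OF p1(1) ef_Hp[OF base]] by simp
    qed
    ultimately show ?case by (simp add: ef_def)
  next
    case (add f g)
    have f: "f \<in> X" and g: "g \<in> X" using add.hyps E_Hp by auto
    have eq: "D n (\<lambda>z. f z + g z) = (\<lambda>z. D n f z + D n g z)" for n
      unfolding D_def bounded_opsD(2)[OF Qb f g] bounded_opsD(2)[OF Ab f g] by (auto simp: fun_eq_iff)
    have "(\<lambda>n. 2 * (N (D n f) + N (D n g))) \<longlonglongrightarrow> 2 * (0 + 0)" by (intro tendsto_intros add.IH)
    then have "(\<lambda>n. 2 * (N (D n f) + N (D n g))) \<longlonglongrightarrow> 0" by simp
    then show ?case
      by (rule Lim_null_comparison[rotated])
        (use Hp_add(2)[OF p1(1) DX[OF f] DX[OF g]] in \<open>auto simp: eq Hp_norm_nonneg intro!: always_eventually\<close>)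
  next
    case (scale f c)
    have f: "f \<in> X" using scale.hyps E_Hp by auto
    have eq: "D n (\<lambda>z. c * f z) = (\<lambda>z. c * D n f z)" for n
      unfolding D_def bounded_opsD(3)[OF Qb f] bounded_opsD(3)[OF Ab f] by (auto simp: fun_eq_iff right_diff_distrib)
    have "(\<lambda>n. norm c * N (D n f)) \<longlonglongrightarrow> norm c * 0" by (intro tendsto_intros scale.IH)
    then show ?case unfolding eq Hp_norm_cmult[OF p1(1) DX[OF f]] by simp
  next
    case (limit f)
    show ?case
    proof (rule tendstoI)
      fix e :: real assume e: "0 < e"
      \<comment> \<open>The triangle inequality with factor 2 is used twice, hence the 4. Adding 1
        keeps \<open>M\<close> positive.\<close>
      define M where "M = 4 * (KQ + KA) + 1"
      have M: "0 < M" using KQ KA by (simp add: M_def)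
      obtain g where g: "g \<in> E" "(\<lambda>n. N (D n g)) \<longlonglongrightarrow> 0" "N (\<lambda>z. f z - g z) < e / (2 * M)"
      proof -
        have "0 < e / (2 * M)" using e M by simp
        then have "\<exists>g. (g \<in> E \<and> (\<lambda>n. N (D n g)) \<longlonglongrightarrow> 0) \<and> N (\<lambda>z. f z - g z) < e / (2 * M)"
          using limit.IH by (elim allE impE)
        then show ?thesis by (elim exE conjE) (rule that)
      qed
      have gX: "g \<in> X" by (rule E_Hp[OF g(1)])
      let ?u = "\<lambda>z. f z - g z"
      have u: "?u \<in> X" by (intro Hp_diff p1 limit gX)
      have f_eq: "f = (\<lambda>z. ?u z + g z)" by simp
      have "\<forall>\<^sub>F n in sequentially. N (D n g) < e / 4" using order_tendstoD(2)[OF g(2), of "e/4"] e by simp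
      then show "\<forall>\<^sub>F n in sequentially. dist (N (D n f)) 0 < e"
      proof eventually_elim
        case (elim n)
        define s t where "s = (KQ + KA) * N ?u" and "t = M * N ?u"
        have "D n f = (\<lambda>z. D n ?u z + D n g z)"
          by (subst f_eq) (simp only: D_def bounded_opsD(2)[OF Qb u gX] bounded_opsD(2)[OF Ab u gX], simp add: fun_eq_iff)
        then have "N (D n f) \<le> 2 * (N (D n ?u) + N (D n g))" using Hp_add(2)[OF p1(1) DX[OF u] DX[OF gX]] by simp
        moreover have "N (D n ?u) \<le> 2 * s"
        proof -
          have "N (D n ?u) \<le> 2 * (N (Q n ?u) + N (A ?u))" unfolding D_def by (intro Hp_diff p1 QX AX u)
          also have "N (Q n ?u) + N (A ?u) \<le> s"
            unfolding s_def using QK[OF u, of n] KA(2)[OF u] by (simp add: algebra_simps)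
          finally show ?thesis by simp
        qed
        ultimately have "N (D n f) \<le> 4 * s + 2 * N (D n g)" by simp
        also have "4 * s \<le> t" unfolding s_def t_def using Hp_norm_nonneg[of p ?u] by (simp add: M_def algebra_simps)
        also have "t + 2 * N (D n g) < e / 2 + 2 * (e / 4)"
        proof (rule add_strict_mono)
          show "t < e / 2" unfolding t_def using g(3) M by (simp add: field_simps)
          show "2 * N (D n g) < 2 * (e / 4)" using elim by simp
        qed
        finally have "N (D n f) < e" by simp
        then show ?case using Hp_norm_nonneg[of p "D n f"] by simp
      qed
    qed
  qed
  then have D_lim: "(\<lambda>n. N (D n f)) \<longlonglongrightarrow> 0" if "f \<in> X" for f using that E_eq_Hp by blast
  show ?thesis
  proof (rule closure_of_sequence[where T=Q])
    fix l f assume l: "l \<in> bounded_functionals X N" and f: "f \<in> X"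
    obtain L where "\<forall>f\<in>X. norm (l f) \<le> L * N f" using l by (auto simp: bounded_functionals_def)
    then have L: "\<And>f. f \<in> X \<Longrightarrow> norm (l f) \<le> L * N f" by blast
    have l_add: "l (\<lambda>z. f z + g z) = l f + l g" if "f \<in> X" "g \<in> X" for f g using l that by (simp add: bounded_functionals_def)
    have Q_eq: "Q n f = (\<lambda>z. D n f z + A f z)" for n by (simp add: D_def)
    have "l (Q n f) - l (A f) = l (D n f)" for n
      using l_add[OF DX[OF f] AX[OF f], of n] Q_eq[of n] by simp
    then have "norm (l (Q n f) - l (A f)) \<le> L * N (D n f)" for n using L[OF DX[OF f]] by simp
    moreover have "(\<lambda>n. L * N (D n f)) \<longlonglongrightarrow> 0" using tendsto_mult_right_zero[OF D_lim[OF f]] by simp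
    ultimately have "(\<lambda>n. l (Q n f) - l (A f)) \<longlonglongrightarrow> 0"
      by (intro Lim_null_comparison[of "\<lambda>n. l (Q n f) - l (A f)" "\<lambda>n. L * N (D n f)"] always_eventually) auto
    then show "(\<lambda>n. l (Q n f)) \<longlonglongrightarrow> l (A f)" by (rule LIM_zero_cancel)
  next
    show "Q n \<in> alg_op X T" for n by (auto simp: alg_op_def Q_def)
  qed (auto intro: Hp_zero Ab Qb)
qed

lemma double_commutant:
  assumes "\<exists>C>0. \<forall>q. op_norm X N (poly_op X q T) \<le> C * (SUP z\<in>cball 0 R0. norm (poly q z))"
  shows "double_commutant_property X N T"
  unfolding double_commutant_property_def
  using T_bounded alg_closure_subset_bicommutant[OF p1(1) T_bounded] bicommutant_subset_alg_closure assms by blast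

end

theorem theorem3p7:
  fixes p a b \<gamma> :: real
    and \<phi> h :: "complex \<Rightarrow> complex"
    and \<Phi> :: "real \<Rightarrow> complex \<Rightarrow> complex"
    and \<Omega> :: "complex set"
  assumes "1 < p"
    and "\<phi> holomorphic_on \<D>" and "\<phi> ` \<D> \<subseteq> \<D>"
    and "hyperbolic_semiflow \<Phi>" and "\<forall>z\<in>\<D>. \<phi> z = \<Phi> 1 z"
    and "Koenigs_function \<Phi> h" and "\<Omega> = h ` \<D>"
    and "interior (closure \<Omega>) = \<Omega>"
    and "finite (components (- closure \<Omega>))" and "card (components (- closure \<Omega>)) \<le> 2"
    and "smallest_horizontal_strip \<Omega> a b" and "\<gamma> = b - a"
    and "\<not> (\<exists>c d. c < d \<and> horizontal_strip c d \<subseteq> \<Omega>)"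
    and "\<exists>C>0. \<forall>q :: complex poly.
           op_norm (Hp p) (Hp_norm p) (poly_op (Hp p) q (comp_op p \<phi>))
             \<le> C * (SUP z\<in>cball 0 (exp (pi / (p * \<gamma>))). norm (poly q z))"
  shows "double_commutant_property (Hp p) (Hp_norm p) (comp_op p \<phi>)"
proof -
  have K: "h holomorphic_on \<D>" "inj_on h \<D>"
    "\<And>t z. 0 \<le> t \<Longrightarrow> z \<in> \<D> \<Longrightarrow> h z + of_real t \<in> h ` \<D> \<and> \<Phi> t z = inv_into \<D> h (h z + of_real t)"
    using assms(6) by (auto simp: Koenigs_function_def)
  have S: "a < b" "\<Omega> \<subseteq> horizontal_strip a b" using assms(11) by (auto simp: smallest_horizontal_strip_def)
  have F: "\<And>t. 0 \<le> t \<Longrightarrow> \<Phi> t holomorphic_on \<D> \<and> \<Phi> t ` \<D> \<subseteq> \<D>"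
    using assms(4) by (simp add: hyperbolic_semiflow_def holomorphic_semiflow_def)
  interpret koenigs_semiflow p a b h \<Phi>
  proof
    show "a < Im (h z) \<and> Im (h z) < b" if "z \<in> \<D>" for z
    proof -
      have "h z \<in> horizontal_strip a b" using S(2) that assms(7) by blast
      then show ?thesis by (simp add: horizontal_strip_def)
    qed
    show "h (\<Phi> t z) = h z + of_real t" if "0 \<le> t" "z \<in> \<D>" for t z
      using K(3)[OF that] f_inv_into_f by metis
  qed (use assms K S F in \<open>simp_all only: not_False_eq_True\<close>)
  \<comment> \<open>\<open>comp_op\<close> evaluates the symbol map only on the disc, where \<phi>
    agrees with \<open>\<Phi> 1\<close>.\<close>
  have T: "comp_op p \<phi> = T"
    unfolding T_def comp_op_def using assms(5) by (auto simp: fun_eq_iff restrict_def)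
  have R: "R0 = exp (pi / (p * \<gamma>))" by (simp add: R0_def s0_def assms(12))
  show ?thesis
    unfolding T by (rule double_commutant) (use assms(14) in \<open>simp only: T R\<close>)
qed

end
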